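(* Let $k$ be an algebraically closed field. Let $H$ and $A$ be finite groups with $A$ acting on $H$ via group automorphisms. For a positive integer $n\in\mathbb{Z}_{>0}$ set $G=(H\rtimes A)\wr S_n=H^n\rtimes(A\wr S_n)$ as well as $N=H^n\trianglelefteq G$. If every simple $kH$-module $X_0$ extends to a $kS_{H\rtimes A}(X_0)$-module, then every simple $kN$-module $X$ extends to a $kS_G(X)$-module.
   Context: All modules are finitely generated; $k$ has arbitrary characteristic $\ell\ge 0$. For a finite group $G$ with normal subgroup $N$, a $kN$-module $M$ and $g\in G$, $\mathrm{ad}(g)M$ is the $kN$-module with the same underlying space as $M$ on which $n\in N$ acts as $g^{-1}ng$ acts on $M$. The stabilizer of $M$ in $G$ is $S_G(M)=\{g\in G : \mathrm{ad}(g)M\cong M\}$. A $kN$-module $X$ extends to a $kS_G(X)$-module if there is a $kS_G(X)$-module $Y$ with $\mathrm{Res}^{S_G(X)}_N Y\cong X$. $S_n$ is the symmetric group on $n$ letters and $B\wr S_n=B^n\rtimes S_n$ is the wreath product with $S_n$ permuting the factors. *)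

theory Defs
  imports
    "HOL-Algebra.Product_Groups"
    "HOL-Algebra.Bij"
    "HOL-Algebra.Sym_Groups"
    "Jordan_Normal_Form.VS_Connect"
begin

section \<open>Semidirect and wreath products\<close>

definition semidirect ::
    "('h, 'p) monoid_scheme \<Rightarrow> ('a, 'q) monoid_scheme \<Rightarrow> ('a \<Rightarrow> 'h \<Rightarrow> 'h) \<Rightarrow> ('h \<times> 'a) monoid" where
  "semidirect H A \<theta> =
     \<lparr>carrier = carrier H \<times> carrier A,
      monoid.mult = (\<lambda>(h, a) (h', a'). (h \<otimes>\<^bsub>H\<^esub> \<theta> a h', a \<otimes>\<^bsub>A\<^esub> a')),
      one = (\<one>\<^bsub>H\<^esub>, \<one>\<^bsub>A\<^esub>)\<rparr>"

definition normal_factor ::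
    "('h, 'p) monoid_scheme \<Rightarrow> ('a, 'q) monoid_scheme \<Rightarrow> ('h \<times> 'a) set" where
  "normal_factor H A = carrier H \<times> {\<one>\<^bsub>A\<^esub>}"

abbreviation power_group :: "('b, 'p) monoid_scheme \<Rightarrow> nat \<Rightarrow> (nat \<Rightarrow> 'b) monoid" where
  "power_group B n \<equiv> product_group {1..n} (\<lambda>_. B)"

text \<open>The inverse makes this a left action: \<open>\<sigma>\<close> moves the \<open>i\<close>-th component to position \<open>\<sigma> i\<close>.\<close>

definition permute_factors ::
    "('b, 'p) monoid_scheme \<Rightarrow> nat \<Rightarrow> (nat \<Rightarrow> nat) \<Rightarrow> (nat \<Rightarrow> 'b) \<Rightarrow> (nat \<Rightarrow> 'b)" where
  "permute_factors B n \<sigma> =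
     (\<lambda>b \<in> carrier (power_group B n). \<lambda>i\<in>{1..n}. b ((inv\<^bsub>sym_group n\<^esub> \<sigma>) i))"

definition wreath_sym ::
    "('b, 'p) monoid_scheme \<Rightarrow> nat \<Rightarrow> ((nat \<Rightarrow> 'b) \<times> (nat \<Rightarrow> nat)) monoid" where
  "wreath_sym B n = semidirect (power_group B n) (sym_group n) (permute_factors B n)"

text \<open>The copy of \<open>H\<^sup>n\<close> inside \<open>(H \<rtimes> A) \<wr> S\<^sub>n\<close>.\<close>

definition power_factor ::
    "('h, 'p) monoid_scheme \<Rightarrow> ('a, 'q) monoid_scheme \<Rightarrow> nat
      \<Rightarrow> ((nat \<Rightarrow> 'h \<times> 'a) \<times> (nat \<Rightarrow> nat)) set" where
  "power_factor H A n = (\<Pi>\<^sub>E i\<in>{1..n}. normal_factor H A) \<times> {\<one>\<^bsub>sym_group n\<^esub>}"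

lemma action_auto:
  assumes "\<theta> \<in> hom A (AutoGroup H)" "a \<in> carrier A"
  shows "\<theta> a \<in> hom H H" "bij_betw (\<theta> a) (carrier H) (carrier H)"
  using assms by (auto simp: hom_def AutoGroup_def auto_def BijGroup_def Bij_def)

lemma action_closed:
  assumes "\<theta> \<in> hom A (AutoGroup H)" "a \<in> carrier A" "h \<in> carrier H"
  shows "\<theta> a h \<in> carrier H"
  using action_auto[OF assms(1,2)] assms(3) by (auto simp: hom_def)

lemma action_mult:
  assumes "\<theta> \<in> hom A (AutoGroup H)" "a \<in> carrier A" "b \<in> carrier A" "h \<in> carrier H"
  shows "\<theta> (a \<otimes>\<^bsub>A\<^esub> b) h = \<theta> a (\<theta> b h)"
proof -
  have "\<theta> a \<in> Bij (carrier H)" "\<theta> b \<in> Bij (carrier H)"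
    using assms by (auto simp: hom_def AutoGroup_def auto_def BijGroup_def)
  then show ?thesis
    using assms by (simp add: hom_def AutoGroup_def BijGroup_def compose_def)
qed

lemma action_one:
  assumes "group H" "group A" "\<theta> \<in> hom A (AutoGroup H)" "h \<in> carrier H"
  shows "\<theta> \<one>\<^bsub>A\<^esub> h = h"
proof -
  interpret A: group A by fact
  have "\<theta> \<one>\<^bsub>A\<^esub> (\<theta> \<one>\<^bsub>A\<^esub> h) = \<theta> \<one>\<^bsub>A\<^esub> h"
    using action_mult[OF assms(3), of "\<one>\<^bsub>A\<^esub>" "\<one>\<^bsub>A\<^esub>" h] assms(4) by simp
  moreover have "inj_on (\<theta> \<one>\<^bsub>A\<^esub>) (carrier H)"
    using action_auto(2)[OF assms(3)] by (auto simp: bij_betw_def)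
  ultimately show ?thesis
    using action_closed[OF assms(3) A.one_closed assms(4)] assms(4) by (auto dest: inj_onD)
qed

lemma semidirect_is_group:
  assumes "group H" "group A" "\<theta> \<in> hom A (AutoGroup H)"
  shows "group (semidirect H A \<theta>)"
proof -
  interpret H: group H by fact
  interpret A: group A by fact
  note [simp] = action_closed[OF assms(3)] action_mult[OF assms(3)] action_one[OF assms]
  have m: "\<theta> a (x \<otimes>\<^bsub>H\<^esub> y) = \<theta> a x \<otimes>\<^bsub>H\<^esub> \<theta> a y"
    if "a \<in> carrier A" "x \<in> carrier H" "y \<in> carrier H" for a x y
    using action_auto(1)[OF assms(3) that(1)] that by (auto simp: hom_def)
  show ?thesis
  proof (rule groupI)
    fix p assume "p \<in> carrier (semidirect H A \<theta>)"
    then obtain x a where p: "p = (x, a)" "x \<in> carrier H" "a \<in> carrier A"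
      by (auto simp: semidirect_def)
    have "\<theta> (inv\<^bsub>A\<^esub> a) (inv\<^bsub>H\<^esub> x) \<otimes>\<^bsub>H\<^esub> \<theta> (inv\<^bsub>A\<^esub> a) x = \<theta> (inv\<^bsub>A\<^esub> a) (inv\<^bsub>H\<^esub> x \<otimes>\<^bsub>H\<^esub> x)"
      by (rule m[symmetric]) (use p in auto)
    also have "\<dots> = \<one>\<^bsub>H\<^esub>"
      using p group_hom.hom_one[of H H "\<theta> (inv\<^bsub>A\<^esub> a)"] action_auto(1)[OF assms(3), of "inv\<^bsub>A\<^esub> a"] assms(1)
      by (simp add: group_hom_def group_hom_axioms_def)
    finally show "\<exists>q\<in>carrier (semidirect H A \<theta>). q \<otimes>\<^bsub>semidirect H A \<theta>\<^esub> p = \<one>\<^bsub>semidirect H A \<theta>\<^esub>"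
      using p by (intro bexI[of _ "(\<theta> (inv\<^bsub>A\<^esub> a) (inv\<^bsub>H\<^esub> x), inv\<^bsub>A\<^esub> a)"]) (auto simp: semidirect_def)
  qed (auto simp: semidirect_def m H.m_assoc A.m_assoc)
qed

lemma normal_factor_normal:
  assumes "group H" "group A" "\<theta> \<in> hom A (AutoGroup H)"
  shows "normal_factor H A \<lhd> semidirect H A \<theta>"
proof -
  interpret H: group H by fact
  interpret A: group A by fact
  interpret S: group "semidirect H A \<theta>" using assms by (rule semidirect_is_group)
  have "snd \<in> hom (semidirect H A \<theta>) A"
    using action_closed[OF assms(3)] by (auto simp: hom_def semidirect_def)
  then interpret group_hom "semidirect H A \<theta>" A snd
    by unfold_locales
  have "kernel (semidirect H A \<theta>) A snd = normal_factor H A"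
    by (auto simp: kernel_def semidirect_def normal_factor_def)
  with normal_kernel show ?thesis by simp
qed

lemma normal_factor_iso:
  assumes "group H" "group A" "\<theta> \<in> hom A (AutoGroup H)"
  shows "(\<lambda>h. (h, \<one>\<^bsub>A\<^esub>)) \<in> iso H ((semidirect H A \<theta>)\<lparr>carrier := normal_factor H A\<rparr>)"
proof -
  interpret A: group A by fact
  show ?thesis using action_one[OF assms]
  by (auto simp: iso_def hom_def semidirect_def normal_factor_def bij_betw_def inj_on_def)
qed

lemma inv_sym: "\<sigma> permutes {1..n} \<Longrightarrow> inv\<^bsub>sym_group n\<^esub> \<sigma> = inv' \<sigma>"
  using sym_group_inv_equality[of \<sigma> n] by (simp add: sym_group_carrier)

lemma permute_factors_hom:
  assumes "group B"
  shows "permute_factors B n \<in> hom (sym_group n) (AutoGroup (power_group B n))"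
proof -
  interpret B: group B by fact
  let ?P = "power_group B n"
  interpret S: group "sym_group n" by (rule sym_group_is_group)
  have pf: "permute_factors B n \<sigma> b = (\<lambda>i\<in>{1..n}. b (inv' \<sigma> i))"
    if "\<sigma> permutes {1..n}" "b \<in> carrier ?P" for \<sigma> b
    using that by (simp add: permute_factors_def inv_sym)
  have inr: "inv' \<sigma> i \<in> {1..n}" if "\<sigma> permutes {1..n}" "i \<in> {1..n}" for \<sigma> i
    using that permutes_inv permutes_in_image by metis
  have cl: "permute_factors B n \<sigma> b \<in> carrier ?P"
    if "\<sigma> permutes {1..n}" "b \<in> carrier ?P" for \<sigma> b
    unfolding pf[OF that] using that(2) inr[OF that(1)] by (auto simp: PiE_iff)
  have comp: "permute_factors B n (\<sigma> \<circ> \<tau>) b = permute_factors B n \<sigma> (permute_factors B n \<tau> b)"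
    if "\<sigma> permutes {1..n}" "\<tau> permutes {1..n}" "b \<in> carrier ?P" for \<sigma> \<tau> b
  proof -
    have "inv' (\<sigma> \<circ> \<tau>) = inv' \<tau> \<circ> inv' \<sigma>"
      using that by (intro o_inv_distrib) (auto intro: permutes_bij)
    then show ?thesis
      unfolding pf[OF that(1) cl[OF that(2,3)]] pf[OF permutes_compose[OF that(2,1)] that(3)]
      using inr[OF that(1)] by (intro restrict_ext) (simp add: pf[OF that(2,3)])
  qed
  have idp: "permute_factors B n id b = b" if "b \<in> carrier ?P" for b
    using that by (subst pf) (auto simp: permutes_id PiE_iff extensional_def fun_eq_iff restrict_def)
  have bij: "bij_betw (permute_factors B n \<sigma>) (carrier ?P) (carrier ?P)"
    if "\<sigma> permutes {1..n}" for \<sigma>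
    using that permutes_inv[OF that] comp[of \<sigma> "inv' \<sigma>"] comp[of "inv' \<sigma>" \<sigma>] idp permutes_inv_o[OF that] cl
    by (intro bij_betw_byWitness[where f' = "permute_factors B n (inv' \<sigma>)"])
      (auto simp del: carrier_product_group)
  have aut: "permute_factors B n \<sigma> \<in> auto ?P" if "\<sigma> permutes {1..n}" for \<sigma>
  proof -
    have "permute_factors B n \<sigma> \<in> hom ?P ?P"
    proof (rule homI)
      fix x y assume xy: "x \<in> carrier ?P" "y \<in> carrier ?P"
      then have "x \<otimes>\<^bsub>?P\<^esub> y \<in> carrier ?P" by (auto simp: PiE_iff)
      then show "permute_factors B n \<sigma> (x \<otimes>\<^bsub>?P\<^esub> y)
          = permute_factors B n \<sigma> x \<otimes>\<^bsub>?P\<^esub> permute_factors B n \<sigma> y"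
        using xy inr[OF that] by (auto simp: pf[OF that] intro!: restrict_ext simp del: carrier_product_group)
    qed (rule cl[OF that])
    with bij[OF that] show ?thesis
      by (auto simp: auto_def Bij_def permute_factors_def)
  qed
  show ?thesis
  proof (rule homI)
    fix \<sigma> \<tau> assume "\<sigma> \<in> carrier (sym_group n)" "\<tau> \<in> carrier (sym_group n)"
    then have st: "\<sigma> permutes {1..n}" "\<tau> permutes {1..n}" by (auto simp: sym_group_carrier)
    then have "permute_factors B n (\<sigma> \<circ> \<tau>) = compose (carrier ?P) (permute_factors B n \<sigma>) (permute_factors B n \<tau>)"
      using comp by (auto simp: fun_eq_iff compose_def permute_factors_def restrict_def simp del: carrier_product_group)
    then show "permute_factors B n (\<sigma> \<otimes>\<^bsub>sym_group n\<^esub> \<tau>) =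
       permute_factors B n \<sigma> \<otimes>\<^bsub>AutoGroup ?P\<^esub> permute_factors B n \<tau>"
      using aut[OF st(1)] aut[OF st(2)]
      by (simp add: AutoGroup_def BijGroup_def auto_def sym_group_mult)
  qed (use aut in \<open>auto simp: AutoGroup_def sym_group_carrier\<close>)
qed

lemma power_is_group: "group B \<Longrightarrow> group (power_group B n)"
  by simp

lemma wreath_sym_is_group: "group B \<Longrightarrow> group (wreath_sym B n)"
  unfolding wreath_sym_def
  by (intro semidirect_is_group power_is_group sym_group_is_group permute_factors_hom)


text \<open>
  The identification \<open>(H \<rtimes> A) \<wr> S\<^sub>n = H\<^sup>n \<rtimes> (A \<wr> S\<^sub>n)\<close>, under which \<^term>\<open>power_factor H A n\<close>
  is the normal factor \<open>H\<^sup>n\<close>.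
\<close>

definition power_action ::
    "('h, 'p) monoid_scheme \<Rightarrow> nat \<Rightarrow> ('a \<Rightarrow> 'h \<Rightarrow> 'h)
      \<Rightarrow> (nat \<Rightarrow> 'a) \<times> (nat \<Rightarrow> nat) \<Rightarrow> (nat \<Rightarrow> 'h) \<Rightarrow> (nat \<Rightarrow> 'h)" where
  "power_action H n \<theta> = (\<lambda>(a, \<sigma>). \<lambda>h \<in> carrier (power_group H n).
     \<lambda>i\<in>{1..n}. \<theta> (a i) (permute_factors H n \<sigma> h i))"

definition unzip_wreath ::
    "nat \<Rightarrow> (nat \<Rightarrow> 'h \<times> 'a) \<times> (nat \<Rightarrow> nat) \<Rightarrow> (nat \<Rightarrow> 'h) \<times> (nat \<Rightarrow> 'a) \<times> (nat \<Rightarrow> nat)" where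
  "unzip_wreath n = (\<lambda>(f, \<sigma>). (\<lambda>i\<in>{1..n}. fst (f i), \<lambda>i\<in>{1..n}. snd (f i), \<sigma>))"

lemma inv_sym_mem: "\<sigma> permutes {1..n} \<Longrightarrow> i \<in> {1..n} \<Longrightarrow> inv' \<sigma> i \<in> {1..n}"
  using permutes_inv permutes_in_image by metis

lemma wreath_sym_iso:
  assumes "group H" "group A" "\<theta> \<in> hom A (AutoGroup H)"
  shows "unzip_wreath n \<in> iso (wreath_sym (semidirect H A \<theta>) n)
           (semidirect (power_group H n) (wreath_sym A n) (power_action H n \<theta>))"
    (is "_ \<in> iso ?G ?K")
proof -
  have "unzip_wreath n \<in> hom ?G ?K"
  proof (rule homI)
    fix x assume "x \<in> carrier ?G"
    then obtain f \<sigma> where x: "x = (f, \<sigma>)" and f: "\<sigma> \<in> carrier (sym_group n)"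
      "\<forall>i\<in>{1..n}. f i \<in> carrier H \<times> carrier A"
      by (auto simp: wreath_sym_def semidirect_def PiE_iff)
    then show "unzip_wreath n x \<in> carrier ?K"
      by (auto simp: unzip_wreath_def wreath_sym_def semidirect_def mem_Times_iff)
  next
    fix x y assume "x \<in> carrier ?G" "y \<in> carrier ?G"
    then obtain f \<sigma> g \<tau> where xy: "x = (f, \<sigma>)" "y = (g, \<tau>)" 
      and f: "f \<in> carrier (power_group (semidirect H A \<theta>) n)" "\<sigma> permutes {1..n}"
      and g: "g \<in> carrier (power_group (semidirect H A \<theta>) n)" "\<tau> permutes {1..n}"
      by (auto simp: wreath_sym_def semidirect_def sym_group_carrier)
    have "(\<lambda>i\<in>{1..n}. fst (g i)) \<in> carrier (power_group H n)" "(\<lambda>i\<in>{1..n}. snd (g i)) \<in> carrier (power_group A n)"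
      using g by (fastforce simp: semidirect_def PiE_iff)+
    with f g inv_sym_mem[OF f(2)] show "unzip_wreath n (x \<otimes>\<^bsub>?G\<^esub> y) = unzip_wreath n x \<otimes>\<^bsub>?K\<^esub> unzip_wreath n y"
      unfolding xy
      by (simp add: unzip_wreath_def wreath_sym_def semidirect_def permute_factors_def inv_sym
          power_action_def case_prod_beta fun_eq_iff del: carrier_product_group)
  qed
  moreover have "bij_betw (unzip_wreath n) (carrier ?G) (carrier ?K)"
    unfolding bij_betw_def
  proof (intro conjI inj_onI equalityI subsetI)
    fix x y assume "x \<in> carrier ?G" "y \<in> carrier ?G" and eq: "unzip_wreath n x = unzip_wreath n y"
    then obtain f g \<sigma> where xy: "x = (f, \<sigma>)" "y = (g, \<sigma>)"
      and f: "f \<in> extensional {1..n}" "g \<in> extensional {1..n}"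
      by (cases x; cases y) (auto simp: wreath_sym_def semidirect_def PiE_iff unzip_wreath_def)
    have "f i = g i" if "i \<in> {1..n}" for i
      using eq that unfolding xy unzip_wreath_def
      by (auto simp: prod_eq_iff dest!: fun_cong[where x = i])
    then show "x = y" using extensionalityI[OF f] xy by simp
  next
    fix y assume "y \<in> unzip_wreath n ` carrier ?G"
    with \<open>unzip_wreath n \<in> hom ?G ?K\<close> show "y \<in> carrier ?K" by (auto simp: hom_def)
  next
    fix y assume "y \<in> carrier ?K"
    then obtain h a \<sigma> where y: "y = (h, a, \<sigma>)" "\<sigma> \<in> carrier (sym_group n)"
      "h \<in> (\<Pi>\<^sub>E i\<in>{1..n}. carrier H)" "a \<in> (\<Pi>\<^sub>E i\<in>{1..n}. carrier A)"
      by (auto simp: wreath_sym_def semidirect_def)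
    let ?x = "(\<lambda>i\<in>{1..n}. (h i, a i), \<sigma>)"
    have "(\<lambda>i\<in>{1..n}. (h i, a i)) \<in> (\<Pi>\<^sub>E i\<in>{1..n}. carrier H \<times> carrier A)"
      using y by (intro restrict_PiE_iff[THEN iffD2]) auto
    then have "?x \<in> carrier ?G"
      using y(2) by (simp add: wreath_sym_def semidirect_def)
    moreover have "y = unzip_wreath n ?x"
    proof -
      have "(\<lambda>i\<in>{1..n}. fst ((\<lambda>i\<in>{1..n}. (h i, a i)) i)) = restrict h {1..n}"
        "(\<lambda>i\<in>{1..n}. snd ((\<lambda>i\<in>{1..n}. (h i, a i)) i)) = restrict a {1..n}"
        by (rule restrict_ext; simp)+
      then show ?thesis
        unfolding unzip_wreath_def y(1) prod.case using PiE_restrict[OF y(3)] PiE_restrict[OF y(4)] by simp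
    qed
    ultimately show "y \<in> unzip_wreath n ` carrier ?G" by blast
  qed
  ultimately show ?thesis by (auto simp: iso_def)
qed

lemma unzip_wreath_power_factor:
  assumes "group H" "group A"
  shows "unzip_wreath n ` power_factor H A n = normal_factor (power_group H n) (wreath_sym A n)"
proof -
  have "p \<in> unzip_wreath n ` power_factor H A n"
    if "p \<in> normal_factor (power_group H n) (wreath_sym A n)" for p
    using that
    by (intro image_eqI[of _ _ "(\<lambda>i\<in>{1..n}. (fst p i, \<one>\<^bsub>A\<^esub>), \<one>\<^bsub>sym_group n\<^esub>)"])
      (auto simp: unzip_wreath_def power_factor_def normal_factor_def wreath_sym_def semidirect_def PiE_iff fun_eq_iff restrict_def extensional_def)
  moreover have "unzip_wreath n p \<in> normal_factor (power_group H n) (wreath_sym A n)" if pm: "p \<in> power_factor H A n" for p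
  proof -
    obtain f where p: "p = (f, \<one>\<^bsub>sym_group n\<^esub>)" and f: "\<forall>i\<in>{1..n}. f i \<in> carrier H \<times> {\<one>\<^bsub>A\<^esub>}"
      using pm by (cases p) (auto simp: power_factor_def normal_factor_def PiE_iff)
    then show ?thesis
      by (auto simp: unzip_wreath_def normal_factor_def wreath_sym_def semidirect_def mem_Times_iff
          intro!: restrict_ext)
  qed
  ultimately show ?thesis by blast
qed

lemma power_factor_normal:
  assumes "group H" "group A" "\<theta> \<in> hom A (AutoGroup H)"
  shows "power_factor H A n \<lhd> wreath_sym (semidirect H A \<theta>) n"
proof -
  let ?G = "wreath_sym (semidirect H A \<theta>) n"
  interpret G: group ?G by (intro wreath_sym_is_group semidirect_is_group assms)
  interpret K: group "wreath_sym A n" by (intro wreath_sym_is_group assms)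
  let ?\<phi> = "snd \<circ> unzip_wreath n"
  have "snd \<in> hom (semidirect (power_group H n) (wreath_sym A n) (power_action H n \<theta>)) (wreath_sym A n)"
    using K.m_closed
    by (auto simp: hom_def semidirect_def)
  with wreath_sym_iso[OF assms, of n] have "?\<phi> \<in> hom ?G (wreath_sym A n)"
    by (auto simp: iso_def intro: hom_compose)
  then interpret group_hom ?G "wreath_sym A n" ?\<phi>
    by unfold_locales
  have inj: "inj_on (unzip_wreath n) (carrier ?G)"
    using wreath_sym_iso[OF assms, of n] by (auto simp: iso_def bij_betw_def)
  have "normal_factor H A \<subseteq> carrier (semidirect H A \<theta>)"
    using monoid.one_closed[OF group.is_monoid[OF assms(2)]]
    by (auto simp: normal_factor_def semidirect_def)
  then have "(\<Pi>\<^sub>E i\<in>{1..n}. normal_factor H A) \<subseteq> (\<Pi>\<^sub>E i\<in>{1..n}. carrier (semidirect H A \<theta>))"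
    by (rule PiE_mono)
  then have sub: "power_factor H A n \<subseteq> carrier ?G"
    unfolding power_factor_def wreath_sym_def semidirect_def[of "power_group (semidirect H A \<theta>) n"]
    by (simp add: Sigma_mono sym_group_carrier sym_group_one permutes_id del: One_nat_def)
  have fst_mem: "fst (unzip_wreath n x) \<in> carrier (power_group H n)" if "x \<in> carrier ?G" for x
  proof -
    have "unzip_wreath n x \<in> carrier (semidirect (power_group H n) (wreath_sym A n) (power_action H n \<theta>))"
      using wreath_sym_iso[OF assms, of n] that by (auto simp: iso_def hom_def)
    then show ?thesis by (auto simp: semidirect_def simp del: carrier_product_group)
  qed
  have "x \<in> power_factor H A n \<longleftrightarrow> ?\<phi> x = \<one>\<^bsub>wreath_sym A n\<^esub>" if x: "x \<in> carrier ?G" for x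
  proof -
    have "x \<in> power_factor H A n \<longleftrightarrow> unzip_wreath n x \<in> unzip_wreath n ` power_factor H A n"
      using inj x sub by (auto dest: inj_onD)
    also have "\<dots> \<longleftrightarrow> ?\<phi> x = \<one>\<^bsub>wreath_sym A n\<^esub>"
      using fst_mem[OF x] unfolding unzip_wreath_power_factor[OF assms(1,2)]
      by (simp add: normal_factor_def mem_Times_iff del: carrier_product_group)
    finally show ?thesis .
  qed
  then have "kernel ?G (wreath_sym A n) ?\<phi> = power_factor H A n"
    using sub by (auto simp: kernel_def)
  with normal_kernel show ?thesis by simp
qed


section \<open>Modules over group algebras\<close>

text \<open>
  A finitely generated \<open>kG\<close>-module, for \<open>G\<close> finite, is a finite-dimensional \<open>k\<close>-vector space with a
  linear action of \<open>G\<close>. Only the values of \<^term>\<open>act\<close> on the acting group and on the carrier matter,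
  so the restriction of \<open>X\<close> to a subgroup \<open>N\<close> is the same record \<open>X\<close>, regarded as a module for
  \<open>G\<lparr>carrier := N\<rparr>\<close>.
\<close>

record ('k, 'v, 'g) kG_record = "('k, 'v) module" +
  act :: "'g \<Rightarrow> 'v \<Rightarrow> 'v"

locale kG_module = vectorspace class_ring X
  for G :: "('g, 'm) monoid_scheme" and X :: "('k :: field, 'v, 'g) kG_record" +
  assumes finite_dimensional: "fin_dim"
    and act_linear: "g \<in> carrier G \<Longrightarrow> act X g \<in> LinearCombinations.module_hom class_ring X X"
    and act_one: "v \<in> carrier X \<Longrightarrow> act X \<one>\<^bsub>G\<^esub> v = v"
    and act_mult: "\<lbrakk>g \<in> carrier G; h \<in> carrier G; v \<in> carrier X\<rbrakk>
                    \<Longrightarrow> act X (g \<otimes>\<^bsub>G\<^esub> h) v = act X g (act X h v)"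

definition kG_simple ::
    "('g, 'm) monoid_scheme \<Rightarrow> ('k :: field, 'v, 'g) kG_record \<Rightarrow> bool" where
  "kG_simple G X \<longleftrightarrow> kG_module G X \<and> carrier X \<noteq> {\<zero>\<^bsub>X\<^esub>} \<and>
     (\<forall>W. submodule class_ring W X \<and> (\<forall>g\<in>carrier G. \<forall>w\<in>W. act X g w \<in> W)
            \<longrightarrow> W = {\<zero>\<^bsub>X\<^esub>} \<or> W = carrier X)"

definition kG_isomorphic ::
    "('g, 'm) monoid_scheme \<Rightarrow> ('k :: field, 'v, 'g) kG_record \<Rightarrow> ('k, 'w, 'g) kG_record \<Rightarrow> bool" where
  "kG_isomorphic G X Y \<longleftrightarrow>
     (\<exists>f \<in> LinearCombinations.module_hom class_ring X Y. bij_betw f (carrier X) (carrier Y) \<and>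
        (\<forall>g\<in>carrier G. \<forall>v\<in>carrier X. f (act X g v) = act Y g (f v)))"

definition ad ::
    "('g, 'm) monoid_scheme \<Rightarrow> 'g \<Rightarrow> ('k, 'v, 'g) kG_record \<Rightarrow> ('k, 'v, 'g) kG_record" where
  "ad G g X = X\<lparr>act := \<lambda>n. act X (inv\<^bsub>G\<^esub> g \<otimes>\<^bsub>G\<^esub> n \<otimes>\<^bsub>G\<^esub> g)\<rparr>"

definition stabilizer ::
    "('g, 'm) monoid_scheme \<Rightarrow> 'g set \<Rightarrow> ('k :: field, 'v, 'g) kG_record \<Rightarrow> 'g set" where
  "stabilizer G N X = {g \<in> carrier G. kG_isomorphic (G\<lparr>carrier := N\<rparr>) (ad G g X) X}"

text \<open>
  Taking the underlying type of \<open>Y\<close> to be that of \<open>X\<close> is no restriction: the structure of any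
  extension can be transported along the isomorphism onto the carrier of \<open>X\<close>.
\<close>

definition extends_to_stabilizer ::
    "('g, 'm) monoid_scheme \<Rightarrow> 'g set \<Rightarrow> ('k :: field, 'v, 'g) kG_record \<Rightarrow> bool" where
  "extends_to_stabilizer G N X \<longleftrightarrow>
     (\<exists>Y :: ('k, 'v, 'g) kG_record.
        kG_module (G\<lparr>carrier := stabilizer G N X\<rparr>) Y \<and> kG_isomorphic (G\<lparr>carrier := N\<rparr>) Y X)"

text \<open>
  Every finitely generated module has an isomorphic copy whose elements are vectors over \<open>k\<close>, so a
  quantifier over modules with underlying type \<^typ>\<open>'k vec\<close> ranges over all modules up to isomorphism.
\<close>

lemma kG_module_vec_copy:
  fixes X :: "('k :: field, 'v, 'g) kG_record"
  assumes X: "kG_module G X"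
  shows "\<exists>Y :: ('k, 'k vec, 'g) kG_record. kG_module G Y \<and> kG_isomorphic G X Y"
proof -
  interpret kG_module G X by fact
  obtain S where S: "finite S" "S \<subseteq> carrier X" "gen_set S"
    using finite_dimensional unfolding fin_dim_def by blast
  obtain xs where xs: "set xs = S" using finite_list[OF S(1)] by blast
  define cf where "cf v = (SOME a. lincomb a S = v)" for v
  have cf: "lincomb (cf v) S = v" if "v \<in> carrier X" for v
  proof -
    have "v \<in> span S" using that S(3) by simp
    then have "\<exists>a. lincomb a S = v" using finite_span[OF S(1,2)] by auto
    then show ?thesis unfolding cf_def by (rule someI_ex)
  qed
  define j :: "'v \<Rightarrow> 'k vec" where "j v = vec (length xs) (\<lambda>i. cf v (xs ! i))" for v
  have inj: "inj_on j (carrier X)"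
  proof (rule inj_onI)
    fix v w assume vw: "v \<in> carrier X" "w \<in> carrier X" "j v = j w"
    have "cf v s = cf w s" if s: "s \<in> S" for s
    proof -
      obtain i where i: "i < length xs" "xs ! i = s"
        using s unfolding xs[symmetric] in_set_conv_nth by blast
      have "j v $ i = j w $ i" by (rule arg_cong[OF vw(3)])
      then show ?thesis unfolding j_def index_vec[OF i(1)] i(2) .
    qed
    then have "lincomb (cf v) S = lincomb (cf w) S"
      unfolding lincomb_def using S(2) by (intro M.finsum_cong') auto
    then show "v = w" using cf vw by simp
  qed
  define q where "q = inv_into (carrier X) j"
  have qj[simp]: "q (j v) = v" if "v \<in> carrier X" for v
    using that inj by (simp add: q_def)
  define Y :: "('k, 'k vec, 'g) kG_record" where
    "Y = \<lparr>carrier = j ` carrier X, monoid.mult = (\<lambda>x y. x), one = j \<zero>\<^bsub>X\<^esub>, zero = j \<zero>\<^bsub>X\<^esub>,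
          add = (\<lambda>x y. j (q x \<oplus>\<^bsub>X\<^esub> q y)), smult = (\<lambda>c x. j (c \<odot>\<^bsub>X\<^esub> q x)),
          act = (\<lambda>g x. j (act X g (q x)))\<rparr>"
  have "abelian_group Y"
  proof (rule abelian_groupI)
    fix x assume "x \<in> carrier Y"
    then obtain v where v: "v \<in> carrier X" "x = j v" by (auto simp: Y_def)
    then show "\<exists>y\<in>carrier Y. y \<oplus>\<^bsub>Y\<^esub> x = \<zero>\<^bsub>Y\<^esub>"
      by (intro bexI[of _ "j (\<ominus>\<^bsub>X\<^esub> v)"]) (auto simp: Y_def M.l_neg)
  qed (auto simp: Y_def M.a_ac)
  moreover have fld: "field (class_ring :: 'k ring)"
    using vectorspace_axioms unfolding vectorspace_def by blast
  moreover from fld have "cring (class_ring :: 'k ring)"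
    unfolding field_def domain_def by blast
  ultimately have "module class_ring Y"
    by (intro moduleI) (auto simp: Y_def smult_r_distr smult_l_distr[simplified] smult_assoc1[simplified] smult_one[simplified])
  with fld interpret Y: vectorspace class_ring Y
    by (simp add: vectorspace_def)
  have hom: "j \<in> LinearCombinations.module_hom class_ring X Y"
    by (auto simp: LinearCombinations.module_hom_def Y_def)
  have actc: "act X g v \<in> carrier X" if "g \<in> carrier G" "v \<in> carrier X" for g v
    using act_linear[OF that(1)] that(2) by (auto simp: LinearCombinations.module_hom_def)
  have iso: "kG_isomorphic G X Y"
    unfolding kG_isomorphic_def using hom inj actc
    by (intro bexI[of _ j]) (auto simp: bij_betw_def Y_def)
  have lin: "act Y g \<in> LinearCombinations.module_hom class_ring Y Y" if "g \<in> carrier G" for g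
    using act_linear[OF that] actc[OF that] by (auto simp: LinearCombinations.module_hom_def Y_def)
  have one: "act Y \<one>\<^bsub>G\<^esub> v = v" if "v \<in> carrier Y" for v
    using that act_one by (auto simp: Y_def)
  have mult: "act Y (g \<otimes>\<^bsub>G\<^esub> h) v = act Y g (act Y h v)"
    if "g \<in> carrier G" "h \<in> carrier G" "v \<in> carrier Y" for g h v
    using that act_mult actc by (auto simp: Y_def)
  have surj: "j ` carrier X = carrier Y" by (simp add: Y_def)
  interpret L: linear_map class_ring X Y j
    using hom by unfold_locales
  have fin: "Y.fin_dim"
    by (rule L.surj_fin_dim[OF finite_dimensional surj])
  have "kG_module G Y"
    by (intro kG_module.intro kG_module_axioms.intro Y.vectorspace_axioms fin lin one mult)
  with iso show ?thesis by blast
qed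

end

theory Submission
  imports Defs "Jordan_Normal_Form.Char_Poly"
begin

hide_const (open) Polynomial.smult

text \<open>
  Write \<open>B = H \<rtimes> A\<close>, \<open>L\<close> for the copy of \<open>H\<close> in \<open>B\<close>, \<open>G = B \<wr> S\<^sub>n\<close> and \<open>N = L\<^sup>n\<close>. A simple \<open>kN\<close>-module
  is an outer tensor product \<open>X = X\<^sub>1 \<otimes> \<dots> \<otimes> X\<^sub>n\<close> of simple \<open>kL\<close>-modules, because \<open>k\<close> is algebraically
  closed. Choosing one module in each \<open>B\<close>-orbit, one may take \<open>X\<^sub>i = ad(b\<^sub>i) Z\<^sub>r\<^sub>(\<^sub>i\<^sub>)\<close>, where the \<open>Z\<^sub>j\<close> are
  pairwise not \<open>B\<close>-conjugate; let \<open>P\<^sub>j\<close> be the matrices of an extension of \<open>Z\<^sub>j\<close> to its stabilizer in \<open>B\<close>.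

  If \<open>g = (x, \<sigma>)\<close> stabilizes \<open>X\<close>, comparing the restrictions of \<open>ad(g) X\<close> and \<open>X\<close> to the \<open>i\<close>-th factor
  gives \<open>ad(x\<^sub>i) X\<^sub>j \<cong> X\<^sub>i\<close> for \<open>j = \<sigma>\<inverse> i\<close>. Hence \<open>r(j) = r(i)\<close>, and \<open>b\<^sub>i\<inverse> x\<^sub>i b\<^sub>j\<close> lies in the
  stabilizer of \<open>Z\<^sub>r\<^sub>(\<^sub>i\<^sub>)\<close>. So \<open>g\<close> can act on the tensor product by permuting the factors along \<open>\<sigma>\<close> and
  applying \<open>P\<^sub>r\<^sub>(\<^sub>i\<^sub>)(b\<^sub>i\<inverse> x\<^sub>i b\<^sub>j)\<close> in the \<open>i\<close>-th place, that is, with matrix entries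

  \<open>Q(g)\<^sub>p\<^sub>q = \<Prod>\<^sub>i P\<^sub>r\<^sub>(\<^sub>i\<^sub>)(b\<^sub>i\<inverse> x\<^sub>i b\<^sub>j)\<close> at row \<open>p\<^sub>i\<close> and column \<open>q\<^sub>j\<close>, where \<open>j = \<sigma>\<inverse> i\<close>.

  In a product of two such matrices the inner elements \<open>b\<^sub>j\<close> cancel and the sum over the middle tuple
  factors, so \<open>Q\<close> is a representation; on \<open>N\<close> it is the tensor product.

  The argument is carried out with matrices over finite index sets. The working notion of simplicity
  is \<open>full_rep\<close>: the group algebra contains all matrix units. Simple modules have it by \<open>burnside\<close>; it
  makes Schur's lemma (\<open>schur\<close>) explicit and passes to tensor products entry by entry. The
  decomposition of \<open>X\<close> is \<open>outer_tensor\<close>, the comparison of restrictions is \<open>isotypic_single\<close>, the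
  choice of representatives is \<open>orbit_representatives\<close>, and the matrices \<open>Q(g)\<close> appear in
  \<open>extends_to_stabilizer_wreath\<close>.
\<close>

section \<open>Matrices over finite index sets\<close>

text \<open>
  Matrices are total functions that vanish outside their index sets, so that identities between matrices
  are equalities of functions and can be used for rewriting.
\<close>

definition mats :: "'i set \<Rightarrow> 'j set \<Rightarrow> ('i \<Rightarrow> 'j \<Rightarrow> 'k :: field) set" where
  "mats I J = {A. \<forall>p q. A p q \<noteq> 0 \<longrightarrow> p \<in> I \<and> q \<in> J}"

definition mmul :: "'j set \<Rightarrow> ('i \<Rightarrow> 'j \<Rightarrow> 'k :: field) \<Rightarrow> ('j \<Rightarrow> 'l \<Rightarrow> 'k) \<Rightarrow> 'i \<Rightarrow> 'l \<Rightarrow> 'k" where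
  "mmul J A B = (\<lambda>p r. \<Sum>q\<in>J. A p q * B q r)"

definition idm :: "'i set \<Rightarrow> 'i \<Rightarrow> 'i \<Rightarrow> 'k :: field" where
  "idm I = (\<lambda>p q. if p = q \<and> p \<in> I then 1 else 0)"

definition munit :: "'i \<Rightarrow> 'j \<Rightarrow> 'i \<Rightarrow> 'j \<Rightarrow> 'k :: field" where
  "munit a b = (\<lambda>p q. if p = a \<and> q = b then 1 else 0)"

text \<open>
  For a representation \<open>R\<close> this is the image of the group algebra element \<open>\<Sum>\<^sub>g c(g) g\<close>.
\<close>

definition lin :: "'g set \<Rightarrow> ('g \<Rightarrow> 'k) \<Rightarrow> ('g \<Rightarrow> 'i \<Rightarrow> 'j \<Rightarrow> 'k) \<Rightarrow> 'i \<Rightarrow> 'j \<Rightarrow> 'k :: field" where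
  "lin S c R = (\<lambda>p q. \<Sum>g\<in>S. c g * R g p q)"

lemma matsD: "A \<in> mats I J \<Longrightarrow> p \<notin> I \<or> q \<notin> J \<Longrightarrow> A p q = 0"
  by (auto simp: mats_def)

lemma mats_eqI:
  assumes "A \<in> mats I J" "B \<in> mats I J" "\<And>p q. p \<in> I \<Longrightarrow> q \<in> J \<Longrightarrow> A p q = B p q"
  shows "A = B"
proof (intro ext)
  fix p q show "A p q = B p q"
    using assms matsD[of A I J p q] matsD[of B I J p q] by (cases "p \<in> I \<and> q \<in> J") auto
qed

lemma mmul_mats: "A \<in> mats I J \<Longrightarrow> B \<in> mats J' K \<Longrightarrow> mmul J'' A B \<in> mats I K"
  by (fastforce simp: mats_def mmul_def dest!: sum.not_neutral_contains_not_neutral)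

lemma lin_mats: "(\<And>g. g \<in> S \<Longrightarrow> R g \<in> mats I J) \<Longrightarrow> lin S c R \<in> mats I J"
  by (fastforce simp: mats_def lin_def dest!: sum.not_neutral_contains_not_neutral)

lemma idm_mats: "idm I \<in> mats I I"
  by (auto simp: mats_def idm_def)

lemma munit_mats: "a \<in> I \<Longrightarrow> b \<in> J \<Longrightarrow> munit a b \<in> mats I J"
  by (auto simp: mats_def munit_def)

lemma mmul_assoc: "mmul J (mmul I A B) C = mmul I A (mmul J B C)"
  unfolding mmul_def sum_distrib_left sum_distrib_right
  by (intro ext, subst sum.swap) (simp add: mult.assoc)

lemma mmul_idm_left:
  assumes "finite I" "A \<in> mats I J"
  shows "mmul I (idm I) A = A"
proof (intro ext)
  fix p r
  have "(\<Sum>q\<in>I. idm I p q * A q r) = (\<Sum>q\<in>I. if p = q then A q r else 0)"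
    by (intro sum.cong) (auto simp: idm_def)
  then show "mmul I (idm I) A p r = A p r"
    using assms by (simp add: mmul_def matsD)
qed

lemma mmul_idm_right:
  assumes "finite J" "A \<in> mats I J"
  shows "mmul J A (idm J) = A"
proof (intro ext)
  fix p r
  have "(\<Sum>q\<in>J. A p q * idm J q r) = (\<Sum>q\<in>J. if q = r then A p q else 0)"
    by (intro sum.cong) (auto simp: idm_def)
  then show "mmul J A (idm J) p r = A p r"
    using assms by (simp add: mmul_def matsD)
qed

lemma mmul_munit_right: "finite J \<Longrightarrow> a \<in> J \<Longrightarrow> mmul J A (munit a b) = (\<lambda>p q. if q = b then A p a else 0)"
  by (auto simp: mmul_def munit_def fun_eq_iff if_distrib[of "\<lambda>x. _ * x"] sum.delta cong: if_cong)

lemma mmul_munit_left: "finite J \<Longrightarrow> b \<in> J \<Longrightarrow> mmul J (munit a b) A = (\<lambda>p q. if p = a then A b q else 0)"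
  by (auto simp: mmul_def munit_def fun_eq_iff if_distrib[of "\<lambda>x. x * _"] sum.delta cong: if_cong)

lemma mmul_zero: "mmul J A (\<lambda>p q. 0) = (\<lambda>p q. 0)" "mmul J (\<lambda>p q. 0) B = (\<lambda>p q. 0)"
  by (auto simp: mmul_def)

lemma mmul_lin_left: "mmul J (lin S c R) U = lin S c (\<lambda>g. mmul J (R g) U)"
  unfolding mmul_def lin_def sum_distrib_left sum_distrib_right
  by (intro ext, subst sum.swap) (simp add: mult.assoc)

lemma mmul_lin_right: "mmul J U (lin S c R) = lin S c (\<lambda>g. mmul J U (R g))"
  unfolding mmul_def lin_def sum_distrib_left sum_distrib_right
  by (intro ext, subst sum.swap) (simp add: ac_simps)

lemma lin_cong: "(\<And>g. g \<in> S \<Longrightarrow> R g = R' g) \<Longrightarrow> lin S c R = lin S c R'"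
  by (simp add: lin_def)

section \<open>Two facts of linear algebra\<close>

text \<open>
  A finite system of linear equations that has no solution is refuted by a linear functional. The
  induction adds one unknown at a time; its step is one elimination.
\<close>

lemma fredholm_alternative:
  fixes m :: "'g \<Rightarrow> 'j \<Rightarrow> 'k :: field"
  assumes "finite S" "finite J"
  shows "(\<exists>c. \<forall>j\<in>J. (\<Sum>g\<in>S. c g * m g j) = t j) \<or>
         (\<exists>T. (\<forall>g\<in>S. (\<Sum>j\<in>J. T j * m g j) = 0) \<and> (\<Sum>j\<in>J. T j * t j) \<noteq> 0)"
  using assms(1)
proof (induction S arbitrary: t rule: finite_induct)
  case empty
  show ?case
  proof (cases "\<forall>j\<in>J. t j = 0")
    case False
    then obtain j where j: "j \<in> J" "t j \<noteq> 0" by blast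
    have "(\<Sum>i\<in>J. (if i = j then 1 else 0) * t i) = t j"
      using j assms(2) by (simp add: if_distrib[of "\<lambda>x. x * _"] cong: if_cong)
    with j show ?thesis by (intro disjI2 exI[of _ "\<lambda>i. if i = j then 1 else 0"]) auto
  qed auto
next
  case (insert g S)
  define dot where "dot T u = (\<Sum>j\<in>J. T j * u j)" for T u :: "'j \<Rightarrow> 'k"
  have dot_diff: "dot T (\<lambda>j. u j - x * v j) = dot T u - x * dot T v"
    "dot (\<lambda>j. u j - x * v j) T = dot u T - x * dot v T" for T u v x
    by (simp_all add: dot_def algebra_simps sum_subtractf sum_distrib_left)
  consider c where "\<forall>j\<in>J. (\<Sum>g\<in>S. c g * m g j) = t j"
    | T where "\<forall>g\<in>S. dot T (m g) = 0" "dot T t \<noteq> 0"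
    using insert.IH[of t] unfolding dot_def by blast
  then show ?case
  proof cases
    case 1
    have "(\<Sum>x\<in>insert g S. (c(g := 0)) x * m x j) = t j" if "j \<in> J" for j
    proof -
      have "(\<Sum>x\<in>S. (c(g := 0)) x * m x j) = (\<Sum>x\<in>S. c x * m x j)"
        using insert.hyps by (intro sum.cong) auto
      then show ?thesis using 1 that insert.hyps by simp
    qed
    then show ?thesis by blast
  next
    case T: 2
    show ?thesis
    proof (cases "dot T (m g) = 0")
      case True
      then show ?thesis using T unfolding dot_def by (intro disjI2 exI[of _ T]) auto
    next
      case False
      \<comment> \<open>\<open>T\<close> kills all old columns but not the new one, which forces the value \<open>x\<close> of the new unknown.\<close>
      define x where "x = dot T t / dot T (m g)"
      consider c where "\<forall>j\<in>J. (\<Sum>h\<in>S. c h * m h j) = t j - x * m g j"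
        | T' where "\<forall>g\<in>S. dot T' (m g) = 0" "dot T' (\<lambda>j. t j - x * m g j) \<noteq> 0"
        using insert.IH[of "\<lambda>j. t j - x * m g j"] unfolding dot_def by blast
      then show ?thesis
      proof cases
        case 1
        have "(\<Sum>h\<in>insert g S. (c(g := x)) h * m h j) = t j" if "j \<in> J" for j
        proof -
          have "(\<Sum>h\<in>S. (c(g := x)) h * m h j) = (\<Sum>h\<in>S. c h * m h j)"
            using insert.hyps by (intro sum.cong) auto
          then show ?thesis using 1 that insert.hyps by simp
        qed
        then show ?thesis by blast
      next
        case 2
        \<comment> \<open>Subtracting a multiple of \<open>T\<close> makes \<open>T'\<close> vanish on the new column and keeps its value on the reduced right-hand side.\<close>
        define y where "y = dot T' (m g) / dot T (m g)"
        have "dot (\<lambda>j. T' j - y * T j) (m h) = 0" if "h \<in> insert g S" for h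
        proof -
          have "dot T' (m h) = y * dot T (m h)" using that 2 T False by (auto simp: y_def)
          then show ?thesis by (simp add: dot_diff)
        qed
        moreover have "dot (\<lambda>j. T' j - y * T j) t = dot T' (\<lambda>j. t j - x * m g j)"
          unfolding dot_diff using False by (simp add: x_def y_def)
        ultimately show ?thesis using 2 unfolding dot_def by (intro disjI2 exI[of _ "\<lambda>j. T' j - y * T j"]) auto
      qed
    qed
  qed
qed

lemma eigenvector_exists:
  fixes A :: "nat \<Rightarrow> nat \<Rightarrow> 'k :: alg_closed_field"
  assumes "d > 0"
  shows "\<exists>x w. (\<exists>q<d. w q \<noteq> 0) \<and> (\<forall>p<d. (\<Sum>q<d. A p q * w q) = x * w p)"
proof -
  define M where "M = mat d d (\<lambda>(p, q). A p q)"
  have M: "M \<in> carrier_mat d d" by (simp add: M_def)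
  obtain x where "poly (char_poly M) x = 0"
    using alg_closed_imp_poly_has_root degree_monic_char_poly[OF M] assms by metis
  then obtain v where v: "v \<in> carrier_vec d" "v \<noteq> 0\<^sub>v d" "M *\<^sub>v v = x \<cdot>\<^sub>v v"
    using eigenvalue_root_char_poly[OF M] M by (auto simp: eigenvalue_def eigenvector_def)
  have "\<exists>q<d. v $ q \<noteq> 0"
    using v(1,2) by (metis carrier_vecD eq_vecI index_zero_vec)
  moreover have "(\<Sum>q<d. A p q * v $ q) = x * v $ p" if "p < d" for p
  proof -
    have "(M *\<^sub>v v) $ p = (\<Sum>q<d. A p q * v $ q)"
      using that v(1) by (simp add: M_def scalar_prod_def atLeast0LessThan)
    then show ?thesis using v that by simp
  qed
  ultimately show ?thesis by blast
qed

section \<open>Matrix representations\<close>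

definition mat_rep :: "('g, 'm) monoid_scheme \<Rightarrow> 'i set \<Rightarrow> ('g \<Rightarrow> 'i \<Rightarrow> 'i \<Rightarrow> 'k :: field) \<Rightarrow> bool" where
  "mat_rep G I R \<longleftrightarrow> finite I \<and> (\<forall>g\<in>carrier G. R g \<in> mats I I) \<and> R \<one>\<^bsub>G\<^esub> = idm I \<and>
     (\<forall>g\<in>carrier G. \<forall>h\<in>carrier G. R (g \<otimes>\<^bsub>G\<^esub> h) = mmul I (R g) (R h))"

text \<open>
  By Burnside's theorem this is absolute irreducibility: the group algebra contains all matrix units.
\<close>

definition full_rep :: "('g, 'm) monoid_scheme \<Rightarrow> 'i set \<Rightarrow> ('g \<Rightarrow> 'i \<Rightarrow> 'i \<Rightarrow> 'k :: field) \<Rightarrow> bool" where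
  "full_rep G I R \<longleftrightarrow> mat_rep G I R \<and> I \<noteq> {} \<and>
     (\<forall>a\<in>I. \<forall>b\<in>I. \<exists>c. lin (carrier G) c R = munit a b)"

text \<open>
  Irreducibility in the form in which it is used: every nonzero vector generates the whole space. A
  vector is a matrix whose columns are indexed by \<^typ>\<open>unit\<close>.
\<close>

definition irred_rep :: "('g, 'm) monoid_scheme \<Rightarrow> 'i set \<Rightarrow> ('g \<Rightarrow> 'i \<Rightarrow> 'i \<Rightarrow> 'k :: field) \<Rightarrow> bool" where
  "irred_rep G I R \<longleftrightarrow> mat_rep G I R \<and> I \<noteq> {} \<and>
     (\<forall>W\<in>mats I (UNIV :: unit set). W \<noteq> (\<lambda>p u. 0) \<longrightarrow>
        (\<forall>p\<in>I. \<exists>c. mmul I (lin (carrier G) c R) W = munit p ()))"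

text \<open>
  The homomorphisms run from the second representation to the first, as the shape of their matrices suggests.
\<close>

definition hom_mats ::
    "('g, 'm) monoid_scheme \<Rightarrow> 'j set \<Rightarrow> ('g \<Rightarrow> 'j \<Rightarrow> 'j \<Rightarrow> 'k :: field) \<Rightarrow> 'i set \<Rightarrow> ('g \<Rightarrow> 'i \<Rightarrow> 'i \<Rightarrow> 'k)
      \<Rightarrow> ('j \<Rightarrow> 'i \<Rightarrow> 'k) set" where
  "hom_mats G J R I M = {U \<in> mats J I. \<forall>g\<in>carrier G. mmul J (R g) U = mmul I U (M g)}"

lemma hom_mats_lin:
  assumes "U \<in> hom_mats G J R I M"
  shows "mmul J (lin (carrier G) c R) U = mmul I U (lin (carrier G) c M)"
  unfolding mmul_lin_left mmul_lin_right using assms by (intro lin_cong) (auto simp: hom_mats_def)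

lemma hom_mats_compose:
  assumes "U \<in> hom_mats G J R I M" "V \<in> hom_mats G I M K Q"
  shows "mmul I U V \<in> hom_mats G J R K Q"
proof -
  have "mmul J (R g) (mmul I U V) = mmul K (mmul I U V) (Q g)" if "g \<in> carrier G" for g
  proof -
    have "mmul J (R g) (mmul I U V) = mmul I (mmul J (R g) U) V" by (simp only: mmul_assoc)
    also have "mmul J (R g) U = mmul I U (M g)" using assms(1) that by (simp add: hom_mats_def)
    also have "mmul I (mmul I U (M g)) V = mmul I U (mmul I (M g) V)" by (simp only: mmul_assoc)
    also have "mmul I (M g) V = mmul K V (Q g)" using assms(2) that by (simp add: hom_mats_def)
    finally show ?thesis by (simp only: mmul_assoc)
  qed
  then show ?thesis using assms unfolding hom_mats_def by (auto intro: mmul_mats)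
qed

text \<open>
  Let the column \<open>a\<close> of \<open>U\<close> be nonzero at \<open>q\<close>. The group algebra element that acts on \<open>M\<close> as the matrix unit at
  \<open>(a, b)\<close> sends the image of \<open>w\<close> to the column \<open>a\<close> times the \<open>b\<close>-th coordinate of \<open>w\<close>, which can then be read
  off in row \<open>q\<close>, up to the factor \<open>U q a\<close>.
\<close>

lemma full_hom_left_inverse:
  assumes "full_rep G I M" "finite J" "U \<in> hom_mats G J R I M" "U \<noteq> (\<lambda>p q. 0)"
  shows "\<exists>V\<in>mats I J. mmul J V U = idm I"
proof -
  have I: "finite I" and U: "U \<in> mats J I"
    using assms by (auto simp: full_rep_def mat_rep_def hom_mats_def)
  obtain q a where q: "U q a \<noteq> 0" using assms(4) by (auto simp: fun_eq_iff)
  then have a: "a \<in> I" using U by (auto simp: mats_def)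
  have "\<forall>b\<in>I. \<exists>c. lin (carrier G) c M = munit a b"
    using assms(1) a unfolding full_rep_def by blast
  then obtain c where c: "\<And>b. b \<in> I \<Longrightarrow> lin (carrier G) (c b) M = munit a b"
    by metis
  define V where "V = (\<lambda>b p. if b \<in> I \<and> p \<in> J then lin (carrier G) (c b) R q p / U q a else 0)"
  have "mmul J V U = idm I"
  proof (intro ext)
    fix b b'
    show "mmul J V U b b' = idm I b b'"
    proof (cases "b \<in> I")
      case True
      have "mmul J V U b b' = mmul J (lin (carrier G) (c b) R) U q b' / U q a"
        using True by (simp add: mmul_def V_def sum_divide_distrib)
      also have "mmul J (lin (carrier G) (c b) R) U = mmul I U (munit a b)"
        using hom_mats_lin[OF assms(3)] c[OF True] by metis
      finally show ?thesis
        using True q by (auto simp: mmul_munit_right[OF I a] idm_def)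
    qed (simp add: mmul_def V_def idm_def)
  qed
  moreover have "V \<in> mats I J" by (auto simp: mats_def V_def)
  ultimately show ?thesis by blast
qed

text \<open>
  The group algebra elements that act on \<open>R\<close> as the matrix units at \<open>(b, q)\<close> turn a column \<open>a\<close> of \<open>U\<close> that is
  nonzero at \<open>q\<close> into multiples of the basis vectors \<open>b\<close>. Applied to the basis vector \<open>a\<close> in \<open>M\<close>, they give the
  preimages.
\<close>

lemma full_hom_right_inverse:
  assumes "full_rep G J R" "finite I" "U \<in> hom_mats G J R I M" "U \<noteq> (\<lambda>p q. 0)"
  shows "\<exists>V\<in>mats I J. mmul I U V = idm J"
proof -
  have J: "finite J" and U: "U \<in> mats J I"
    using assms by (auto simp: full_rep_def mat_rep_def hom_mats_def)
  obtain q a where q: "U q a \<noteq> 0" using assms(4) by (auto simp: fun_eq_iff)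
  then have qJ: "q \<in> J" using U by (auto simp: mats_def)
  have "\<forall>b\<in>J. \<exists>c. lin (carrier G) c R = munit b q"
    using assms(1) qJ unfolding full_rep_def by blast
  then obtain c where c: "\<And>b. b \<in> J \<Longrightarrow> lin (carrier G) (c b) R = munit b q"
    by metis
  define V where "V = (\<lambda>p b. if p \<in> I \<and> b \<in> J then lin (carrier G) (c b) M p a / U q a else 0)"
  have "mmul I U V = idm J"
  proof (intro ext)
    fix b' b
    show "mmul I U V b' b = idm J b' b"
    proof (cases "b \<in> J")
      case True
      have "mmul I U V b' b = mmul I U (lin (carrier G) (c b) M) b' a / U q a"
        using True by (simp add: mmul_def V_def sum_divide_distrib)
      also have "mmul I U (lin (carrier G) (c b) M) = mmul J (munit b q) U"
        using hom_mats_lin[OF assms(3)] c[OF True] by metis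
      finally show ?thesis
        using True q by (simp add: mmul_munit_left[OF J qJ] idm_def)
    qed (auto simp: mmul_def V_def idm_def)
  qed
  moreover have "V \<in> mats I J" by (auto simp: mats_def V_def)
  ultimately show ?thesis by blast
qed

lemma schur:
  assumes "full_rep G J R" "full_rep G I M" "U \<in> hom_mats G J R I M" "U \<noteq> (\<lambda>p q. 0)"
  shows "\<exists>V\<in>hom_mats G I M J R. mmul J V U = idm I \<and> mmul I U V = idm J"
proof -
  have fin: "finite I" "finite J" and U: "U \<in> mats J I"
    using assms by (auto simp: full_rep_def mat_rep_def hom_mats_def)
  obtain V where V: "V \<in> mats I J" "mmul J V U = idm I"
    using full_hom_left_inverse[OF assms(2) fin(2) assms(3,4)] by blast
  obtain V' where V': "V' \<in> mats I J" "mmul I U V' = idm J"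
    using full_hom_right_inverse[OF assms(1) fin(1) assms(3,4)] by blast
  have "V = mmul J V (mmul I U V')"
    using V' mmul_idm_right[OF fin(2) V(1)] by simp
  also have "\<dots> = V'"
    unfolding mmul_assoc[symmetric] V(2) by (rule mmul_idm_left[OF fin(1) V'(1)])
  finally have UV: "mmul I U V = idm J" using V' by simp
  have "mmul I (M g) V = mmul J V (R g)" if g: "g \<in> carrier G" for g
  proof -
    have Rg: "R g \<in> mats J J" and Mg: "M g \<in> mats I I"
      using assms(1,2) g by (auto simp: full_rep_def mat_rep_def)
    have "mmul I (M g) V = mmul I (mmul J V U) (mmul I (M g) V)"
      unfolding V(2) by (rule mmul_idm_left[OF fin(1) mmul_mats[OF Mg V(1)], symmetric])
    also have "\<dots> = mmul J V (mmul I (mmul I U (M g)) V)"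
      by (simp only: mmul_assoc)
    also have "mmul I U (M g) = mmul J (R g) U"
      using assms(3) g by (simp add: hom_mats_def)
    also have "mmul J V (mmul I (mmul J (R g) U) V) = mmul J V (R g)"
      unfolding mmul_assoc UV by (simp add: mmul_idm_right[OF fin(2) Rg])
    finally show ?thesis .
  qed
  then show ?thesis using V UV by (auto simp: hom_mats_def)
qed

text \<open>
  An endomorphism has an eigenvector, and it multiplies by the eigenvalue everything that this vector
  generates.
\<close>

lemma commutant_scalar:
  fixes R :: "'g \<Rightarrow> nat \<Rightarrow> nat \<Rightarrow> 'k :: alg_closed_field"
  assumes "irred_rep G {..<d} R" "A \<in> hom_mats G {..<d} R {..<d} R"
  shows "\<exists>x. \<forall>p<d. \<forall>q<d. A p q = (if p = q then x else 0)"
proof -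
  let ?I = "{..<d}"
  have "d > 0" using assms(1) by (cases d) (auto simp: irred_rep_def)
  then obtain x w where w: "\<exists>q<d. w q \<noteq> 0" "\<forall>p<d. (\<Sum>q<d. A p q * w q) = x * w p"
    using eigenvector_exists by blast
  define W where "W = (\<lambda>p (u :: unit). if p < d then w p else 0)"
  have W: "W \<in> mats ?I UNIV" "W \<noteq> (\<lambda>p u. 0)"
    using w(1) by (auto simp: W_def mats_def fun_eq_iff)
  have A: "A \<in> mats ?I ?I" using assms(2) by (simp add: hom_mats_def)
  have AW: "mmul ?I A W = (\<lambda>p u. x * W p u)"
  proof (intro ext)
    fix p u
    show "mmul ?I A W p u = x * W p u"
      using w(2) matsD[OF A, of p] by (cases "p < d") (auto simp: mmul_def W_def)
  qed
  have "A p q = (if p = q then x else 0)" if p: "p < d" "q < d" for p q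
  proof -
    obtain c where c: "mmul ?I (lin (carrier G) c R) W = munit q ()"
      using assms(1) W p unfolding irred_rep_def by blast
    have "A p q = mmul ?I A (munit q ()) p ()"
      using p by (simp add: mmul_munit_right)
    also have "mmul ?I A (munit q ()) = mmul ?I (mmul ?I A (lin (carrier G) c R)) W"
      unfolding c[symmetric] mmul_assoc ..
    also have "mmul ?I A (lin (carrier G) c R) = mmul ?I (lin (carrier G) c R) A"
      using hom_mats_lin[OF assms(2)] by metis
    also have "mmul ?I (mmul ?I (lin (carrier G) c R) A) W = (\<lambda>p u. x * munit q () p u)"
      unfolding mmul_assoc AW c[symmetric] by (simp add: mmul_def sum_distrib_left ac_simps)
    finally show ?thesis by (auto simp: munit_def)
  qed
  then show ?thesis by blast
qed

text \<open>
  Suppose that the matrices \<open>R g\<close> do not span. Then the space \<open>ann\<close> of matrices orthogonal to all of them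
  under the trace form is nonzero, and it is closed under left multiplication by the \<open>R g\<close>. In an
  element \<open>T\<close> with as few nonzero columns as possible, and in the elements that \<open>T\<close> generates, every column is
  the image of one fixed nonzero column \<open>j\<close> under a well-defined endomorphism of the representation, hence
  proportional to it by \<open>commutant_scalar\<close>. So \<open>ann\<close> contains a matrix of rank one with any prescribed column \<open>j\<close>,
  proportional columns elsewhere, and trace zero; the basis vector \<open>j\<close> as column \<open>j\<close> makes the trace one.
\<close>

theorem burnside:
  fixes R :: "'g \<Rightarrow> nat \<Rightarrow> nat \<Rightarrow> 'k :: alg_closed_field"
  assumes "irred_rep G {..<d} R" "group G" "finite (carrier G)"
  shows "full_rep G {..<d} R"
proof (rule ccontr)
  let ?I = "{..<d}" and ?S = "carrier G"
  interpret G: group G by fact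
  have rep: "mat_rep G ?I R" and "?I \<noteq> {}" using assms(1) by (auto simp: irred_rep_def)
  have R_mats: "R g \<in> mats ?I ?I" if "g \<in> ?S" for g using rep that by (auto simp: mat_rep_def)
  have R_mult: "R (g \<otimes>\<^bsub>G\<^esub> h) = mmul ?I (R g) (R h)" if "g \<in> ?S" "h \<in> ?S" for g h
    using rep that by (auto simp: mat_rep_def)
  define ann where "ann = {T \<in> mats ?I ?I. \<forall>g\<in>?S. (\<Sum>p<d. mmul ?I T (R g) p p) = 0}"
  assume "\<not> full_rep G ?I R"
  then obtain a b where ab: "a < d" "b < d" "\<And>c. lin ?S c R \<noteq> munit a b"
    using rep \<open>?I \<noteq> {}\<close> by (auto simp: full_rep_def)
  have "\<exists>T\<in>ann. T \<noteq> (\<lambda>p q. 0)"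
  proof -
    have "\<not> (\<exists>c. \<forall>j\<in>?I \<times> ?I. (\<Sum>g\<in>?S. c g * R g (fst j) (snd j)) = munit a b (fst j) (snd j))"
    proof
      assume "\<exists>c. \<forall>j\<in>?I \<times> ?I. (\<Sum>g\<in>?S. c g * R g (fst j) (snd j)) = munit a b (fst j) (snd j)"
      then obtain c where c: "\<forall>j\<in>?I \<times> ?I. (\<Sum>g\<in>?S. c g * R g (fst j) (snd j)) = munit a b (fst j) (snd j)" ..
      have "lin ?S c R = munit a b"
        using c ab by (intro mats_eqI[OF lin_mats[OF R_mats] munit_mats]) (auto simp: lin_def)
      then show False using ab by blast
    qed
    then obtain T where T: "\<forall>g\<in>?S. (\<Sum>j\<in>?I \<times> ?I. T j * R g (fst j) (snd j)) = 0"
      "(\<Sum>j\<in>?I \<times> ?I. T j * munit a b (fst j) (snd j)) \<noteq> 0"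
      using fredholm_alternative[OF assms(3), of "?I \<times> ?I" "\<lambda>g j. R g (fst j) (snd j)"
          "\<lambda>j. munit a b (fst j) (snd j)"] by auto
    define T' where "T' = (\<lambda>q p. if q < d \<and> p < d then T (p, q) else 0)"
    have "(\<Sum>q<d. mmul ?I T' (R g) q q) = 0" if "g \<in> ?S" for g
    proof -
      have "(\<Sum>q<d. mmul ?I T' (R g) q q) = (\<Sum>q<d. \<Sum>p<d. T (p, q) * R g p q)"
        by (simp add: mmul_def T'_def)
      also have "\<dots> = (\<Sum>j\<in>?I \<times> ?I. T j * R g (fst j) (snd j))"
        by (subst sum.swap) (simp add: sum.cartesian_product case_prod_beta)
      finally show ?thesis using T(1) that by simp
    qed
    moreover have "T' \<in> mats ?I ?I" by (auto simp: mats_def T'_def)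
    moreover have "T' \<noteq> (\<lambda>p q. 0)"
    proof
      assume "T' = (\<lambda>p q. 0)"
      then have "T' q p = 0" for p q by simp
      then have "T (p, q) = 0" if "p < d" "q < d" for p q
        using that unfolding T'_def by meson
      then have "(\<Sum>j\<in>?I \<times> ?I. T j * munit a b (fst j) (snd j)) = 0"
        by (intro sum.neutral) auto
      then show False using T(2) by simp
    qed
    ultimately show ?thesis by (auto simp: ann_def)
  qed
  define cols where "cols T = {j. \<exists>p. T p j \<noteq> (0 :: 'k)}" for T :: "nat \<Rightarrow> nat \<Rightarrow> 'k"
  \<comment> \<open>Minimality makes an element of \<open>ann\<close> that is supported on the columns of \<open>T\<close> determined by its column \<open>j\<close>.\<close>
  obtain T0 where "T0 \<in> ann \<and> T0 \<noteq> (\<lambda>p q. 0)" using \<open>\<exists>T\<in>ann. _\<close> by blast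
  from ex_has_least_nat[of "\<lambda>T. T \<in> ann \<and> T \<noteq> (\<lambda>p q. 0)", OF this, of "\<lambda>T. card (cols T)"]
  obtain T where T: "T \<in> ann" "T \<noteq> (\<lambda>p q. 0)"
    and T_min: "\<And>Z. Z \<in> ann \<Longrightarrow> Z \<noteq> (\<lambda>p q. 0) \<Longrightarrow> card (cols T) \<le> card (cols Z)"
    by auto
  have T_mats: "T \<in> mats ?I ?I" using T by (simp add: ann_def)
  have fin_cols: "finite (cols T)"
    by (rule finite_subset[of _ ?I]) (use T_mats in \<open>auto simp: cols_def mats_def\<close>)
  obtain r j where rj: "T r j \<noteq> 0" using T(2) by (auto simp: fun_eq_iff)
  then have j: "j < d" using T_mats by (auto simp: mats_def)
  have zero: "Z = (\<lambda>p q. 0)" if Z: "Z \<in> ann" "cols Z \<subseteq> cols T" "\<And>p. Z p j = 0" for Z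
  proof (rule ccontr)
    assume "Z \<noteq> (\<lambda>p q. 0)"
    then have "card (cols T) \<le> card (cols Z)" using T_min Z by blast
    moreover have "j \<in> cols T - cols Z" using Z(3) rj by (auto simp: cols_def)
    then have "cols Z \<subset> cols T" using Z(2) by blast
    then have "card (cols Z) < card (cols T)" by (rule psubset_card_mono[OF fin_cols])
    ultimately show False by simp
  qed
  have ann_mult: "mmul ?I (R g) Z \<in> ann" if g: "g \<in> ?S" and Z: "Z \<in> ann" for g Z
  proof -
    have Zm: "Z \<in> mats ?I ?I" using Z by (simp add: ann_def)
    have tr: "(\<Sum>p<d. mmul ?I A B p p) = (\<Sum>p<d. mmul ?I B A p p)" for A B :: "nat \<Rightarrow> nat \<Rightarrow> 'k"
      unfolding mmul_def by (subst sum.swap) (simp add: mult.commute)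
    have "(\<Sum>p<d. mmul ?I (mmul ?I (R g) Z) (R h) p p) = 0" if h: "h \<in> ?S" for h
    proof -
      have "(\<Sum>p<d. mmul ?I (mmul ?I (R g) Z) (R h) p p) = (\<Sum>p<d. mmul ?I Z (R (h \<otimes>\<^bsub>G\<^esub> g)) p p)"
        unfolding mmul_assoc by (subst tr) (simp add: mmul_assoc R_mult g h)
      then show ?thesis using Z g h by (simp add: ann_def)
    qed
    then show ?thesis using mmul_mats[OF R_mats[OF g] Zm] by (simp add: ann_def)
  qed
  have ann_lin: "lin X c Z \<in> ann" if "\<And>x. x \<in> X \<Longrightarrow> Z x \<in> ann" for X c and Z :: "'x \<Rightarrow> nat \<Rightarrow> nat \<Rightarrow> 'k"
  proof -
    have "(\<Sum>p<d. mmul ?I (lin X c Z) (R g) p p) = 0" if g: "g \<in> ?S" for g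
    proof -
      have "(\<Sum>p<d. mmul ?I (lin X c Z) (R g) p p) = (\<Sum>x\<in>X. c x * (\<Sum>p<d. mmul ?I (Z x) (R g) p p))"
        unfolding mmul_lin_left unfolding lin_def by (subst sum.swap) (simp add: sum_distrib_left)
      then show ?thesis using \<open>\<And>x. x \<in> X \<Longrightarrow> Z x \<in> ann\<close> g by (simp add: ann_def)
    qed
    moreover have "lin X c Z \<in> mats ?I ?I" using that by (intro lin_mats) (auto simp: ann_def)
    ultimately show ?thesis by (simp add: ann_def)
  qed
  define W where "W = (\<lambda>p (u :: unit). T p j)"
  have W: "W \<in> mats ?I UNIV" "W \<noteq> (\<lambda>p u. 0)"
    using rj T_mats by (auto simp: W_def mats_def fun_eq_iff)
  have "\<forall>p\<in>?I. \<exists>c. mmul ?I (lin ?S c R) W = munit p ()"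
    using assms(1) W unfolding irred_rep_def by blast
  then obtain c where c: "\<And>p. p < d \<Longrightarrow> mmul ?I (lin ?S (c p) R) W = munit p ()"
    by (metis lessThan_iff)
  \<comment> \<open>The element of \<open>ann\<close> generated by \<open>T\<close> whose column \<open>j\<close> is the \<open>p\<close>-th basis vector.\<close>
  define X where "X p = mmul ?I (lin ?S (c p) R) T" for p
  have X_ann: "X p \<in> ann" for p
    unfolding X_def mmul_lin_left by (intro ann_lin ann_mult T)
  have X_mats: "X p \<in> mats ?I ?I" for p using X_ann by (simp add: ann_def)
  have X_cols: "X p q i = 0" if "i \<notin> cols T" for p q i
    using that by (auto simp: X_def mmul_def cols_def)
  have X_j: "X p q j = (if q = p then 1 else 0)" if "p < d" for p q
    using fun_cong[OF fun_cong[OF c[OF that]], of q "()"] by (simp add: X_def mmul_def W_def munit_def)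
  have commute: "mmul ?I (R g) (X p) = lin ?I (\<lambda>q. R g q p) X" if g: "g \<in> ?S" and p: "p < d" for g p
  proof -
    define Z where "Z = (\<lambda>q i. mmul ?I (R g) (X p) q i - lin ?I (\<lambda>q. R g q p) X q i)"
    have Z: "Z = lin UNIV (\<lambda>b. if b then 1 else -1)
        (\<lambda>b. if b then mmul ?I (R g) (X p) else lin ?I (\<lambda>q. R g q p) X)"
      by (simp add: Z_def lin_def UNIV_bool)
    have "mmul ?I (R g) (X p) \<in> ann" "lin ?I (\<lambda>q. R g q p) X \<in> ann"
      by (rule ann_mult[OF g X_ann]) (rule ann_lin[OF X_ann])
    then have "Z \<in> ann" unfolding Z by (intro ann_lin) simp
    moreover have "Z q i = 0" if "i \<notin> cols T" for q i
      using X_cols[OF that] by (simp add: Z_def mmul_def lin_def)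
    then have "cols Z \<subseteq> cols T" unfolding cols_def[of Z] by blast
    moreover have "Z q j = 0" for q
    proof -
      have "mmul ?I (R g) (X p) q j = R g q p"
        using p by (simp add: mmul_def X_j if_distrib[of "\<lambda>x. _ * x"] cong: if_cong)
      moreover have "lin ?I (\<lambda>q. R g q p) X q j = (\<Sum>x<d. if q = x then R g x p else 0)"
        unfolding lin_def by (intro sum.cong) (auto simp: X_j)
      ultimately show ?thesis
        using matsD[OF R_mats[OF g], of q p] by (auto simp: Z_def)
    qed
    ultimately have "Z = (\<lambda>p q. 0)" by (rule zero)
    then show ?thesis by (auto simp: Z_def fun_eq_iff)
  qed
  have scalar: "\<exists>x. \<forall>q<d. \<forall>p<d. X p q i = (if q = p then x else 0)" for i
  proof -
    \<comment> \<open>The endomorphism that sends column \<open>j\<close> to column \<open>i\<close>.\<close>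
    define A where "A = (\<lambda>q p. if p < d then X p q i else 0)"
    have "A \<in> hom_mats G ?I R ?I R"
    proof -
      have "mmul ?I (R g) A = mmul ?I A (R g)" if g: "g \<in> ?S" for g
      proof (intro ext)
        fix q p
        show "mmul ?I (R g) A q p = mmul ?I A (R g) q p"
          using fun_cong[OF fun_cong[OF commute[OF g, of p]], of q i] matsD[OF R_mats[OF g], of _ p]
          by (cases "p < d") (auto simp: mmul_def lin_def A_def mult.commute)
      qed
      moreover have "A \<in> mats ?I ?I" using X_mats by (auto simp: A_def mats_def)
      ultimately show ?thesis by (simp add: hom_mats_def)
    qed
    from commutant_scalar[OF assms(1) this] show ?thesis by (auto simp: A_def)
  qed
  \<comment> \<open>The trace of \<open>X j\<close> vanishes, yet its only nonzero diagonal entry is the one in column \<open>j\<close>.\<close>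
  have "R \<one>\<^bsub>G\<^esub> = idm ?I" using rep by (simp add: mat_rep_def)
  then have X_one: "mmul ?I (X j) (R \<one>\<^bsub>G\<^esub>) = X j"
    by (simp add: mmul_idm_right[OF _ X_mats])
  have "\<forall>g\<in>?S. (\<Sum>q<d. mmul ?I (X j) (R g) q q) = 0"
    using X_ann[of j] by (simp add: ann_def)
  from bspec[OF this G.one_closed] have "(\<Sum>q<d. X j q q) = 0"
    unfolding X_one .
  moreover have "(\<Sum>q<d. X j q q) = (\<Sum>q<d. if q = j then 1 else 0)"
  proof (intro sum.cong refl)
    fix q assume "q \<in> ?I"
    then show "X j q q = (if q = j then 1 else 0)"
      using scalar[of q] X_j[OF j, of q] j by (cases "q = j") auto
  qed
  ultimately show False using j by simp
qed

section \<open>Modules in coordinates\<close>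

text \<open>
  The module of column vectors on which \<open>g\<close> acts by the matrix \<open>R g\<close>. The multiplicative part of the record
  carries no meaning.
\<close>

definition matmod :: "nat \<Rightarrow> ('g \<Rightarrow> nat \<Rightarrow> nat \<Rightarrow> 'k :: field) \<Rightarrow> ('k, 'k vec, 'g) kG_record" where
  "matmod d R = \<lparr>carrier = carrier_vec d, monoid.mult = (\<lambda>x y. x), one = 0\<^sub>v d, zero = 0\<^sub>v d,
     add = (+), smult = (\<cdot>\<^sub>v), act = (\<lambda>g v. vec d (\<lambda>p. \<Sum>q<d. R g p q * v $ q))\<rparr>"

lemma matmod_simps [simp]:
  "carrier (matmod d R) = carrier_vec d" "add (matmod d R) = (+)" "smult (matmod d R) = (\<cdot>\<^sub>v)"
  "zero (matmod d R) = 0\<^sub>v d" "act (matmod d R) g v = vec d (\<lambda>p. \<Sum>q<d. R g p q * v $ q)"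
  by (simp_all add: matmod_def)

definition coords :: "('k :: field, 'v, 'z) module_scheme \<Rightarrow> nat \<Rightarrow> ('v \<Rightarrow> 'k vec) \<Rightarrow> bool" where
  "coords X d f \<longleftrightarrow> bij_betw f (carrier X) (carrier_vec d) \<and>
     (\<forall>v\<in>carrier X. \<forall>w\<in>carrier X. f (v \<oplus>\<^bsub>X\<^esub> w) = f v + f w) \<and>
     (\<forall>c. \<forall>v\<in>carrier X. f (c \<odot>\<^bsub>X\<^esub> v) = c \<cdot>\<^sub>v f v)"

definition equivariant ::
    "('g, 'm) monoid_scheme \<Rightarrow> ('k :: field, 'v, 'g) kG_record \<Rightarrow> nat \<Rightarrow> ('g \<Rightarrow> nat \<Rightarrow> nat \<Rightarrow> 'k)
      \<Rightarrow> ('v \<Rightarrow> 'k vec) \<Rightarrow> bool" where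
  "equivariant G X d R f \<longleftrightarrow>
     (\<forall>g\<in>carrier G. \<forall>v\<in>carrier X. f (act X g v) = act (matmod d R) g (f v))"

lemma coordsD:
  assumes "coords X d f"
  shows "bij_betw f (carrier X) (carrier_vec d)" "inj_on f (carrier X)" "f ` carrier X = carrier_vec d"
    "v \<in> carrier X \<Longrightarrow> f v \<in> carrier_vec d"
    "v \<in> carrier X \<Longrightarrow> w \<in> carrier X \<Longrightarrow> f (v \<oplus>\<^bsub>X\<^esub> w) = f v + f w"
    "v \<in> carrier X \<Longrightarrow> f (c \<odot>\<^bsub>X\<^esub> v) = c \<cdot>\<^sub>v f v"
  using assms by (auto simp: coords_def bij_betw_def)

lemma coords_inv:
  assumes "coords X d f" "u \<in> carrier_vec d"
  shows "inv_into (carrier X) f u \<in> carrier X" "f (inv_into (carrier X) f u) = u"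
  using coordsD(3)[OF assms(1)] assms(2) by (auto simp: inv_into_into f_inv_into_f)

lemma coords_inv_left: "coords X d f \<Longrightarrow> v \<in> carrier X \<Longrightarrow> inv_into (carrier X) f (f v) = v"
  by (rule inv_into_f_f[OF coordsD(2)])

lemma coords_zero:
  assumes "vectorspace class_ring X" "coords X d f"
  shows "f \<zero>\<^bsub>X\<^esub> = 0\<^sub>v d"
proof -
  interpret vectorspace class_ring X by fact
  have "f \<zero>\<^bsub>X\<^esub> = f (0 \<odot>\<^bsub>X\<^esub> \<zero>\<^bsub>X\<^esub>)" using lmult_0[OF M.zero_closed] by simp
  also have "\<dots> = 0 \<cdot>\<^sub>v f \<zero>\<^bsub>X\<^esub>" by (rule coordsD(6)[OF assms(2) M.zero_closed])
  also have "\<dots> = 0\<^sub>v d" using coordsD(4)[OF assms(2) M.zero_closed] by (intro eq_vecI) auto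
  finally show ?thesis .
qed

lemma coords_inv_add:
  assumes X: "vectorspace class_ring X" and f: "coords X d f" and uw: "u \<in> carrier_vec d" "w \<in> carrier_vec d"
  shows "inv_into (carrier X) f (u + w) = inv_into (carrier X) f u \<oplus>\<^bsub>X\<^esub> inv_into (carrier X) f w"
proof -
  interpret vectorspace class_ring X by fact
  show ?thesis
    using coords_inv_left[OF f, of "inv_into (carrier X) f u \<oplus>\<^bsub>X\<^esub> inv_into (carrier X) f w"] uw
    by (simp add: coordsD(5)[OF f] coords_inv[OF f])
qed

lemma coords_inv_smult:
  assumes X: "vectorspace class_ring X" and f: "coords X d f" and u: "u \<in> carrier_vec d"
  shows "inv_into (carrier X) f (c \<cdot>\<^sub>v u) = c \<odot>\<^bsub>X\<^esub> inv_into (carrier X) f u"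
proof -
  interpret vectorspace class_ring X by fact
  show ?thesis
    using coords_inv_left[OF f, of "c \<odot>\<^bsub>X\<^esub> inv_into (carrier X) f u"] u
    by (simp add: coordsD(6)[OF f] coords_inv[OF f])
qed

lemma (in kG_module) act_closed: "g \<in> carrier G \<Longrightarrow> v \<in> carrier X \<Longrightarrow> act X g v \<in> carrier X"
  using LinearCombinations.module_hom_closed[OF act_linear] by blast

lemma coords_exist:
  assumes X: "vectorspace class_ring X" and fd: "vectorspace.fin_dim class_ring X"
  shows "\<exists>d f. coords X d f"
proof -
  interpret vectorspace class_ring X by fact
  obtain B where B: "finite B" "basis B" using finite_basis_exists[OF fd] by blast
  have BX: "B \<subseteq> carrier X" using B(2) by (simp add: basis_def)
  obtain xs where xs: "set xs = B" "distinct xs" using finite_distinct_list[OF B(1)] by blast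
  have ex1: "\<exists>!a. a \<in> B \<rightarrow>\<^sub>E UNIV \<and> lincomb a B = v" if "v \<in> carrier X" for v
    using basis_criterion[OF B(1) BX] B(2) that by auto
  define a where "a v = (THE a. a \<in> B \<rightarrow>\<^sub>E UNIV \<and> lincomb a B = v)" for v
  have a: "a v \<in> extensional B" "lincomb (a v) B = v" if "v \<in> carrier X" for v
    using theI'[OF ex1[OF that]] by (auto simp: a_def PiE_def)
  have a_eq: "a (lincomb b B) x = b x" if "x \<in> B" for b x
  proof -
    have "lincomb (restrict b B) B = lincomb b B"
      unfolding lincomb_def using BX by (intro M.finsum_cong') auto
    moreover have "lincomb b B \<in> carrier X" using lincomb_closed[OF BX, of b] by simp
    ultimately have "a (lincomb b B) = restrict b B"
      unfolding a_def using ex1 by (intro the1_equality) auto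
    then show ?thesis using that by simp
  qed
  define f where "f v = vec (length xs) (\<lambda>i. a v (xs ! i))" for v
  have mem: "xs ! i \<in> B" if "i < length xs" for i using that xs by auto
  have f_lincomb: "f (lincomb b B) = vec (length xs) (\<lambda>i. b (xs ! i))" for b
    by (rule eq_vecI) (simp_all add: f_def a_eq mem)
  have "bij_betw f (carrier X) (carrier_vec (length xs))"
  proof (rule bij_betwI)
    let ?idx = "\<lambda>x. THE i. i < length xs \<and> xs ! i = x"
    let ?g = "\<lambda>u. lincomb (\<lambda>x. u $ ?idx x) B"
    have idx: "?idx (xs ! i) = i" if "i < length xs" for i
      using that xs(2) by (intro the_equality) (auto simp: nth_eq_iff_index_eq)
    show "f \<in> carrier X \<rightarrow> carrier_vec (length xs)" by (auto simp: f_def)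
    show "?g \<in> carrier_vec (length xs) \<rightarrow> carrier X" using lincomb_closed[OF BX] by auto
    show "?g (f v) = v" if v: "v \<in> carrier X" for v
    proof -
      have "lincomb (\<lambda>x. f v $ ?idx x) B = lincomb (a v) B"
        unfolding lincomb_def
      proof (rule M.finsum_cong')
        fix x assume "x \<in> B"
        then obtain i where "i < length xs" "x = xs ! i" using xs(1) by (metis in_set_conv_nth)
        then show "(f v $ ?idx x) \<odot>\<^bsub>X\<^esub> x = a v x \<odot>\<^bsub>X\<^esub> x" by (simp add: idx f_def)
      qed (use BX in auto)
      then show ?thesis using a(2)[OF v] by simp
    qed
    show "f (?g u) = u" if "u \<in> carrier_vec (length xs)" for u
      unfolding f_lincomb by (rule eq_vecI) (use that in \<open>auto simp: idx\<close>)
  qed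
  moreover have "f (v \<oplus>\<^bsub>X\<^esub> w) = f v + f w" if "v \<in> carrier X" "w \<in> carrier X" for v w
  proof -
    have "v \<oplus>\<^bsub>X\<^esub> w = lincomb (\<lambda>x. a v x + a w x) B"
      using lincomb_sum[OF B(1) BX, of "a v" "a w"] a(2)[OF that(1)] a(2)[OF that(2)] by simp
    then show ?thesis unfolding f_lincomb[of "\<lambda>x. a v x + a w x", folded \<open>v \<oplus>\<^bsub>X\<^esub> w = _\<close>]
      by (auto simp: f_def)
  qed
  moreover have "f (c \<odot>\<^bsub>X\<^esub> v) = c \<cdot>\<^sub>v f v" if "v \<in> carrier X" for c v
  proof -
    have "c \<odot>\<^bsub>X\<^esub> v = lincomb (\<lambda>x. c * a v x) B"
      using lincomb_smult[OF BX, of "a v" c] a(2)[OF that] by simp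
    then show ?thesis unfolding f_lincomb[of "\<lambda>x. c * a v x", folded \<open>c \<odot>\<^bsub>X\<^esub> v = _\<close>]
      by (auto simp: f_def)
  qed
  ultimately show ?thesis unfolding coords_def by blast
qed

lemma linear_eq_matrix:
  assumes "\<And>v w. v \<in> carrier_vec e \<Longrightarrow> w \<in> carrier_vec e \<Longrightarrow> \<phi> (v + w) = \<phi> v + \<phi> w"
    and "\<And>c v. v \<in> carrier_vec e \<Longrightarrow> \<phi> (c \<cdot>\<^sub>v v) = c \<cdot>\<^sub>v \<phi> v"
    and \<phi>: "\<And>v. v \<in> carrier_vec e \<Longrightarrow> \<phi> v \<in> carrier_vec d"
    and "v \<in> carrier_vec e" "p < d"
  shows "\<phi> v $ p = (\<Sum>q<e. \<phi> (unit_vec e q) $ p * v $ q :: 'k :: field)"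
proof -
  let ?tr = "\<lambda>k. vec e (\<lambda>i. if i < k then v $ i else 0)"
  have "\<phi> (?tr k) $ p = (\<Sum>q<k. \<phi> (unit_vec e q) $ p * v $ q)" if "k \<le> e" for k
    using that
  proof (induction k)
    case 0
    have "\<phi> (0 \<cdot>\<^sub>v 0\<^sub>v e) = 0 \<cdot>\<^sub>v \<phi> (0\<^sub>v e)" by (rule assms(2)) simp
    moreover have "?tr 0 = 0 \<cdot>\<^sub>v 0\<^sub>v e" by (rule eq_vecI) auto
    ultimately show ?case using \<phi>[of "0\<^sub>v e"] \<open>p < d\<close> by simp
  next
    case (Suc k)
    have "?tr (Suc k) = ?tr k + v $ k \<cdot>\<^sub>v unit_vec e k"
      using Suc.prems by (intro eq_vecI) (auto simp: unit_vec_def less_Suc_eq)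
    then have "\<phi> (?tr (Suc k)) = \<phi> (?tr k) + v $ k \<cdot>\<^sub>v \<phi> (unit_vec e k)"
      by (simp add: assms(1,2))
    then show ?case
      using Suc \<phi>[of "?tr k"] \<phi>[of "unit_vec e k"] \<open>p < d\<close> by simp
  qed
  moreover have "?tr e = v" using assms(4) by (intro eq_vecI) auto
  ultimately show ?thesis by (metis le_refl)
qed

lemma rep_of_coords:
  fixes X :: "('k :: field, 'v, 'g) kG_record"
  assumes X: "kG_module G X" and f: "coords X d f"
  shows "\<exists>R. mat_rep G {..<d} R \<and> equivariant G X d R f"
proof -
  interpret kG_module G X by fact
  let ?g = "inv_into (carrier X) f"
  note [simp] = coords_inv[OF f] coordsD(4)[OF f]
  note act_cl = act_closed
  define R where "R g = (\<lambda>p q. if p < d \<and> q < d then f (act X g (?g (unit_vec d q))) $ p else 0)" for g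
  have R_eq: "f (act X g v) = act (matmod d R) g (f v)" if g: "g \<in> carrier G" and v: "v \<in> carrier X" for g v
  proof -
    let ?\<phi> = "\<lambda>u. f (act X g (?g u))"
    note inv_add = coords_inv_add[OF vectorspace_axioms f] and inv_smult = coords_inv_smult[OF vectorspace_axioms f]
    have "?\<phi> (f v) $ p = (\<Sum>q<d. ?\<phi> (unit_vec d q) $ p * f v $ q)" if "p < d" for p
    proof (rule linear_eq_matrix[where \<phi> = ?\<phi>])
      fix u w :: "'k vec" assume "u \<in> carrier_vec d" "w \<in> carrier_vec d"
      then show "?\<phi> (u + w) = ?\<phi> u + ?\<phi> w"
        using act_linear[OF g] by (simp add: inv_add LinearCombinations.module_hom_def coordsD(5)[OF f] act_cl g)
    next
      fix c and u :: "'k vec" assume "u \<in> carrier_vec d"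
      then show "?\<phi> (c \<cdot>\<^sub>v u) = c \<cdot>\<^sub>v ?\<phi> u"
        using act_linear[OF g] by (simp add: inv_smult LinearCombinations.module_hom_def coordsD(6)[OF f] act_cl g)
    qed (use that v g act_cl in auto)
    then show ?thesis
      using v act_cl[OF g v] by (intro eq_vecI) (auto simp: R_def coords_inv_left[OF f])
  qed
  have ent: "R g p q = f (act X g (?g (unit_vec d q))) $ p" if "p < d" "q < d" for g p q
    using that by (simp add: R_def)
  have m: "R g \<in> mats {..<d} {..<d}" for g by (auto simp: R_def mats_def)
  have "R \<one>\<^bsub>G\<^esub> = idm {..<d}"
    by (rule mats_eqI[OF m idm_mats]) (auto simp: ent act_one idm_def)
  moreover have "R (g \<otimes>\<^bsub>G\<^esub> h) = mmul {..<d} (R g) (R h)" if "g \<in> carrier G" "h \<in> carrier G" for g h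
  proof (rule mats_eqI[OF m mmul_mats[OF m m]])
    fix p q assume pq: "p \<in> {..<d}" "q \<in> {..<d}"
    let ?v = "act X h (?g (unit_vec d q))"
    have "R (g \<otimes>\<^bsub>G\<^esub> h) p q = f (act X g ?v) $ p"
      using pq that by (simp add: ent act_mult)
    also have "\<dots> = (\<Sum>r<d. R g p r * f ?v $ r)"
      using pq that by (simp add: R_eq act_cl)
    finally show "R (g \<otimes>\<^bsub>G\<^esub> h) p q = mmul {..<d} (R g) (R h) p q"
      using pq by (simp add: mmul_def ent)
  qed
  ultimately have "mat_rep G {..<d} R" using m by (simp add: mat_rep_def)
  then show ?thesis using R_eq unfolding equivariant_def by blast
qed

text \<open>
  Applied to identity maps, this passes between records that share their vector space structure.
\<close>

lemma surjective_image_fin_dim: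
  assumes "vectorspace K V" "vectorspace K W" "f \<in> LinearCombinations.module_hom K V W"
    and "f ` carrier V = carrier W" "vectorspace.fin_dim K V"
  shows "vectorspace.fin_dim K W"
proof -
  interpret linear_map K V W f
    using assms by (intro linear_map.intro mod_hom.intro mod_hom_axioms.intro) (auto simp: vectorspace_def)
  show ?thesis by (rule surj_fin_dim[OF assms(5,4)])
qed

lemma matmod_vectorspace:
  fixes R :: "'g \<Rightarrow> nat \<Rightarrow> nat \<Rightarrow> 'k :: field"
  shows "vectorspace class_ring (matmod d R)"
proof (rule vs_criteria)
  show "field (class_ring :: 'k ring)" using vec_vs unfolding vectorspace_def by blast
  show "\<forall>v\<in>carrier (matmod d R). \<exists>w\<in>carrier (matmod d R). v \<oplus>\<^bsub>matmod d R\<^esub> w = \<zero>\<^bsub>matmod d R\<^esub>"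
    by (auto intro!: bexI[of _ "- _"] uminus_r_inv_vec)
qed (auto simp: comm_add_vec assoc_add_vec add_smult_distrib_vec smult_add_distrib_vec smult_smult_assoc)

lemma matmod_fin_dim: "vectorspace.fin_dim class_ring (matmod d R)"
  using vec_space.fin_dim[of d] 
  by (intro surjective_image_fin_dim[OF vec_vs matmod_vectorspace, of id])
    (auto simp: LinearCombinations.module_hom_def module_vec_simps)

lemma matmod_module:
  fixes R :: "'g \<Rightarrow> nat \<Rightarrow> nat \<Rightarrow> 'k :: field"
  assumes "mat_rep G {..<d} R"
  shows "kG_module G (matmod d R)"
proof (rule kG_module.intro[OF matmod_vectorspace kG_module_axioms.intro[OF matmod_fin_dim]])
  fix g assume "g \<in> carrier G"
  show "act (matmod d R) g \<in> LinearCombinations.module_hom class_ring (matmod d R) (matmod d R)"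
    by (auto simp: LinearCombinations.module_hom_def algebra_simps sum.distrib sum_distrib_left intro!: eq_vecI)
next
  fix v assume v: "v \<in> carrier (matmod d R)"
  have "R \<one>\<^bsub>G\<^esub> = idm {..<d}" using assms by (simp add: mat_rep_def)
  moreover have "(\<Sum>q<d. idm {..<d} p q * v $ q) = (\<Sum>q<d. if p = q then v $ q else 0)" if "p < d" for p
    using that by (intro sum.cong) (auto simp: idm_def)
  ultimately show "act (matmod d R) \<one>\<^bsub>G\<^esub> v = v" using v by (intro eq_vecI) auto
next
  fix g h v assume g: "g \<in> carrier G" "h \<in> carrier G" and v: "v \<in> carrier (matmod d R)"
  have "R (g \<otimes>\<^bsub>G\<^esub> h) = mmul {..<d} (R g) (R h)" using assms g by (simp add: mat_rep_def)
  moreover have "(\<Sum>q<d. mmul {..<d} (R g) (R h) p q * v $ q) = (\<Sum>r<d. R g p r * (\<Sum>q<d. R h r q * v $ q))" for p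
    unfolding mmul_def sum_distrib_left sum_distrib_right by (subst sum.swap) (simp add: mult.assoc)
  ultimately show "act (matmod d R) (g \<otimes>\<^bsub>G\<^esub> h) v = act (matmod d R) g (act (matmod d R) h v)"
    by (intro eq_vecI) auto
qed

text \<open>
  Equivariance ranges over the whole type, so that it covers products of elements of the carrier when the
  carrier is a stabilizer, of which only the underlying set is used.
\<close>

lemma module_of_coords:
  fixes X :: "('k :: field, 'v, 'g) kG_record"
  assumes X: "vectorspace class_ring X" "vectorspace.fin_dim class_ring X"
    and f: "coords X d f" and R: "mat_rep G {..<d} R"
    and cl: "\<And>g v. v \<in> carrier X \<Longrightarrow> act X g v \<in> carrier X"
    and eq: "\<And>g v. v \<in> carrier X \<Longrightarrow> f (act X g v) = act (matmod d R) g (f v)"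
  shows "kG_module G X"
proof -
  interpret vectorspace class_ring X by fact
  interpret M: kG_module G "matmod d R" by (rule matmod_module[OF R(1)])
  note inj = inj_onD[OF coordsD(2)[OF f]]
  show ?thesis
  proof (rule kG_module.intro[OF X(1) kG_module_axioms.intro[OF X(2)]])
    fix g assume g: "g \<in> carrier G"
    have L: "act (matmod d R) g \<in> LinearCombinations.module_hom class_ring (matmod d R) (matmod d R)"
      by (rule M.act_linear[OF g])
    have "act X g (v \<oplus>\<^bsub>X\<^esub> w) = act X g v \<oplus>\<^bsub>X\<^esub> act X g w" if "v \<in> carrier X" "w \<in> carrier X" for v w
      using L that by (intro inj)
        (simp_all add: cl eq coordsD(4,5)[OF f] LinearCombinations.module_hom_def del: matmod_simps(5))
    moreover have "act X g (c \<odot>\<^bsub>X\<^esub> v) = c \<odot>\<^bsub>X\<^esub> act X g v" if "v \<in> carrier X" for c v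
      using L that by (intro inj)
        (simp_all add: cl eq coordsD(4,6)[OF f] LinearCombinations.module_hom_def del: matmod_simps(5))
    ultimately show "act X g \<in> LinearCombinations.module_hom class_ring X X"
      using cl by (auto simp: LinearCombinations.module_hom_def)
  next
    fix v assume v: "v \<in> carrier X"
    show "act X \<one>\<^bsub>G\<^esub> v = v"
      using M.act_one[of "f v"] v by (intro inj) (simp_all add: cl eq coordsD(4)[OF f] del: matmod_simps(5))
  next
    fix g h v assume "g \<in> carrier G" "h \<in> carrier G" "v \<in> carrier X"
    then show "act X (g \<otimes>\<^bsub>G\<^esub> h) v = act X g (act X h v)"
      using M.act_mult[of g h "f v"] by (intro inj) (simp_all add: cl eq coordsD(4)[OF f] del: matmod_simps(5))
  qed
qed

lemma vectorspace_act_update: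
  assumes "vectorspace class_ring X"
  shows "vectorspace class_ring (X\<lparr>act := a\<rparr>)"
proof -
  interpret vectorspace class_ring X by fact
  show ?thesis
  proof (rule vs_criteria)
    show "field (class_ring :: 'a ring)" using assms unfolding vectorspace_def by blast
    show "\<forall>v\<in>carrier (X\<lparr>act := a\<rparr>). \<exists>w\<in>carrier (X\<lparr>act := a\<rparr>). v \<oplus>\<^bsub>X\<lparr>act := a\<rparr>\<^esub> w = \<zero>\<^bsub>X\<lparr>act := a\<rparr>\<^esub>"
      using M.r_neg M.a_inv_closed by fastforce
  qed (use M.a_comm M.a_assoc smult_r_distr smult_l_distr[simplified] smult_assoc1[simplified] smult_one[simplified] in auto)
qed

lemma module_by_matrices:
  fixes X :: "('k :: field, 'v, 'g) kG_record"
  assumes X: "vectorspace class_ring X" "vectorspace.fin_dim class_ring X" and f: "coords X d f"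
    and R: "mat_rep G {..<d} R"
  shows "kG_module G (X\<lparr>act := \<lambda>g v. inv_into (carrier X) f (act (matmod d R) g (f v))\<rparr>)"
    (is "kG_module G ?Y")
proof -
  have vs: "vectorspace class_ring ?Y" by (rule vectorspace_act_update[OF X(1)])
  show ?thesis
  proof (rule module_of_coords[OF vs _ _ R])
    show "vectorspace.fin_dim class_ring ?Y"
      by (rule surjective_image_fin_dim[OF X(1) vs _ _ X(2), of id])
        (auto simp: LinearCombinations.module_hom_def)
    show "coords ?Y d f" using f by (simp add: coords_def)
    fix g v assume "v \<in> carrier ?Y"
    show "act ?Y g v \<in> carrier ?Y" "f (act ?Y g v) = act (matmod d R) g (f v)"
      using coords_inv[OF f, of "act (matmod d R) g (f v)"] by simp_all
  qed
qed


section \<open>Simple modules\<close>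

lemma zero_smult_vec: "v \<in> carrier_vec d \<Longrightarrow> (0 :: 'k :: field) \<cdot>\<^sub>v v = 0\<^sub>v d"
  by (intro eq_vecI) auto

lemma (in group) lin_translate:
  assumes "g \<in> carrier G"
  shows "lin (carrier G) c (\<lambda>h. R (g \<otimes> h)) = lin (carrier G) (\<lambda>h. c (inv g \<otimes> h)) R"
proof (intro ext)
  fix p q
  show "lin (carrier G) c (\<lambda>h. R (g \<otimes> h)) p q = lin (carrier G) (\<lambda>h. c (inv g \<otimes> h)) R p q"
    unfolding lin_def using assms
    by (intro sum.reindex_bij_witness[of _ "\<lambda>h. inv g \<otimes> h" "\<lambda>h. g \<otimes> h"]) (auto simp: m_assoc[symmetric])
qed

lemma lin_one:
  assumes "group G" "finite (carrier G)" "mat_rep G I R"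
  shows "lin (carrier G) (\<lambda>g. if g = \<one>\<^bsub>G\<^esub> then 1 else 0) R = idm I"
proof -
  interpret group G by fact
  have "lin (carrier G) (\<lambda>g. if g = \<one>\<^bsub>G\<^esub> then 1 else 0) R = R \<one>\<^bsub>G\<^esub>"
    by (intro ext) (simp add: lin_def assms(2) if_distrib[of "\<lambda>x. x * _"] sum.delta cong: if_cong)
  then show ?thesis using assms(3) by (simp add: mat_rep_def)
qed

text \<open>
  The vectors that a given vector generates under the group algebra form a submodule.
\<close>

lemma simple_imp_irred:
  fixes X :: "('k :: field, 'v, 'g) kG_record"
  assumes X: "kG_simple G X" and G: "group G" "finite (carrier G)"
    and f: "coords X d f" and R: "mat_rep G {..<d} R" "equivariant G X d R f"
  shows "irred_rep G {..<d} R"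
proof -
  let ?I = "{..<d}" and ?S = "carrier G"
  interpret kG_module G X using X by (simp add: kG_simple_def)
  interpret G: group G by fact
  have vs: "vectorspace class_ring X" by unfold_locales
  have R_mult: "R (g \<otimes>\<^bsub>G\<^esub> h) = mmul ?I (R g) (R h)" if "g \<in> ?S" "h \<in> ?S" for g h
    using R(1) that by (simp add: mat_rep_def)
  have act_cl: "act X g v \<in> carrier X" if "g \<in> ?S" "v \<in> carrier X" for g v
    using act_linear[OF that(1)] that(2) by (auto simp: LinearCombinations.module_hom_def)
  have gen: "\<forall>p<d. \<exists>c. mmul ?I (lin ?S c R) W = munit p ()"
    if W: "W \<in> mats ?I (UNIV :: unit set)" "W \<noteq> (\<lambda>p u. 0)" for W
  proof -
    define Y where "Y = {v \<in> carrier X. \<exists>c. \<forall>p<d. f v $ p = mmul ?I (lin ?S c R) W p ()}"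
    have YI: "v \<in> Y" if "v \<in> carrier X" "\<And>p. p < d \<Longrightarrow> f v $ p = mmul ?I (lin ?S c R) W p ()" for v c
      using that by (auto simp: Y_def)
    have "submodule class_ring Y X"
    proof (unfold_locales)
      show "Y \<subseteq> carrier X" by (auto simp: Y_def)
      show "\<zero>\<^bsub>X\<^esub> \<in> Y"
        by (rule YI[of _ "\<lambda>g. 0"]) (simp_all add: coords_zero[OF vs f] mmul_def lin_def)
    next
      fix v w assume "v \<in> Y" "w \<in> Y"
      then obtain c c' where v: "v \<in> carrier X" "\<And>p. p < d \<Longrightarrow> f v $ p = mmul ?I (lin ?S c R) W p ()"
        and w: "w \<in> carrier X" "\<And>p. p < d \<Longrightarrow> f w $ p = mmul ?I (lin ?S c' R) W p ()"
        by (auto simp: Y_def)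
      show "v \<oplus>\<^bsub>X\<^esub> w \<in> Y"
        using v w coordsD(4)[OF f v(1)] coordsD(4)[OF f w(1)]
        by (intro YI[of _ "\<lambda>g. c g + c' g"])
          (simp_all add: coordsD(5)[OF f] mmul_def lin_def distrib_right sum.distrib)
    next
      fix x v assume "v \<in> Y"
      then obtain c where v: "v \<in> carrier X" "\<And>p. p < d \<Longrightarrow> f v $ p = mmul ?I (lin ?S c R) W p ()"
        by (auto simp: Y_def)
      show "x \<odot>\<^bsub>X\<^esub> v \<in> Y"
        using v coordsD(4)[OF f v(1)]
        by (intro YI[of _ "\<lambda>g. x * c g"])
          (simp_all add: coordsD(6)[OF f] mmul_def lin_def mult.assoc flip: sum_distrib_left)
    qed
    moreover have "act X g v \<in> Y" if g: "g \<in> ?S" and "v \<in> Y" for g v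
    proof -
      obtain c where v: "v \<in> carrier X" "\<And>p. p < d \<Longrightarrow> f v $ p = mmul ?I (lin ?S c R) W p ()"
        using \<open>v \<in> Y\<close> by (auto simp: Y_def)
      have "mmul ?I (R g) (lin ?S c R) = lin ?S (\<lambda>h. c (inv\<^bsub>G\<^esub> g \<otimes>\<^bsub>G\<^esub> h)) R"
        unfolding mmul_lin_right G.lin_translate[OF g, symmetric] using g by (intro lin_cong) (simp add: R_mult)
      then have "mmul ?I (lin ?S (\<lambda>h. c (inv\<^bsub>G\<^esub> g \<otimes>\<^bsub>G\<^esub> h)) R) W = mmul ?I (R g) (mmul ?I (lin ?S c R) W)"
        by (simp only: mmul_assoc[symmetric])
      moreover have "f (act X g v) $ p = mmul ?I (R g) (mmul ?I (lin ?S c R) W) p ()" if "p < d" for p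
        using R(2) g v that by (simp add: equivariant_def mmul_def)
      ultimately show ?thesis
        using g v by (intro YI[of _ "\<lambda>h. c (inv\<^bsub>G\<^esub> g \<otimes>\<^bsub>G\<^esub> h)"] act_cl) simp_all
    qed
    ultimately have Y: "Y = {\<zero>\<^bsub>X\<^esub>} \<or> Y = carrier X" using X by (simp add: kG_simple_def)
    define v where "v = inv_into (carrier X) f (vec d (\<lambda>p. W p ()))"
    have v: "v \<in> carrier X" "f v = vec d (\<lambda>p. W p ())"
      using coords_inv[OF f, of "vec d (\<lambda>p. W p ())"] by (auto simp: v_def)
    have "v \<in> Y"
      using v W(1) by (intro YI[of _ "\<lambda>g. if g = \<one>\<^bsub>G\<^esub> then 1 else 0"])
        (simp_all add: lin_one[OF G R(1)] mmul_idm_left)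
    moreover have "v \<noteq> \<zero>\<^bsub>X\<^esub>"
    proof
      assume "v = \<zero>\<^bsub>X\<^esub>"
      then have "vec d (\<lambda>p. W p ()) = 0\<^sub>v d" using v(2) coords_zero[OF vs f] by simp
      then have "W p () = 0" if "p < d" for p using that by (metis index_vec index_zero_vec(1))
      then show False using W by (auto simp: mats_def fun_eq_iff)
    qed
    ultimately have "Y = carrier X" using Y by blast
    show ?thesis
    proof (intro allI impI)
      fix p assume p: "p < d"
      define e where "e = inv_into (carrier X) f (unit_vec d p)"
      have e: "e \<in> carrier X" "f e = unit_vec d p"
        using coords_inv[OF f, of "unit_vec d p"] by (auto simp: e_def)
      then have "e \<in> Y" using \<open>Y = carrier X\<close> by simp
      then obtain c where c: "\<And>q. q < d \<Longrightarrow> f e $ q = mmul ?I (lin ?S c R) W q ()" by (auto simp: Y_def)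
      have "mmul ?I (lin ?S c R) W = munit p ()"
        using R(1) W(1) p c e(2)
        by (intro mats_eqI[of _ ?I UNIV] mmul_mats[OF lin_mats] munit_mats)
          (auto simp: mat_rep_def munit_def)
      then show "\<exists>c. mmul ?I (lin ?S c R) W = munit p ()" by blast
    qed
  qed
  have "d \<noteq> 0"
  proof
    assume "d = 0"
    have "v = \<zero>\<^bsub>X\<^esub>" if "v \<in> carrier X" for v
      using inj_onD[OF coordsD(2)[OF f], of v "\<zero>\<^bsub>X\<^esub>"] that coordsD(4)[OF f] \<open>d = 0\<close> coords_zero[OF vs f]
      by (metis M.zero_closed carrier_vecD eq_vecI index_zero_vec(2) less_nat_zero_code)
    then have "carrier X = {\<zero>\<^bsub>X\<^esub>}" by auto
    then show False using X by (simp add: kG_simple_def)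
  qed
  then show ?thesis using R(1) gen unfolding irred_rep_def by auto
qed

corollary simple_imp_full:
  fixes X :: "('k :: alg_closed_field, 'v, 'g) kG_record"
  assumes "kG_simple G X" "group G" "finite (carrier G)" "coords X d f" "mat_rep G {..<d} R"
    "equivariant G X d R f"
  shows "full_rep G {..<d} R"
  using assms by (intro burnside simple_imp_irred)

lemma simple_matmod:
  fixes X :: "('k :: field, 'v, 'g) kG_record"
  assumes X: "kG_simple G X" and f: "coords X d f" and R: "mat_rep G {..<d} R" "equivariant G X d R f"
  shows "kG_simple G (matmod d R)"
proof -
  interpret kG_module G X using X by (simp add: kG_simple_def)
  have vs: "vectorspace class_ring X" by unfold_locales
  note act_cl = act_closed
  have "W = {0\<^sub>v d} \<or> W = carrier_vec d"
    if sub: "submodule class_ring W (matmod d R)" and inv: "\<And>g w. g \<in> carrier G \<Longrightarrow> w \<in> W \<Longrightarrow> act (matmod d R) g w \<in> W"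
    for W
  proof -
    have W: "W \<subseteq> carrier_vec d" "0\<^sub>v d \<in> W" "\<And>v w. v \<in> W \<Longrightarrow> w \<in> W \<Longrightarrow> v + w \<in> W"
      "\<And>c v. v \<in> W \<Longrightarrow> c \<cdot>\<^sub>v v \<in> W"
      using sub by (auto simp: submodule_def)
    define Y where "Y = {v \<in> carrier X. f v \<in> W}"
    have "submodule class_ring Y X"
      by unfold_locales (auto simp: Y_def W coordsD[OF f] coords_zero[OF vs f])
    moreover have "\<forall>g\<in>carrier G. \<forall>w\<in>Y. act X g w \<in> Y"
      using inv R(2) act_cl by (auto simp: Y_def equivariant_def simp del: matmod_simps(5))
    ultimately have "Y = {\<zero>\<^bsub>X\<^esub>} \<or> Y = carrier X" using X by (auto simp: kG_simple_def)
    moreover have "f ` Y = W"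
      using coordsD(3)[OF f] W(1) by (auto simp: Y_def)
    ultimately show ?thesis
      using coordsD(3)[OF f] coords_zero[OF vs f] by auto
  qed
  moreover have "carrier_vec d \<noteq> {0\<^sub>v d :: 'k vec}"
  proof
    assume "carrier_vec d = {0\<^sub>v d :: 'k vec}"
    then have "v = \<zero>\<^bsub>X\<^esub>" if "v \<in> carrier X" for v
      using inj_onD[OF coordsD(2)[OF f], of v "\<zero>\<^bsub>X\<^esub>"] coordsD(4)[OF f that] that coords_zero[OF vs f] by simp
    then have "carrier X = {\<zero>\<^bsub>X\<^esub>}" by auto
    then show False using X by (simp add: kG_simple_def)
  qed
  ultimately show ?thesis
    using matmod_module[OF R(1)] unfolding kG_simple_def by (auto simp del: matmod_simps(5))
qed

text \<open>
  Choose a nonzero submodule \<open>W\<close> with the least bound \<open>m\<close> on its linearly independent subsets. A nonzero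
  submodule of \<open>W\<close> has no smaller bound, hence contains an independent set with \<open>m\<close> elements, and this set
  spans \<open>W\<close>. Applied to \<open>W\<close> itself, this shows that \<open>W\<close> has finite dimension.
\<close>

lemma simple_submodule_exists:
  fixes Z :: "('k :: field, 'v, 'g) kG_record"
  assumes Z: "kG_module G Z" and nz: "carrier Z \<noteq> {\<zero>\<^bsub>Z\<^esub>}"
  shows "\<exists>W. W \<subseteq> carrier Z \<and> kG_simple G (Z\<lparr>carrier := W\<rparr>)"
proof -
  interpret kG_module G Z by fact
  note act_cl = act_closed
  define P where "P m W \<longleftrightarrow> submodule class_ring W Z \<and> (\<forall>g\<in>carrier G. \<forall>w\<in>W. act Z g w \<in> W) \<and>
    W \<noteq> {\<zero>\<^bsub>Z\<^esub>} \<and> (\<forall>A\<subseteq>W. lin_indpt A \<longrightarrow> card A \<le> m)" for m W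
  have "P dim (carrier Z)"
    using nz act_cl li_le_dim(2)[OF finite_dimensional] by (auto simp: P_def submodule_def module_axioms)
  define m where "m = (LEAST m. \<exists>W. P m W)"
  have "\<exists>W. P m W" unfolding m_def by (rule LeastI_ex) (use \<open>P dim (carrier Z)\<close> in blast)
  then obtain W where W: "P m W" by blast
  have subW: "submodule class_ring W Z" "W \<subseteq> carrier Z"
    using W by (auto simp: P_def submodule_def)
  have bound: "card A \<le> m" if "A \<subseteq> W" "lin_indpt A" for A
    using W that by (simp add: P_def)
  have spans: "\<exists>A\<subseteq>W'. finite A \<and> W \<subseteq> span A"
    if W': "submodule class_ring W' Z" "\<forall>g\<in>carrier G. \<forall>w\<in>W'. act Z g w \<in> W'" "W' \<noteq> {\<zero>\<^bsub>Z\<^esub>}" "W' \<subseteq> W" for W'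
  proof -
    have "\<exists>A\<subseteq>W'. lin_indpt A \<and> m \<le> card A"
    proof (cases m)
      case 0
      then show ?thesis by (intro exI[of _ "{}"]) (auto simp: lin_dep_def)
    next
      case (Suc k)
      then have "\<not> P k W'" using not_less_Least[of k "\<lambda>m. \<exists>W. P m W"] by (auto simp: m_def)
      then show ?thesis using W' Suc by (auto simp: P_def not_le)
    qed
    then obtain A where A: "A \<subseteq> W'" "lin_indpt A" "m \<le> card A" by blast
    have AZ: "A \<subseteq> carrier Z" and AW: "A \<subseteq> W" using A(1) W'(4) subW by auto
    have finA: "finite A" by (rule li_le_dim(1)[OF finite_dimensional AZ A(2)])
    have "w \<in> span A" if w: "w \<in> W" for w
    proof (cases "w \<in> A")
      case True
      then show ?thesis using AZ span_mem by blast
    next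
      case False
      show ?thesis
      proof (rule ccontr)
        assume "w \<notin> span A"
        then have "lin_indpt (A \<union> {w})"
          using lin_dep_iff_in_span[OF AZ A(2) _ False] w subW by blast
        moreover have "A \<union> {w} \<subseteq> W" using AW w by blast
        ultimately have "card (A \<union> {w}) \<le> m" using bound by simp
        then show False using A(3) False finA by simp
      qed
    qed
    then show ?thesis using A(1) finA by blast
  qed
  let ?W = "Z\<lparr>carrier := W\<rparr>"
  have vsW: "vectorspace class_ring ?W"
    by (intro subspace_is_vs VectorSpace.subspace.intro subW(1)) unfold_locales
  then interpret W: vectorspace class_ring ?W .
  obtain A where A: "A \<subseteq> W" "finite A" "W \<subseteq> span A"
    using spans[OF subW(1)] W unfolding P_def by blast
  have "W.fin_dim"
    unfolding W.fin_dim_def using A span_is_subset[OF A(1) subW(1)] span_li_not_depend(1)[OF A(1) subW(1)]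
    by (intro exI[of _ A]) auto
  then have "kG_module G ?W"
  proof (intro kG_module.intro kG_module_axioms.intro vsW)
    fix g assume g: "g \<in> carrier G"
    show "act ?W g \<in> LinearCombinations.module_hom class_ring ?W ?W"
      using act_linear[OF g] g W subW by (auto simp: LinearCombinations.module_hom_def P_def subset_iff)
  qed (use subW act_one act_mult in auto)
  moreover have "W' = {\<zero>\<^bsub>Z\<^esub>} \<or> W' = W"
    if W': "submodule class_ring W' ?W" "\<forall>g\<in>carrier G. \<forall>w\<in>W'. act Z g w \<in> W'" for W'
  proof (cases "W' = {\<zero>\<^bsub>Z\<^esub>}")
    case False
    have sub: "W' \<subseteq> W" "submodule class_ring W' Z"
      using W'(1) subW module_axioms by (auto simp: submodule_def)
    obtain A where A: "A \<subseteq> W'" "W \<subseteq> span A"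
      using spans[OF sub(2) W'(2) False sub(1)] by blast
    then show ?thesis using span_is_subset[OF A(1) sub(2)] sub(1) by auto
  qed simp
  ultimately have "kG_simple G ?W" using W unfolding kG_simple_def by (auto simp: P_def)
  then show ?thesis using subW by blast
qed

text \<open>The columns of the intertwiner are the images of the unit vectors.\<close>

lemma hom_mats_of_embedding:
  fixes R :: "'g \<Rightarrow> nat \<Rightarrow> nat \<Rightarrow> 'k :: field"
  assumes add: "\<And>v w. v \<in> carrier_vec e \<Longrightarrow> w \<in> carrier_vec e \<Longrightarrow> \<phi> (v + w) = \<phi> v + \<phi> w"
    and smult: "\<And>c v. v \<in> carrier_vec e \<Longrightarrow> \<phi> (c \<cdot>\<^sub>v v) = c \<cdot>\<^sub>v \<phi> v"
    and \<phi>: "\<And>v. v \<in> carrier_vec e \<Longrightarrow> \<phi> v \<in> carrier_vec d"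
    and inj: "inj_on \<phi> (carrier_vec e)" and e: "e > 0"
    and eq: "\<And>g v. g \<in> carrier G \<Longrightarrow> v \<in> carrier_vec e \<Longrightarrow>
               \<phi> (act (matmod e M) g v) = act (matmod d R) g (\<phi> v)"
    and RM: "\<And>g. g \<in> carrier G \<Longrightarrow> R g \<in> mats {..<d} {..<d}" "\<And>g. g \<in> carrier G \<Longrightarrow> M g \<in> mats {..<e} {..<e}"
  shows "\<exists>U\<in>hom_mats G {..<d} R {..<e} M. U \<noteq> (\<lambda>p q. 0)"
proof -
  define U where "U = (\<lambda>p a. if p < d \<and> a < e then \<phi> (unit_vec e a) $ p else 0)"
  have U: "U \<in> mats {..<d} {..<e}" by (auto simp: U_def mats_def)
  have "mmul {..<d} (R g) U = mmul {..<e} U (M g)" if g: "g \<in> carrier G" for g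
  proof (rule mats_eqI[OF mmul_mats[OF RM(1)[OF g] U] mmul_mats[OF U RM(2)[OF g]]])
    fix p a assume pa: "p \<in> {..<d}" "a \<in> {..<e}"
    have "mmul {..<d} (R g) U p a = act (matmod d R) g (\<phi> (unit_vec e a)) $ p"
      using pa by (simp add: mmul_def U_def)
    also have "\<dots> = \<phi> (act (matmod e M) g (unit_vec e a)) $ p" using eq[OF g] by simp
    also have "\<dots> = (\<Sum>b<e. \<phi> (unit_vec e b) $ p * act (matmod e M) g (unit_vec e a) $ b)"
      using pa by (intro linear_eq_matrix[where d = d] add smult \<phi>) auto
    also have "\<dots> = mmul {..<e} U (M g) p a"
      using pa by (simp add: mmul_def U_def unit_vec_def if_distrib[of "\<lambda>x. _ * x"] cong: if_cong)
    finally show "mmul {..<d} (R g) U p a = mmul {..<e} U (M g) p a" .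
  qed
  moreover have "U \<noteq> (\<lambda>p q. 0)"
  proof
    assume "U = (\<lambda>p q. 0)"
    then have "U p 0 = 0" for p by simp
    then have "\<phi> (unit_vec e 0) $ p = 0" if "p < d" for p using that e by (metis U_def)
    then have "\<phi> (unit_vec e 0) = 0\<^sub>v d" using \<phi>[of "unit_vec e 0"] by (intro eq_vecI) auto
    moreover have "\<phi> (0 \<cdot>\<^sub>v unit_vec e 0) = 0 \<cdot>\<^sub>v \<phi> (unit_vec e 0)" by (rule smult) simp
    then have "\<phi> (0\<^sub>v e) = 0\<^sub>v d" using \<phi>[of "unit_vec e 0"] by (simp add: zero_smult_vec[of _ e] zero_smult_vec[of _ d])
    ultimately have "unit_vec e 0 = (0\<^sub>v e :: 'k vec)" using inj_onD[OF inj, of "unit_vec e 0" "0\<^sub>v e"] by simp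
    then have "(unit_vec e 0 :: 'k vec) $ 0 = 0\<^sub>v e $ 0" by (rule arg_cong)
    then show False using e by simp
  qed
  ultimately show ?thesis using U by (auto simp: hom_mats_def)
qed

lemma isomorphic_of_hom_mats:
  fixes R :: "'g \<Rightarrow> nat \<Rightarrow> nat \<Rightarrow> 'k :: field"
  assumes U: "U \<in> hom_mats G {..<d} R {..<e} M"
    and V: "mmul {..<d} V U = idm {..<e}" "mmul {..<e} U V = idm {..<d}"
  shows "kG_isomorphic G (matmod e M) (matmod d R)"
proof -
  let ?f = "\<lambda>v. vec d (\<lambda>p. \<Sum>a<e. U p a * v $ a)" and ?g = "\<lambda>v. vec e (\<lambda>a. \<Sum>p<d. V a p * v $ p)"
  have mv: "(\<Sum>q<m. A p q * (\<Sum>r<l. B q r * v $ r)) = (\<Sum>r<l. mmul {..<m} A B p r * v $ r)"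
    for A B :: "nat \<Rightarrow> nat \<Rightarrow> 'k" and l m p and v :: "'k vec"
    unfolding mmul_def sum_distrib_left sum_distrib_right by (subst sum.swap) (simp add: mult.assoc)
  have one: "(\<Sum>q<m. idm {..<m} p q * v $ q) = v $ p" if "p < m" for m p and v :: "'k vec"
  proof -
    have "(\<Sum>q<m. idm {..<m} p q * v $ q) = (\<Sum>q<m. if p = q then v $ q else 0)"
      using that by (intro sum.cong) (auto simp: idm_def)
    then show ?thesis using that by simp
  qed
  have "bij_betw ?f (carrier_vec e) (carrier_vec d)"
    by (rule bij_betw_byWitness[where f' = ?g]) (auto intro!: eq_vecI simp: mv V one)
  moreover have "?f \<in> LinearCombinations.module_hom class_ring (matmod e M) (matmod d R)"
    by (auto simp: LinearCombinations.module_hom_def algebra_simps sum.distrib sum_distrib_left intro!: eq_vecI)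
  moreover have "?f (act (matmod e M) g v) = act (matmod d R) g (?f v)" if "g \<in> carrier G" for g v
    using U that by (intro eq_vecI) (simp_all add: mv hom_mats_def)
  ultimately show ?thesis unfolding kG_isomorphic_def by (intro bexI[of _ ?f]) auto
qed

text \<open>
  The constituent comes both as a matrix representation and as a simple module, because the matrices are
  compared by \<open>schur\<close> while the extension is a property of the module.
\<close>

lemma full_subrep_exists:
  fixes R :: "'g \<Rightarrow> nat \<Rightarrow> nat \<Rightarrow> 'k :: alg_closed_field"
  assumes G: "group G" "finite (carrier G)" and R: "mat_rep G {..<D} R" and D: "D > 0"
  shows "\<exists>d M U. full_rep G {..<d} M \<and> kG_simple G (matmod d M) \<and>
           U \<in> hom_mats G {..<D} R {..<d} M \<and> U \<noteq> (\<lambda>p q. 0)"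
proof -
  let ?Z = "matmod D R"
  have "carrier ?Z \<noteq> {\<zero>\<^bsub>?Z\<^esub>}"
  proof
    assume "carrier ?Z = {\<zero>\<^bsub>?Z\<^esub>}"
    then have "unit_vec D 0 = (0\<^sub>v D :: 'k vec)" by (metis matmod_simps(1,4) singletonD unit_vec_carrier)
    then have "(unit_vec D 0 :: 'k vec) $ 0 = 0\<^sub>v D $ 0" by (rule arg_cong)
    then show False using D by simp
  qed
  then obtain W where W: "W \<subseteq> carrier_vec D" "kG_simple G (?Z\<lparr>carrier := W\<rparr>)"
    using simple_submodule_exists[OF matmod_module[OF R]] by auto
  let ?W = "?Z\<lparr>carrier := W\<rparr>"
  interpret W: kG_module G ?W using W(2) by (simp add: kG_simple_def)
  obtain d f where f: "coords ?W d f"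
    using coords_exist[OF W.vectorspace_axioms W.finite_dimensional] by blast
  obtain M where M: "mat_rep G {..<d} M" "equivariant G ?W d M f"
    using rep_of_coords[OF W.kG_module_axioms f] by blast
  have full: "full_rep G {..<d} M" by (rule simple_imp_full[OF W(2) G f M])
  let ?\<phi> = "inv_into W f"
  note \<phi> = coords_inv[OF f, simplified] and \<phi>' = coords_inv_left[OF f, simplified]
  have act_cl: "act ?Z g v \<in> W" if "g \<in> carrier G" "v \<in> W" for g v
    using W.act_closed that by simp
  have "\<exists>U\<in>hom_mats G {..<D} R {..<d} M. U \<noteq> (\<lambda>p q. 0)"
  proof (rule hom_mats_of_embedding[where \<phi> = ?\<phi>])
    fix v w :: "'k vec" assume "v \<in> carrier_vec d" "w \<in> carrier_vec d"
    then show "?\<phi> (v + w) = ?\<phi> v + ?\<phi> w"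
      using coords_inv_add[OF W.vectorspace_axioms f] by simp
  next
    fix c and v :: "'k vec" assume "v \<in> carrier_vec d"
    then show "?\<phi> (c \<cdot>\<^sub>v v) = c \<cdot>\<^sub>v ?\<phi> v"
      using coords_inv_smult[OF W.vectorspace_axioms f] by simp
  next
    fix v :: "'k vec" assume "v \<in> carrier_vec d"
    then show "?\<phi> v \<in> carrier_vec D" using \<phi> W(1) by blast
  next
    show "inj_on ?\<phi> (carrier_vec d)" using \<phi>(2) by (metis inj_onI)
    show "d > 0" using full by (auto simp: full_rep_def)
  next
    fix g and v :: "'k vec" assume gv: "g \<in> carrier G" "v \<in> carrier_vec d"
    have "f (act ?Z g (?\<phi> v)) = act (matmod d M) g v"
      using M(2) gv \<phi>[OF gv(2)] by (simp add: equivariant_def)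
    then show "?\<phi> (act (matmod d M) g v) = act ?Z g (?\<phi> v)"
      using \<phi>'[OF act_cl[OF gv(1) \<phi>(1)[OF gv(2)]]] by simp
  qed (use R M in \<open>auto simp: mat_rep_def\<close>)
  then show ?thesis using full simple_matmod[OF W(2) f M] by blast
qed

section \<open>Representations of a direct power\<close>

lemma lin_diff: "lin S (\<lambda>g. c g - c' g) R = (\<lambda>p q. lin S c R p q - lin S c' R p q)"
  by (simp add: lin_def left_diff_distrib sum_subtractf)

lemma lin_lin: "lin S (\<lambda>h. \<Sum>x\<in>I. m x * c x h) R = lin I m (\<lambda>x. lin S (c x) R)"
  unfolding lin_def sum_distrib_left sum_distrib_right
  by (intro ext, subst sum.swap) (simp add: mult.assoc)

text \<open>
  As a function of its first index, \<open>X\<close> behaves under \<open>R\<close> like the basis vectors under \<open>M\<close>; matrix units have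
  this property. So the vectors that the matrices \<open>X c a\<close> make of a fixed basis vector \<open>q\<close> are the columns of a
  homomorphism.
\<close>

lemma hom_of_columns:
  assumes X: "\<And>a b. a \<in> I \<Longrightarrow> b \<in> I \<Longrightarrow> X a b \<in> mats J J" and M: "\<And>g. g \<in> carrier G \<Longrightarrow> M g \<in> mats I I"
    and eq: "\<And>g a b. g \<in> carrier G \<Longrightarrow> a \<in> I \<Longrightarrow> b \<in> I \<Longrightarrow>
               mmul J (R g) (X a b) = lin I (\<lambda>c. M g c a) (\<lambda>c. X c b)"
    and a: "a \<in> I" "X a a \<noteq> (\<lambda>p q. 0)"
  shows "\<exists>V\<in>hom_mats G J R I M. V \<noteq> (\<lambda>p q. 0)"
proof -
  obtain p q where pq: "X a a p q \<noteq> 0" using a(2) by (auto simp: fun_eq_iff)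
  define V where "V = (\<lambda>r c. if c \<in> I then X c a r q else 0)"
  have "mmul J (R g) V = mmul I V (M g)" if g: "g \<in> carrier G" for g
  proof (intro ext)
    fix r c
    show "mmul J (R g) V r c = mmul I V (M g) r c"
    proof (cases "c \<in> I")
      case True
      then have "mmul J (R g) V r c = lin I (\<lambda>c'. M g c' c) (\<lambda>c'. X c' a) r q"
        by (simp add: eq[OF g True a(1), symmetric] mmul_def V_def)
      then show ?thesis by (simp add: lin_def mmul_def V_def mult.commute)
    qed (use matsD[OF M[OF g]] in \<open>simp add: mmul_def V_def\<close>)
  qed
  moreover have "V \<in> mats J I"
    using matsD[OF X[OF _ a(1)]] by (auto simp: mats_def V_def intro: ccontr split: if_splits)
  moreover have "V p a \<noteq> 0" using pq a(1) by (simp add: V_def)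
  ultimately show ?thesis by (auto simp: hom_mats_def intro!: bexI[of _ V])
qed

text \<open>
  The outer tensor product, in the basis of pure tensors: tuples of basis indices.
\<close>

definition tensor_rep ::
    "'j set \<Rightarrow> ('j \<Rightarrow> 'e set) \<Rightarrow> ('j \<Rightarrow> 'g \<Rightarrow> 'e \<Rightarrow> 'e \<Rightarrow> 'k :: field) \<Rightarrow> ('j \<Rightarrow> 'g) \<Rightarrow> ('j \<Rightarrow> 'e) \<Rightarrow> ('j \<Rightarrow> 'e) \<Rightarrow> 'k" where
  "tensor_rep J E M x = (\<lambda>p q. if p \<in> Pi\<^sub>E J E \<and> q \<in> Pi\<^sub>E J E then \<Prod>i\<in>J. M i (x i) (p i) (q i) else 0)"

lemma prod_delta_PiE:
  assumes "finite J" "p \<in> Pi\<^sub>E J E" "q \<in> Pi\<^sub>E J E"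
  shows "(\<Prod>i\<in>J. if p i = q i then 1 else 0) = (if p = q then 1 else 0 :: 'k :: field)"
proof (cases "p = q")
  case False
  then obtain i where "i \<in> J" "p i \<noteq> q i"
    using assms(2,3) by (metis PiE_ext)
  then show ?thesis using False assms(1) by (auto intro!: prod_zero)
qed simp

lemma tensor_rep_rep:
  assumes J: "finite J" and M: "\<And>i. i \<in> J \<Longrightarrow> mat_rep L (E i) (M i)"
  shows "mat_rep (product_group J (\<lambda>_. L)) (Pi\<^sub>E J E) (tensor_rep J E M)"
proof -
  have fin: "finite (E i)" if "i \<in> J" for i using M[OF that] by (simp add: mat_rep_def)
  have "tensor_rep J E M \<one>\<^bsub>product_group J (\<lambda>_. L)\<^esub> = idm (Pi\<^sub>E J E)"
  proof (intro ext)
    fix p q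
    show "tensor_rep J E M \<one>\<^bsub>product_group J (\<lambda>_. L)\<^esub> p q = idm (Pi\<^sub>E J E) p q"
    proof (cases "p \<in> Pi\<^sub>E J E \<and> q \<in> Pi\<^sub>E J E")
      case True
      then have "(\<Prod>i\<in>J. M i \<one>\<^bsub>L\<^esub> (p i) (q i)) = (\<Prod>i\<in>J. if p i = q i then 1 else 0)"
        using M by (intro prod.cong) (auto simp: mat_rep_def idm_def PiE_iff)
      then show ?thesis using True prod_delta_PiE[OF J, of p E q] by (simp add: tensor_rep_def idm_def)
    qed (auto simp: tensor_rep_def idm_def)
  qed
  moreover have "tensor_rep J E M (x \<otimes>\<^bsub>product_group J (\<lambda>_. L)\<^esub> y) =
      mmul (Pi\<^sub>E J E) (tensor_rep J E M x) (tensor_rep J E M y)"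
    if x: "x \<in> carrier (product_group J (\<lambda>_. L))" "y \<in> carrier (product_group J (\<lambda>_. L))" for x y
  proof (intro ext)
    fix p q
    show "tensor_rep J E M (x \<otimes>\<^bsub>product_group J (\<lambda>_. L)\<^esub> y) p q =
        mmul (Pi\<^sub>E J E) (tensor_rep J E M x) (tensor_rep J E M y) p q"
    proof (cases "p \<in> Pi\<^sub>E J E \<and> q \<in> Pi\<^sub>E J E")
      case True
      have "(\<Prod>i\<in>J. M i (x i \<otimes>\<^bsub>L\<^esub> y i) (p i) (q i)) = (\<Prod>i\<in>J. \<Sum>r\<in>E i. M i (x i) (p i) r * M i (y i) r (q i))"
        using M x by (intro prod.cong) (auto simp: mat_rep_def mmul_def PiE_iff)
      also have "\<dots> = (\<Sum>r\<in>Pi\<^sub>E J E. \<Prod>i\<in>J. M i (x i) (p i) (r i) * M i (y i) (r i) (q i))"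
        using fin by (intro prod_sum_PiE J) auto
      finally show ?thesis using True by (simp add: tensor_rep_def mmul_def prod.distrib)
    qed (auto simp: tensor_rep_def mmul_def)
  qed
  moreover have "tensor_rep J E M x \<in> mats (Pi\<^sub>E J E) (Pi\<^sub>E J E)" for x
    by (auto simp: tensor_rep_def mats_def)
  ultimately show ?thesis using J fin by (simp add: mat_rep_def finite_PiE)
qed

lemma tensor_rep_full:
  fixes M :: "'j \<Rightarrow> 'g \<Rightarrow> 'e \<Rightarrow> 'e \<Rightarrow> 'k :: field"
  assumes J: "finite J" and L: "finite (carrier L)" and M: "\<And>i. i \<in> J \<Longrightarrow> full_rep L (E i) (M i)"
  shows "full_rep (product_group J (\<lambda>_. L)) (Pi\<^sub>E J E) (tensor_rep J E M)"
proof -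
  have "\<exists>c. lin (carrier (product_group J (\<lambda>_. L))) c (tensor_rep J E M) = munit a b"
    if ab: "a \<in> Pi\<^sub>E J E" "b \<in> Pi\<^sub>E J E" for a b
  proof -
    have "\<forall>i\<in>J. \<exists>c. lin (carrier L) c (M i) = munit (a i) (b i)"
      using M ab by (auto simp: full_rep_def PiE_iff)
    then obtain c where c: "\<And>i. i \<in> J \<Longrightarrow> lin (carrier L) (c i) (M i) = munit (a i) (b i)" by metis
    have "lin (carrier (product_group J (\<lambda>_. L))) (\<lambda>x. \<Prod>i\<in>J. c i (x i)) (tensor_rep J E M) p q = munit a b p q" for p q
    proof (cases "p \<in> Pi\<^sub>E J E \<and> q \<in> Pi\<^sub>E J E")
      case True
      then have "lin (carrier (product_group J (\<lambda>_. L))) (\<lambda>x. \<Prod>i\<in>J. c i (x i)) (tensor_rep J E M) p q =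
          (\<Sum>x\<in>Pi\<^sub>E J (\<lambda>_. carrier L). \<Prod>i\<in>J. c i (x i) * M i (x i) (p i) (q i))"
        by (simp add: lin_def tensor_rep_def prod.distrib)
      also have "\<dots> = (\<Prod>i\<in>J. \<Sum>l\<in>carrier L. c i l * M i l (p i) (q i))"
        using L by (intro prod_sum_PiE[symmetric] J) auto
      also have "\<dots> = (\<Prod>i\<in>J. munit (a i) (b i) (p i) (q i))"
        by (intro prod.cong refl) (simp add: c[symmetric] lin_def)
      also have "\<dots> = (\<Prod>i\<in>J. (if p i = a i then 1 else 0) * (if q i = b i then 1 else 0))"
        by (intro prod.cong) (auto simp: munit_def)
      also have "\<dots> = munit a b p q"
        unfolding prod.distrib using True ab by (simp add: prod_delta_PiE[OF J, of _ E] munit_def)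
      finally show ?thesis .
    next
      case False
      then have "tensor_rep J E M x p q = 0" for x unfolding tensor_rep_def by (rule if_not_P)
      moreover have "munit a b p q = (0 :: 'k)" using False ab by (auto simp: munit_def)
      ultimately show ?thesis by (simp add: lin_def)
    qed
    then show ?thesis by blast
  qed
  moreover have "Pi\<^sub>E J E \<noteq> {}" using M by (auto simp: full_rep_def PiE_eq_empty_iff)
  ultimately show ?thesis
    using tensor_rep_rep[OF J, of L E M] M by (auto simp: full_rep_def)
qed

locale power_rep = group L for L (structure) +
  fixes J :: "'j set" and I :: "'i set" and \<rho> :: "('j \<Rightarrow> 'a) \<Rightarrow> 'i \<Rightarrow> 'i \<Rightarrow> 'k :: field"
  assumes J: "finite J" and finL: "finite (carrier L)"
    and full: "full_rep (product_group J (\<lambda>_. L)) I \<rho>"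
begin

abbreviation P where "P \<equiv> product_group J (\<lambda>_. L)"

definition single :: "'j \<Rightarrow> 'a \<Rightarrow> 'j \<Rightarrow> 'a" where
  "single i l = (\<lambda>j\<in>J. if j = i then l else \<one>)"

lemma rep: "mat_rep P I \<rho>" and I: "finite I" "I \<noteq> {}"
  using full by (auto simp: full_rep_def mat_rep_def)

lemma rho_mult: "x \<in> carrier P \<Longrightarrow> y \<in> carrier P \<Longrightarrow> \<rho> (x \<otimes>\<^bsub>P\<^esub> y) = mmul I (\<rho> x) (\<rho> y)"
  and rho_mats: "x \<in> carrier P \<Longrightarrow> \<rho> x \<in> mats I I"
  using rep by (auto simp: mat_rep_def)

lemma group_P: "group P"
  by (simp add: is_group)

lemma single_closed: "l \<in> carrier L \<Longrightarrow> single i l \<in> carrier P"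
  by (simp add: single_def)

lemma single_mult: "l \<in> carrier L \<Longrightarrow> l' \<in> carrier L \<Longrightarrow> single i (l \<otimes> l') = single i l \<otimes>\<^bsub>P\<^esub> single i l'"
  by (auto simp: single_def fun_eq_iff)

lemma single_rep: "mat_rep L I (\<lambda>l. \<rho> (single i l))"
proof -
  have "single i \<one> = \<one>\<^bsub>P\<^esub>" by (auto simp: single_def fun_eq_iff)
  then show ?thesis
    using rep single_closed by (simp add: mat_rep_def single_mult del: carrier_product_group)
qed

text \<open>
  The vectors that \<open>\<phi>\<close>, acting through the \<open>i\<close>-th factor, kills together with all their translates form
  a submodule: the other factors commute with \<open>\<phi>\<close>, and the \<open>i\<close>-th factor maps the image of \<open>M\<close> to itself. It
  contains the image of \<open>M\<close>, so it is everything by simplicity.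
\<close>

lemma annihilator_single:
  assumes U: "U \<in> hom_mats L I (\<lambda>l. \<rho> (single i l)) E M" "U \<noteq> (\<lambda>p q. 0)"
    and i: "i \<in> J" and \<phi>: "lin (carrier L) \<phi> M = (\<lambda>p q. 0)"
  shows "lin (carrier L) \<phi> (\<lambda>l. \<rho> (single i l)) = (\<lambda>p q. 0)"
proof -
  let ?A = "lin (carrier L) \<phi> (\<lambda>l. \<rho> (single i l))"
  have AU: "mmul I ?A U = (\<lambda>p q. 0)"
    using hom_mats_lin[OF U(1)] \<phi> by (simp add: mmul_zero)
  have kill: "mmul I ?A (mmul I (\<rho> x) U) = (\<lambda>p q. 0)" if x: "x \<in> carrier P" for x
  proof -
    \<comment> \<open>Split \<open>x\<close> into its \<open>i\<close>-th component and a part that commutes with the \<open>i\<close>-th factor.\<close>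
    let ?y = "x(i := \<one>)"
    have xi: "x i \<in> carrier L" and y: "?y \<in> carrier P" using x i by (auto simp: PiE_iff extensional_def)
    have "x = ?y \<otimes>\<^bsub>P\<^esub> single i (x i)"
      using x i by (auto simp: single_def fun_eq_iff PiE_iff extensional_def restrict_def)
    then have x_eq: "\<rho> x = mmul I (\<rho> ?y) (\<rho> (single i (x i)))"
      using rho_mult[OF y single_closed[OF xi]] by metis
    have comm: "mmul I ?A (\<rho> ?y) = mmul I (\<rho> ?y) ?A"
      unfolding mmul_lin_left mmul_lin_right
    proof (rule lin_cong)
      fix l assume l: "l \<in> carrier L"
      have "single i l \<otimes>\<^bsub>P\<^esub> ?y = ?y \<otimes>\<^bsub>P\<^esub> single i l"
        using l x by (auto simp: single_def fun_eq_iff PiE_iff)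
      then show "mmul I (\<rho> (single i l)) (\<rho> ?y) = mmul I (\<rho> ?y) (\<rho> (single i l))"
        using rho_mult[OF y single_closed[OF l]] rho_mult[OF single_closed[OF l] y] by metis
    qed
    have "mmul I ?A (mmul I (\<rho> x) U) = mmul I (mmul I ?A (\<rho> ?y)) (mmul I (\<rho> (single i (x i))) U)"
      unfolding x_eq mmul_assoc ..
    also have "mmul I (\<rho> (single i (x i))) U = mmul E U (M (x i))"
      using U(1) xi by (simp add: hom_mats_def)
    also have "mmul I (mmul I ?A (\<rho> ?y)) (mmul E U (M (x i))) = mmul I (\<rho> ?y) (mmul E (mmul I ?A U) (M (x i)))"
      unfolding comm mmul_assoc ..
    finally show ?thesis unfolding AU by (simp add: mmul_zero)
  qed
  obtain b e where be: "U b e \<noteq> 0" using U(2) by (auto simp: fun_eq_iff)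
  then have b: "b \<in> I" using U(1) by (auto simp: hom_mats_def mats_def)
  show ?thesis
  proof (intro ext)
    fix p a
    show "?A p a = 0"
    proof (cases "a \<in> I")
      case True
      then obtain c where c: "lin (carrier P) c \<rho> = munit a b"
        using full b unfolding full_rep_def by blast
      have "mmul I ?A (mmul I (lin (carrier P) c \<rho>) U) = lin (carrier P) c (\<lambda>x. mmul I ?A (mmul I (\<rho> x) U))"
        unfolding mmul_lin_left[of I "carrier P"] mmul_lin_right[of I _ "carrier P"] ..
      also have "\<dots> = lin (carrier P) c (\<lambda>x p q. 0)" by (rule lin_cong) (rule kill)
      finally have "mmul I ?A (mmul I (munit a b) U) p e = 0"
        unfolding c by (simp add: lin_def)
      moreover have "mmul I ?A (mmul I (munit a b) U) p e = ?A p a * U b e"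
        using True b unfolding mmul_munit_left[OF I(1) b]
        by (simp add: mmul_def[of I ?A] I(1) if_distrib[of "\<lambda>x. _ * x"] cong: if_cong)
      ultimately show ?thesis using be by simp
    next
      case False
      have "?A \<in> mats I I" by (intro lin_mats rho_mats single_closed)
      then show ?thesis using False by (auto dest: matsD)
    qed
  qed
qed

lemma lin_eq_single:
  assumes "U \<in> hom_mats L I (\<lambda>l. \<rho> (single i l)) E M" "U \<noteq> (\<lambda>p q. 0)" "i \<in> J"
    and "lin (carrier L) \<phi> M = lin (carrier L) \<psi> M"
  shows "lin (carrier L) \<phi> (\<lambda>l. \<rho> (single i l)) = lin (carrier L) \<psi> (\<lambda>l. \<rho> (single i l))"
  using annihilator_single[OF assms(1-3), of "\<lambda>l. \<phi> l - \<psi> l"] assms(4)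
  by (simp add: lin_diff fun_eq_iff)

text \<open>
  A group element times a matrix unit: in \<open>M\<close>, multiplying the unit at \<open>(a, b)\<close> from the left by \<open>g\<close> gives
  the combination of the units \<open>(d, b)\<close> with the entries of column \<open>a\<close> of \<open>M g\<close>.
\<close>

lemma translate_unit:
  assumes M: "mat_rep L E M" and c: "\<And>a b. a \<in> E \<Longrightarrow> b \<in> E \<Longrightarrow> lin (carrier L) (c a b) M = munit a b"
    and "g \<in> carrier L" "a \<in> E" "b \<in> E"
  shows "lin (carrier L) (\<lambda>h. c a b (inv g \<otimes> h)) M = lin (carrier L) (\<lambda>h. \<Sum>d\<in>E. M g d a * c d b h) M"
proof -
  have E: "finite E" and Mg: "M g \<in> mats E E" using M assms(3) by (auto simp: mat_rep_def)
  have "lin (carrier L) (\<lambda>h. c a b (inv g \<otimes> h)) M = mmul E (M g) (lin (carrier L) (c a b) M)"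
    unfolding mmul_lin_right lin_translate[OF assms(3), symmetric]
    using M assms(3) by (intro lin_cong) (simp add: mat_rep_def)
  also have "\<dots> = (\<lambda>p q. if q = b then M g p a else 0)"
    using c assms(4,5) by (simp add: mmul_munit_right[OF E])
  also have "\<dots> = (\<lambda>p q. \<Sum>d\<in>E. M g d a * munit d b p q)"
  proof (intro ext)
    fix p q
    have "(\<Sum>d\<in>E. M g d a * munit d b p q) = (\<Sum>d\<in>E. if p = d then (if q = b then M g d a else 0) else 0)"
      by (intro sum.cong) (auto simp: munit_def)
    then show "(if q = b then M g p a else 0) = (\<Sum>d\<in>E. M g d a * munit d b p q)"
      using E matsD[OF Mg, of p a] by auto
  qed
  also have "\<dots> = lin (carrier L) (\<lambda>h. \<Sum>d\<in>E. M g d a * c d b h) M"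
    unfolding lin_lin using c assms(5) by (simp add: lin_def[of E])
  finally show ?thesis .
qed

lemma sum_units_one:
  fixes M :: "'a \<Rightarrow> 'e \<Rightarrow> 'e \<Rightarrow> 'k"
  assumes M: "mat_rep L E M" and c: "\<And>a b. a \<in> E \<Longrightarrow> b \<in> E \<Longrightarrow> lin (carrier L) (c a b) M = munit a b"
  shows "lin (carrier L) (\<lambda>h. \<Sum>a\<in>E. c a a h) M = lin (carrier L) (\<lambda>h. if h = \<one> then 1 else 0) M"
proof -
  have E: "finite E" using M by (auto simp: mat_rep_def)
  have "lin (carrier L) (\<lambda>h. \<Sum>a\<in>E. c a a h) M = (\<lambda>p q. \<Sum>a\<in>E. munit a a p q)"
    using lin_lin[of "carrier L" "\<lambda>_. 1" "\<lambda>a. c a a" E M] c by (simp add: lin_def[of E])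
  also have "\<dots> = idm E"
  proof (intro ext)
    fix p q
    have "(\<Sum>a\<in>E. munit a a p q) = (\<Sum>a\<in>E. if p = a then (if p = q then 1 else 0 :: 'k) else 0)"
      by (intro sum.cong) (auto simp: munit_def)
    then show "(\<Sum>a\<in>E. munit a a p q) = (idm E p q :: 'k)" using E by (simp add: idm_def)
  qed
  finally show ?thesis unfolding lin_one[OF is_group finL M] .
qed

text \<open>
  All simple constituents of the restriction to the \<open>i\<close>-th factor are isomorphic. By
  \<open>annihilator_single\<close> the elements that act as matrix units on \<open>M\<close> satisfy the same relations on the whole
  restriction, hence on \<open>M'\<close>, and \<open>hom_of_columns\<close> applies.
\<close>

lemma isotypic_single:
  assumes i: "i \<in> J"
    and M: "full_rep L E M" "U \<in> hom_mats L I (\<lambda>l. \<rho> (single i l)) E M" "U \<noteq> (\<lambda>p q. 0)"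
    and M': "full_rep L E' M'" "U' \<in> hom_mats L I (\<lambda>l. \<rho> (single i l)) E' M'" "U' \<noteq> (\<lambda>p q. 0)"
  shows "\<exists>V\<in>hom_mats L E' M' E M. V \<noteq> (\<lambda>p q. 0)"
proof -
  have rep: "mat_rep L E M" "mat_rep L E' M'" and E': "finite E'" "E' \<noteq> {}"
    using M(1) M'(1) by (auto simp: full_rep_def mat_rep_def)
  have M'_mats: "M' g \<in> mats E' E'" if "g \<in> carrier L" for g using rep(2) that by (simp add: mat_rep_def)
  obtain V where V: "mmul I V U' = idm E'"
    using full_hom_left_inverse[OF M'(1) I(1) M'(2,3)] by blast
  have lin_eq: "lin (carrier L) \<phi> M' = lin (carrier L) \<psi> M'" if "lin (carrier L) \<phi> M = lin (carrier L) \<psi> M" for \<phi> \<psi>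
  proof -
    have *: "lin (carrier L) \<phi> M' = mmul I V (mmul I (lin (carrier L) \<phi> (\<lambda>l. \<rho> (single i l))) U')" for \<phi>
    proof -
      have "lin (carrier L) \<phi> M' = mmul E' (mmul I V U') (lin (carrier L) \<phi> M')"
        unfolding V by (rule mmul_idm_left[OF E'(1) lin_mats[OF M'_mats], symmetric])
      then show ?thesis unfolding mmul_assoc hom_mats_lin[OF M'(2)] .
    qed
    show ?thesis unfolding * lin_eq_single[OF M(2,3) i that] ..
  qed
  have "\<forall>a\<in>E. \<forall>b\<in>E. \<exists>c. lin (carrier L) c M = munit a b"
    using M(1) unfolding full_rep_def by blast
  then obtain c where c: "\<And>a b. a \<in> E \<Longrightarrow> b \<in> E \<Longrightarrow> lin (carrier L) (c a b) M = munit a b" by metis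
  define X where "X a b = lin (carrier L) (c a b) M'" for a b
  have "lin (carrier L) (\<lambda>h. \<Sum>a\<in>E. c a a h) M' = idm E'"
    using lin_eq[OF sum_units_one[OF rep(1) c]] lin_one[OF is_group finL rep(2)] by simp
  then have sum: "(\<Sum>a\<in>E. X a a p q) = idm E' p q" for p q
    using lin_lin[of "carrier L" "\<lambda>_. 1" "\<lambda>a. c a a" E M']
    by (simp add: X_def lin_def[of E] fun_eq_iff)
  obtain e where "e \<in> E'" using E' by blast
  then have "(\<Sum>a\<in>E. X a a e e) \<noteq> 0" using sum by (simp add: idm_def)
  then obtain a where a: "a \<in> E" "X a a e e \<noteq> 0" by (meson sum.not_neutral_contains_not_neutral)
  show ?thesis
  proof (rule hom_of_columns[where X = X])
    show "X a b \<in> mats E' E'" for a b unfolding X_def by (intro lin_mats M'_mats)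
    show "M g \<in> mats E E" if "g \<in> carrier L" for g using rep(1) that by (simp add: mat_rep_def)
    show "a \<in> E" "X a a \<noteq> (\<lambda>p q. 0)" using a by (auto simp: fun_eq_iff)
    fix g a b assume g: "g \<in> carrier L" and ab: "a \<in> E" "b \<in> E"
    have "mmul E' (M' g) (X a b) = lin (carrier L) (\<lambda>h. c a b (inv g \<otimes> h)) M'"
      unfolding X_def mmul_lin_right lin_translate[OF g, symmetric]
      using rep(2) g by (intro lin_cong) (simp add: mat_rep_def)
    also have "\<dots> = lin (carrier L) (\<lambda>h. \<Sum>d\<in>E. M g d a * c d b h) M'"
      by (rule lin_eq[OF translate_unit[OF rep(1) c g ab]])
    finally show "mmul E' (M' g) (X a b) = lin E (\<lambda>d. M g d a) (\<lambda>d. X d b)"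
      unfolding X_def lin_lin .
  qed
qed

text \<open>
  The image of the pure tensor \<open>f\<^sub>1 \<otimes> f\<^sub>2 \<otimes> \<dots>\<close> of elements of the group algebra of \<open>L\<close>, read as an element of the group
  algebra of the direct power.
\<close>

definition product_element :: "('j \<Rightarrow> 'a \<Rightarrow> 'k) \<Rightarrow> 'i \<Rightarrow> 'i \<Rightarrow> 'k" where
  "product_element f = lin (carrier P) (\<lambda>x. \<Prod>i\<in>J. f i (x i)) \<rho>"

text \<open>
  Collecting the tuples with the same components outside \<open>i\<close> exhibits the image of \<open>f i\<close> as a right factor.
\<close>

lemma product_element_zero:
  assumes i: "i \<in> J" and f: "lin (carrier L) (f i) (\<lambda>l. \<rho> (single i l)) = (\<lambda>p q. 0)"
  shows "product_element f = (\<lambda>p q. 0)"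
proof -
  let ?Q = "{y \<in> carrier P. y i = \<one>}"
  let ?w = "\<lambda>y. \<Prod>j\<in>J - {i}. f j (y j)"
  have "product_element f p q = (\<Sum>(y, l)\<in>?Q \<times> carrier L. ?w y * f i l * \<rho> (y \<otimes>\<^bsub>P\<^esub> single i l) p q)" for p q
    unfolding product_element_def lin_def
  proof (rule sum.reindex_bij_witness[of _ "\<lambda>(y, l). y(i := l)" "\<lambda>x. (x(i := \<one>), x i)"], goal_cases)
    case (5 x)
    have "x(i := \<one>) \<otimes>\<^bsub>P\<^esub> single i (x i) = x"
      using 5 i by (auto simp: single_def fun_eq_iff PiE_iff extensional_def restrict_def)
    moreover have "(\<Prod>j\<in>J. f j (x j)) = f i (x i) * ?w (x(i := \<one>))"
      by (simp add: prod.remove[OF J i])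
    ultimately show ?case by (simp add: mult.commute)
  qed (use i in \<open>auto simp: PiE_iff extensional_def\<close>)
  also have "(\<Sum>(y, l)\<in>?Q \<times> carrier L. ?w y * f i l * \<rho> (y \<otimes>\<^bsub>P\<^esub> single i l) p q) =
      (\<Sum>y\<in>?Q. ?w y * mmul I (\<rho> y) (lin (carrier L) (f i) (\<lambda>l. \<rho> (single i l))) p q)" for p q
    unfolding sum.cartesian_product[symmetric] mmul_lin_right
    using rho_mult single_closed
    by (intro sum.cong refl) (simp add: lin_def sum_distrib_left mult.assoc del: carrier_product_group mult_product_group)
  finally show ?thesis unfolding f by (simp add: mmul_zero fun_eq_iff)
qed

text \<open>
  A pure tensor depends only on the images of its factors: exchange them one at a time; each exchange is
  a difference with one factor that acts as zero.
\<close>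

lemma product_element_cong:
  assumes "\<And>i. i \<in> J \<Longrightarrow> lin (carrier L) (f i) (\<lambda>l. \<rho> (single i l)) = lin (carrier L) (g i) (\<lambda>l. \<rho> (single i l))"
  shows "product_element f = product_element g"
proof -
  \<comment> \<open>The factors in \<open>S\<close> are already exchanged.\<close>
  have "product_element (\<lambda>j. if j \<in> S then g j else f j) = product_element f" if "finite S" "S \<subseteq> J" for S
    using that
  proof (induction S rule: finite_induct)
    case (insert i S)
    then have i: "i \<in> J" "i \<notin> S" by auto
    let ?F = "\<lambda>j. if j \<in> S then g j else f j"
    let ?F' = "\<lambda>j. if j \<in> insert i S then g j else f j"
    let ?D = "\<lambda>j. if j = i then (\<lambda>l. g i l - f i l) else ?F j"
    have "(\<Prod>j\<in>J. ?D j (x j)) = (\<Prod>j\<in>J. ?F' j (x j)) - (\<Prod>j\<in>J. ?F j (x j))" for x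
    proof -
      have "(\<Prod>j\<in>J - {i}. ?D j (x j)) = (\<Prod>j\<in>J - {i}. ?F j (x j))"
        "(\<Prod>j\<in>J - {i}. ?F' j (x j)) = (\<Prod>j\<in>J - {i}. ?F j (x j))"
        by (auto intro!: prod.cong)
      then show ?thesis using i by (simp add: prod.remove[OF J i(1)] left_diff_distrib)
    qed
    then have "product_element ?D = (\<lambda>p q. product_element ?F' p q - product_element ?F p q)"
      unfolding product_element_def lin_diff[symmetric] by simp
    moreover have "product_element ?D = (\<lambda>p q. 0)"
      using assms[OF i(1)] by (intro product_element_zero[OF i(1)]) (simp add: lin_diff fun_eq_iff)
    ultimately have "product_element ?F' = product_element ?F" by (simp add: fun_eq_iff)
    then show ?case using insert by simp
  qed simp
  from this[OF J subset_refl] show ?thesis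
    unfolding product_element_def by (simp cong: prod.cong)
qed

lemma product_element_sum:
  assumes "\<And>i. i \<in> J \<Longrightarrow> finite (E i)"
  shows "product_element (\<lambda>i h. \<Sum>d\<in>E i. m i d * c i d h) =
    lin (Pi\<^sub>E J E) (\<lambda>\<gamma>. \<Prod>i\<in>J. m i (\<gamma> i)) (\<lambda>\<gamma>. product_element (\<lambda>i. c i (\<gamma> i)))"
  unfolding product_element_def lin_lin[symmetric] prod.distrib[symmetric]
  using assms J by (simp add: prod_sum_PiE)

text \<open>
  The pure tensors \<open>X a b\<close> of elements acting as matrix units on the constituents \<open>M i\<close> act on \<open>\<rho>\<close> as the
  matrix units of the tensor product would, because the relations between the factors hold in \<open>\<rho>\<close>
  (\<open>lin_eq_single\<close>) and pure tensors respect them (\<open>product_element_cong\<close>). They are not all zero, since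
  their diagonal sum is the identity.
\<close>

lemma outer_tensor:
  assumes M: "\<And>i. i \<in> J \<Longrightarrow> full_rep L (E i) (M i)"
    and U: "\<And>i. i \<in> J \<Longrightarrow> U i \<in> hom_mats L I (\<lambda>l. \<rho> (single i l)) (E i) (M i)" "\<And>i. i \<in> J \<Longrightarrow> U i \<noteq> (\<lambda>p q. 0)"
  shows "\<exists>V\<in>hom_mats P I \<rho> (Pi\<^sub>E J E) (tensor_rep J E M). V \<noteq> (\<lambda>p q. 0)"
proof -
  have repM: "mat_rep L (E i) (M i)" if "i \<in> J" for i using M[OF that] by (simp add: full_rep_def)
  have finE: "finite (E i)" if "i \<in> J" for i using repM[OF that] by (simp add: mat_rep_def)
  have "\<forall>i\<in>J. \<forall>a\<in>E i. \<forall>b\<in>E i. \<exists>c. lin (carrier L) c (M i) = munit a b"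
    using M unfolding full_rep_def by blast
  then obtain c where c: "\<And>i a b. i \<in> J \<Longrightarrow> a \<in> E i \<Longrightarrow> b \<in> E i \<Longrightarrow> lin (carrier L) (c i a b) (M i) = munit a b"
    by metis
  define X where "X a b = product_element (\<lambda>i. c i (a i) (b i))" for a b
  note transfer = lin_eq_single[OF U(1) U(2)]
  interpret P: group P by (rule group_P)
  have "product_element (\<lambda>i h. \<Sum>a\<in>E i. 1 * c i a a h) = product_element (\<lambda>i h. if h = \<one> then 1 else 0)"
    using sum_units_one[OF repM c] by (intro product_element_cong transfer) auto
  also have "\<dots> = lin (carrier P) (\<lambda>x. if x = \<one>\<^bsub>P\<^esub> then 1 else 0) \<rho>"
    unfolding product_element_def lin_def
  proof (intro ext sum.cong refl arg_cong2[of _ _ _ _ "(*)"])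
    fix x assume "x \<in> carrier P"
    then show "(\<Prod>i\<in>J. if x i = \<one> then 1 else 0) = (if x = \<one>\<^bsub>P\<^esub> then 1 else 0 :: 'k)"
      using prod_delta_PiE[OF J, of x "\<lambda>_. carrier L" "\<one>\<^bsub>P\<^esub>"] by (simp cong: prod.cong)
  qed
  also have "\<dots> = idm I"
    using J finL by (intro lin_one[OF group_P _ rep]) (simp add: finite_PiE)
  finally have one: "(\<Sum>a\<in>Pi\<^sub>E J E. X a a p q) = idm I p q" for p q
    using product_element_sum[of E "\<lambda>i a. 1" "\<lambda>i a. c i a a", OF finE]
    by (simp add: X_def lin_def fun_eq_iff)
  obtain e where e: "e \<in> I" using I(2) by blast
  then have "(\<Sum>a\<in>Pi\<^sub>E J E. X a a e e) \<noteq> 0" using one by (simp add: idm_def)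
  then obtain a where a: "a \<in> Pi\<^sub>E J E" "X a a e e \<noteq> 0" by (meson sum.not_neutral_contains_not_neutral)
  show ?thesis
  proof (rule hom_of_columns[where X = X])
    show "X a b \<in> mats I I" for a b
      unfolding X_def product_element_def by (intro lin_mats rho_mats)
    show "tensor_rep J E M x \<in> mats (Pi\<^sub>E J E) (Pi\<^sub>E J E)" for x
      by (auto simp: tensor_rep_def mats_def)
    show "a \<in> Pi\<^sub>E J E" "X a a \<noteq> (\<lambda>p q. 0)" using a by (auto simp: fun_eq_iff)
    fix x a b assume x: "x \<in> carrier P" and ab: "a \<in> Pi\<^sub>E J E" "b \<in> Pi\<^sub>E J E"
    have xi: "x i \<in> carrier L" "a i \<in> E i" "b i \<in> E i" if "i \<in> J" for i using x ab that by (auto simp: PiE_iff)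
    let ?F = "\<lambda>y. \<Prod>i\<in>J. c i (a i) (b i) (y i)"
    have "mmul I (\<rho> x) (X a b) = lin (carrier P) ?F (\<lambda>y. \<rho> (x \<otimes>\<^bsub>P\<^esub> y))"
      unfolding X_def product_element_def mmul_lin_right
      by (intro lin_cong) (simp add: rho_mult[OF x] del: carrier_product_group mult_product_group)
    also have "\<dots> = lin (carrier P) (\<lambda>y. ?F (inv\<^bsub>P\<^esub> x \<otimes>\<^bsub>P\<^esub> y)) \<rho>"
      by (rule P.lin_translate[OF x])
    also have "\<dots> = product_element (\<lambda>i h. c i (a i) (b i) (inv (x i) \<otimes> h))"
      unfolding product_element_def using x by (simp add: inv_product_group is_group cong: prod.cong)
    also have "\<dots> = product_element (\<lambda>i h. \<Sum>d\<in>E i. M i (x i) d (a i) * c i d (b i) h)"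
      using translate_unit[OF repM c] xi by (intro product_element_cong transfer) auto
    also have "\<dots> = lin (Pi\<^sub>E J E) (\<lambda>\<gamma>. \<Prod>i\<in>J. M i (x i) (\<gamma> i) (a i)) (\<lambda>\<gamma>. X \<gamma> b)"
      unfolding X_def by (rule product_element_sum[OF finE])
    also have "\<dots> = lin (Pi\<^sub>E J E) (\<lambda>\<gamma>. tensor_rep J E M x \<gamma> a) (\<lambda>\<gamma>. X \<gamma> b)"
      using ab by (simp add: lin_def tensor_rep_def)
    finally show "mmul I (\<rho> x) (X a b) = lin (Pi\<^sub>E J E) (\<lambda>\<gamma>. tensor_rep J E M x \<gamma> a) (\<lambda>\<gamma>. X \<gamma> b)" .
  qed
qed

end

section \<open>Conjugation and stabilizers\<close>

text \<open>
  The matrices of \<^term>\<open>ad B b\<close>, as \<open>ad_matmod\<close> shows.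
\<close>

definition twist :: "('g, 'm) monoid_scheme \<Rightarrow> 'g \<Rightarrow> ('g \<Rightarrow> 'x) \<Rightarrow> 'g \<Rightarrow> 'x" where
  "twist B b M = (\<lambda>l. M (inv\<^bsub>B\<^esub> b \<otimes>\<^bsub>B\<^esub> l \<otimes>\<^bsub>B\<^esub> b))"

lemma ad_matmod: "ad B b (matmod d M) = matmod d (twist B b M)"
  by (simp add: ad_def matmod_def twist_def)

lemma hom_mats_cong:
  assumes "\<And>g. g \<in> carrier G \<Longrightarrow> R g = R' g" "\<And>g. g \<in> carrier G \<Longrightarrow> M g = M' g"
  shows "hom_mats G J R I M = hom_mats G J R' I M'"
  using assms by (simp add: hom_mats_def)

lemma mmul_nonzero:
  assumes "finite I" "mmul J V U = idm I" "W \<in> mats I K" "W \<noteq> (\<lambda>p q. 0)"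
  shows "mmul I U W \<noteq> (\<lambda>p q. 0)"
proof
  assume "mmul I U W = (\<lambda>p q. 0)"
  then have "mmul J V (mmul I U W) = (\<lambda>p q. 0)" by (simp add: mmul_zero)
  moreover have "mmul J V (mmul I U W) = W"
    unfolding mmul_assoc[symmetric] assms(2) by (rule mmul_idm_left[OF assms(1,3)])
  ultimately show False using assms(4) by simp
qed

lemma idm_nonzero: "I \<noteq> {} \<Longrightarrow> idm I \<noteq> (\<lambda>p q. 0 :: 'k :: field)"
  by (auto simp: idm_def fun_eq_iff)

lemma hom_mats_sym:
  assumes "full_rep G J R" "full_rep G I M" "U \<in> hom_mats G J R I M" "U \<noteq> (\<lambda>p q. 0)"
  shows "\<exists>V\<in>hom_mats G I M J R. V \<noteq> (\<lambda>p q. 0)"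
proof -
  obtain V where V: "V \<in> hom_mats G I M J R" "mmul J V U = idm I" using schur[OF assms] by blast
  have "idm I \<noteq> (\<lambda>p q. 0 :: 'd)" using assms(2) by (intro idm_nonzero) (simp add: full_rep_def)
  then have "V \<noteq> (\<lambda>p q. 0)" using V(2) mmul_zero(2)[of J U] by metis
  then show ?thesis using V(1) by blast
qed

lemma hom_mats_trans:
  assumes "full_rep G I M" "finite J" "U \<in> hom_mats G J R I M" "U \<noteq> (\<lambda>p q. 0)"
    "V \<in> hom_mats G I M K Q" "V \<noteq> (\<lambda>p q. 0)"
  shows "mmul I U V \<in> hom_mats G J R K Q" "mmul I U V \<noteq> (\<lambda>p q. 0)"
proof -
  show "mmul I U V \<in> hom_mats G J R K Q" by (rule hom_mats_compose[OF assms(3,5)])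
  obtain W where "mmul J W U = idm I" using full_hom_left_inverse[OF assms(1-4)] by blast
  then show "mmul I U V \<noteq> (\<lambda>p q. 0)"
    using assms by (intro mmul_nonzero[of I J W U V K]) (auto simp: full_rep_def mat_rep_def hom_mats_def)
qed

context normal
begin

abbreviation NH where "NH \<equiv> G\<lparr>carrier := H\<rparr>"

lemma group_NH: "group NH"
  by (rule subgroup_is_group) (rule is_group)

lemma conj_closed: "b \<in> carrier G \<Longrightarrow> l \<in> H \<Longrightarrow> inv b \<otimes> l \<otimes> b \<in> H"
  using inv_op_closed1 by simp

lemma twist_hom:
  "U \<in> hom_mats NH J R I M \<Longrightarrow> b \<in> carrier G \<Longrightarrow> U \<in> hom_mats NH J (twist G b R) I (twist G b M)"
  by (auto simp: hom_mats_def twist_def conj_closed)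

lemma twist_twist:
  assumes "b \<in> carrier G" "c \<in> carrier G" "l \<in> H"
  shows "twist G b (twist G c M) l = twist G (b \<otimes> c) M l"
  using assms mem_carrier[OF assms(3)] by (simp add: twist_def m_assoc inv_mult_group)

lemma twist_one: "l \<in> H \<Longrightarrow> twist G \<one> M l = M l"
  using mem_carrier[of l] by (simp add: twist_def)

lemma twist_rep:
  assumes M: "mat_rep NH I M" and b: "b \<in> carrier G"
  shows "mat_rep NH I (twist G b M)"
proof -
  have "inv b \<otimes> (l \<otimes> l') \<otimes> b = (inv b \<otimes> l \<otimes> b) \<otimes> (inv b \<otimes> l' \<otimes> b)" if "l \<in> H" "l' \<in> H" for l l'
  proof -
    have "b \<otimes> (inv b \<otimes> z) = z" if "z \<in> carrier G" for z using that b by (simp flip: m_assoc)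
    then show ?thesis using that b mem_carrier by (simp add: m_assoc)
  qed
  then show ?thesis using M b by (simp add: mat_rep_def twist_def conj_closed)
qed

lemma twist_full:
  assumes M: "full_rep NH I M" and b: "b \<in> carrier G"
  shows "full_rep NH I (twist G b M)"
proof -
  have "lin H (\<lambda>l. c (inv b \<otimes> l \<otimes> b)) (twist G b M) = lin H c M" for c
  proof (intro ext)
    fix p q
    show "lin H (\<lambda>l. c (inv b \<otimes> l \<otimes> b)) (twist G b M) p q = lin H c M p q"
      unfolding lin_def twist_def
    proof (rule sum.reindex_bij_witness[of _ "\<lambda>l. b \<otimes> l \<otimes> inv b" "\<lambda>l. inv b \<otimes> l \<otimes> b"])
      fix l assume l: "l \<in> H"
      then have lc: "l \<in> carrier G" by (rule mem_carrier)
      show "b \<otimes> (inv b \<otimes> l \<otimes> b) \<otimes> inv b = l" "inv b \<otimes> (b \<otimes> l \<otimes> inv b) \<otimes> b = l"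
        using b lc by (simp_all add: m_assoc inv_solve_left) (simp_all add: m_assoc[symmetric])
      show "inv b \<otimes> l \<otimes> b \<in> H" "b \<otimes> l \<otimes> inv b \<in> H"
        using b l by (auto intro: conj_closed inv_op_closed2)
    qed simp
  qed
  moreover have "\<forall>p\<in>I. \<forall>q\<in>I. \<exists>c. lin H c M = munit p q" using M by (simp add: full_rep_def)
  ultimately have "\<forall>p\<in>I. \<forall>q\<in>I. \<exists>c. lin H c (twist G b M) = munit p q" by metis
  moreover have "mat_rep NH I M" using M by (simp add: full_rep_def)
  then have "mat_rep NH I (twist G b M)" by (rule twist_rep[OF _ b])
  ultimately show ?thesis using M by (simp add: full_rep_def)
qed

lemma mem_stabilizer_of_hom:
  fixes M :: "'a \<Rightarrow> nat \<Rightarrow> nat \<Rightarrow> 'k :: field"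
  assumes M: "full_rep NH {..<d} M" and s: "s \<in> carrier G"
    and U: "U \<in> hom_mats NH {..<d} M {..<d} (twist G s M)" "U \<noteq> (\<lambda>p q. 0)"
  shows "s \<in> stabilizer G H (matmod d M)"
proof -
  obtain V where "mmul {..<d} V U = idm {..<d}" "mmul {..<d} U V = idm {..<d}"
    using schur[OF M twist_full[OF M s] U] by blast
  then have "kG_isomorphic NH (matmod d (twist G s M)) (matmod d M)"
    by (intro isomorphic_of_hom_mats[OF U(1)])
  then show ?thesis using s by (simp add: stabilizer_def ad_matmod)
qed

text \<open>
  The matrix \<^term>\<open>M h\<close> itself is an isomorphism from the conjugate by \<open>h\<close>.
\<close>

lemma subset_stabilizer:
  fixes M :: "'a \<Rightarrow> nat \<Rightarrow> nat \<Rightarrow> 'k :: field"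
  assumes M: "full_rep NH {..<d} M"
  shows "H \<subseteq> stabilizer G H (matmod d M)"
proof
  fix h assume h: "h \<in> H"
  have rep: "mat_rep NH {..<d} M" using M by (simp add: full_rep_def)
  have mult: "M (x \<otimes> y) = mmul {..<d} (M x) (M y)" if "x \<in> H" "y \<in> H" for x y
    using rep that by (simp add: mat_rep_def)
  have hc: "h \<in> carrier G" using h by (rule mem_carrier)
  have "mmul {..<d} (M l) (M h) = mmul {..<d} (M h) (twist G h M l)" if l: "l \<in> H" for l
  proof -
    have "l \<otimes> h = h \<otimes> (inv h \<otimes> l \<otimes> h)"
      using hc mem_carrier[OF l] by (simp add: m_assoc inv_solve_left) (simp add: m_assoc[symmetric])
    then show ?thesis using mult[OF l h] mult[OF h conj_closed[OF hc l]] by (simp add: twist_def)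
  qed
  moreover have "M h \<in> mats {..<d} {..<d}" using rep h by (simp add: mat_rep_def)
  ultimately have U: "M h \<in> hom_mats NH {..<d} M {..<d} (twist G h M)" by (simp add: hom_mats_def)
  have "mmul {..<d} (M h) (M (inv h)) = idm {..<d}"
    using mult[OF h, of "inv h"] rep h hc by (simp add: mat_rep_def)
  moreover have "idm {..<d} \<noteq> (\<lambda>p q. 0 :: 'k)" using M by (intro idm_nonzero) (simp add: full_rep_def)
  ultimately have "M h \<noteq> (\<lambda>p q. 0)" by (metis mmul_zero(2))
  then show "h \<in> stabilizer G H (matmod d M)" by (rule mem_stabilizer_of_hom[OF M hc U])
qed

text \<open>
  Transporting the extension along its isomorphism with the given module makes its matrices agree with
  the given ones on the normal subgroup on the nose.
\<close>

lemma extension_matrices: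
  fixes M :: "'a \<Rightarrow> nat \<Rightarrow> nat \<Rightarrow> 'k :: field"
  assumes M: "full_rep NH {..<d} M" and ext: "extends_to_stabilizer G H (matmod d M)"
  shows "\<exists>P. mat_rep (G\<lparr>carrier := stabilizer G H (matmod d M)\<rparr>) {..<d} P \<and> (\<forall>l\<in>H. P l = M l)"
proof -
  let ?S = "stabilizer G H (matmod d M)"
  obtain Y :: "('k, 'k vec, 'a) kG_record" and f where Y: "kG_module (G\<lparr>carrier := ?S\<rparr>) Y"
    and f: "f \<in> LinearCombinations.module_hom class_ring Y (matmod d M)" "bij_betw f (carrier Y) (carrier_vec d)"
    and eq: "\<And>l v. l \<in> H \<Longrightarrow> v \<in> carrier Y \<Longrightarrow> f (act Y l v) = act (matmod d M) l (f v)"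
    using ext unfolding extends_to_stabilizer_def kG_isomorphic_def by auto
  have co: "coords Y d f" using f by (simp add: coords_def LinearCombinations.module_hom_def)
  obtain P where P: "mat_rep (G\<lparr>carrier := ?S\<rparr>) {..<d} P" "equivariant (G\<lparr>carrier := ?S\<rparr>) Y d P f"
    using rep_of_coords[OF Y co] by blast
  have "P l = M l" if l: "l \<in> H" for l
  proof (rule mats_eqI)
    have lS: "l \<in> ?S" using subset_stabilizer[OF M] l by blast
    show "P l \<in> mats {..<d} {..<d}" "M l \<in> mats {..<d} {..<d}"
      using P(1) M l lS by (auto simp: mat_rep_def full_rep_def)
    fix p q assume pq: "p \<in> {..<d}" "q \<in> {..<d}"
    let ?v = "inv_into (carrier Y) f (unit_vec d q)"
    have v: "?v \<in> carrier Y" "f ?v = unit_vec d q" using coords_inv[OF co, of "unit_vec d q"] by auto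
    have "act (matmod d P) l (f ?v) = act (matmod d M) l (f ?v)"
      using eq[OF l v(1)] P(2) lS v(1) by (simp add: equivariant_def)
    then have "act (matmod d P) l (unit_vec d q) $ p = act (matmod d M) l (unit_vec d q) $ p"
      unfolding v(2) by (rule arg_cong)
    then show "P l p q = M l p q"
      using pq by (simp add: unit_vec_def if_distrib[of "\<lambda>x. _ * x"] cong: if_cong)
  qed
  then show ?thesis using P(1) by blast
qed

text \<open>
  Being isomorphic up to conjugation is an equivalence relation on the index set; \<open>r\<close> picks the least element
  of each class, and \<open>b i\<close> conjugates the representative to \<open>M i\<close>. Undoing the conjugation by \<open>b i\<close> turns a
  homomorphism between conjugated representatives into one between the representatives themselves, twisted by
  \<open>b\<^sub>i\<inverse> c b\<^sub>j\<close>; so they coincide, and this element stabilizes them.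
\<close>

lemma orbit_representatives:
  fixes M :: "nat \<Rightarrow> 'a \<Rightarrow> nat \<Rightarrow> nat \<Rightarrow> 'k :: field"
  assumes M: "\<And>i. i \<in> J \<Longrightarrow> full_rep NH {..<d i} (M i)"
  shows "\<exists>r b. (\<forall>i\<in>J. r i \<in> J \<and> b i \<in> carrier G \<and>
            (\<exists>U\<in>hom_mats NH {..<d i} (M i) {..<d (r i)} (twist G (b i) (M (r i))). U \<noteq> (\<lambda>p q. 0))) \<and>
          (\<forall>i\<in>J. \<forall>j\<in>J. \<forall>c\<in>carrier G.
            (\<exists>U\<in>hom_mats NH {..<d (r i)} (twist G (b i) (M (r i))) {..<d (r j)} (twist G c (twist G (b j) (M (r j)))).
               U \<noteq> (\<lambda>p q. 0)) \<longrightarrow>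
            r i = r j \<and> inv (b i) \<otimes> c \<otimes> b j \<in> stabilizer G H (matmod (d (r i)) (M (r i))))"
proof -
  define link where "link i b j \<longleftrightarrow> b \<in> carrier G \<and>
    (\<exists>U\<in>hom_mats NH {..<d i} (M i) {..<d j} (twist G b (M j)). U \<noteq> (\<lambda>p q. 0))" for i b j
  have untwist: "hom_mats NH {..<d i} (twist G b (twist G b' (M i))) {..<d j} (twist G c (twist G c' (M j))) =
      hom_mats NH {..<d i} (twist G (b \<otimes> b') (M i)) {..<d j} (twist G (c \<otimes> c') (M j))"
    if "b \<in> carrier G" "b' \<in> carrier G" "c \<in> carrier G" "c' \<in> carrier G" for i j b b' c c'
    using that by (intro hom_mats_cong) (simp_all add: twist_twist)
  have untwist_one: "hom_mats NH {..<d i} (twist G \<one> (M i)) K Q = hom_mats NH {..<d i} (M i) K Q"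
    "hom_mats NH K Q {..<d i} (twist G \<one> (M i)) = hom_mats NH K Q {..<d i} (M i)" for i K Q
    by (intro hom_mats_cong; simp add: twist_one)+
  have link_refl: "link i \<one> i" if "i \<in> J" for i
  proof -
    have "mat_rep NH {..<d i} (M i)" "{..<d i} \<noteq> {}" using M[OF that] by (auto simp: full_rep_def)
    then have "idm {..<d i} \<in> hom_mats NH {..<d i} (M i) {..<d i} (M i)"
      by (auto simp: hom_mats_def mat_rep_def idm_mats mmul_idm_left mmul_idm_right)
    then show ?thesis
      using idm_nonzero[OF \<open>{..<d i} \<noteq> {}\<close>] unfolding link_def untwist_one by auto
  qed
  have link_sym: "link j (inv b) i" if ij: "i \<in> J" "j \<in> J" and l: "link i b j" for i j b
  proof -
    have b: "b \<in> carrier G" using l by (simp add: link_def)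
    obtain V where V: "V \<in> hom_mats NH {..<d j} (twist G b (M j)) {..<d i} (M i)" "V \<noteq> (\<lambda>p q. 0)"
      using l hom_mats_sym[OF M[OF ij(1)] twist_full[OF M[OF ij(2)] b]] unfolding link_def by blast
    have "V \<in> hom_mats NH {..<d j} (twist G (inv b) (twist G b (M j))) {..<d i} (twist G (inv b) (twist G \<one> (M i)))"
      using twist_hom[OF V(1)[folded untwist_one(2)[of _ _ i]], of "inv b"] b by simp
    then have "V \<in> hom_mats NH {..<d j} (M j) {..<d i} (twist G (inv b) (M i))"
      using b by (simp add: untwist untwist_one)
    then show ?thesis using V(2) b by (auto simp: link_def)
  qed
  have link_trans: "link i (b \<otimes> c) k" if ijk: "i \<in> J" "j \<in> J" "k \<in> J" and l: "link i b j" "link j c k" for i j k b c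
  proof -
    have b: "b \<in> carrier G" "c \<in> carrier G" using l by (simp_all add: link_def)
    obtain U V where U: "U \<in> hom_mats NH {..<d i} (M i) {..<d j} (twist G b (M j))" "U \<noteq> (\<lambda>p q. 0)"
      and V: "V \<in> hom_mats NH {..<d j} (M j) {..<d k} (twist G c (M k))" "V \<noteq> (\<lambda>p q. 0)"
      using l unfolding link_def by blast
    have "V \<in> hom_mats NH {..<d j} (twist G b (M j)) {..<d k} (twist G b (twist G c (M k)))"
      by (rule twist_hom[OF V(1) b(1)])
    also have "\<dots> = hom_mats NH {..<d j} (twist G b (M j)) {..<d k} (twist G (b \<otimes> c) (M k))"
      using b by (intro hom_mats_cong) (simp_all add: twist_twist)
    finally show ?thesis
      using hom_mats_trans[OF twist_full[OF M[OF ijk(2)] b(1)] _ U _ V(2)] b unfolding link_def by blast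
  qed
  define r where "r i = (LEAST j. j \<in> J \<and> (\<exists>b. link i b j))" for i
  have r: "r i \<in> J" "\<exists>b. link i b (r i)" if "i \<in> J" for i
    using LeastI[of "\<lambda>j. j \<in> J \<and> (\<exists>b. link i b j)" i] that link_refl[OF that] unfolding r_def by blast+
  have r_eq: "r i = r j" if "i \<in> J" "j \<in> J" "link i b j" for i j b
  proof -
    have "(\<exists>b. link i b k) \<longleftrightarrow> (\<exists>b. link j b k)" if "k \<in> J" for k
      using link_trans[of i j k b] link_trans[of j i k "inv b"] link_sym[of i j b] that \<open>i \<in> J\<close> \<open>j \<in> J\<close> \<open>link i b j\<close>
      by blast
    then show ?thesis unfolding r_def by metis
  qed
  obtain b where b: "\<And>i. i \<in> J \<Longrightarrow> link i (b i) (r i)" using r(2) by metis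
  have bc: "b i \<in> carrier G" if "i \<in> J" for i using b[OF that] by (simp add: link_def)
  have "r i = r j \<and> inv (b i) \<otimes> c \<otimes> b j \<in> stabilizer G H (matmod (d (r i)) (M (r i)))"
    if ij: "i \<in> J" "j \<in> J" and c: "c \<in> carrier G"
      and U: "U \<in> hom_mats NH {..<d (r i)} (twist G (b i) (M (r i))) {..<d (r j)} (twist G c (twist G (b j) (M (r j))))"
      and nz: "U \<noteq> (\<lambda>p q. 0)"
    for i j c U
  proof -
    note [simp] = bc[OF ij(1)] bc[OF ij(2)]
    have "U \<in> hom_mats NH {..<d (r i)} (twist G (b i) (M (r i))) {..<d (r j)} (twist G (c \<otimes> b j) (M (r j)))"
      using U c hom_mats_cong[of NH "twist G (b i) (M (r i))" _ "twist G c (twist G (b j) (M (r j)))"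
          "twist G (c \<otimes> b j) (M (r j))"] by (simp add: twist_twist)
    from twist_hom[OF this, of "inv (b i)"]
    have U': "U \<in> hom_mats NH {..<d (r i)} (M (r i)) {..<d (r j)} (twist G (inv (b i) \<otimes> c \<otimes> b j) (M (r j)))"
      using c by (simp add: untwist untwist_one m_assoc)
    then have l: "link (r i) (inv (b i) \<otimes> c \<otimes> b j) (r j)" using c nz by (auto simp: link_def)
    have "r i = r (r i)" "r j = r (r j)" using r_eq[OF _ _ b] r(1) ij by blast+
    then have "r i = r j" using r_eq[OF _ _ l] r(1) ij by simp
    moreover have "inv (b i) \<otimes> c \<otimes> b j \<in> stabilizer G H (matmod (d (r i)) (M (r i)))"
      using U' nz c M[OF r(1)[OF ij(1)]] unfolding \<open>r i = r j\<close>[symmetric]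
      by (intro mem_stabilizer_of_hom) auto
    ultimately show ?thesis by blast
  qed
  then show ?thesis
    using r(1) b bc unfolding link_def by (intro exI[of _ r] exI[of _ b]) blast
qed

end

text \<open>
  This is the matrix, in the coordinates \<open>f\<close>, of the isomorphism that puts \<open>g\<close> into the stabilizer.
\<close>

lemma hom_mats_of_stabilizer:
  fixes X :: "('k :: field, 'v, 'g) kG_record"
  assumes N: "N \<lhd> G" and X: "kG_module (G\<lparr>carrier := N\<rparr>) X" and f: "coords X d f" and d: "d > 0"
    and R: "mat_rep (G\<lparr>carrier := N\<rparr>) {..<d} R" "equivariant (G\<lparr>carrier := N\<rparr>) X d R f"
    and g: "g \<in> stabilizer G N X"
  shows "\<exists>U\<in>hom_mats (G\<lparr>carrier := N\<rparr>) {..<d} R {..<d} (twist G g R). U \<noteq> (\<lambda>p q. 0)"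
proof -
  interpret N: normal N G by fact
  interpret kG_module "G\<lparr>carrier := N\<rparr>" X by fact
  have gG: "g \<in> carrier G" using g by (simp add: stabilizer_def)
  obtain \<phi> where \<phi>: "\<phi> \<in> LinearCombinations.module_hom class_ring X X" "bij_betw \<phi> (carrier X) (carrier X)"
    and eq: "\<And>y v. y \<in> N \<Longrightarrow> v \<in> carrier X \<Longrightarrow> \<phi> (act X (inv\<^bsub>G\<^esub> g \<otimes>\<^bsub>G\<^esub> y \<otimes>\<^bsub>G\<^esub> g) v) = act X y (\<phi> v)"
    using g by (auto simp: stabilizer_def kG_isomorphic_def ad_def LinearCombinations.module_hom_def)
  have \<phi>_cl: "\<phi> v \<in> carrier X" if "v \<in> carrier X" for v using \<phi>(2) that by (auto simp: bij_betw_def)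
  let ?h = "inv_into (carrier X) f"
  let ?\<psi> = "\<lambda>u. f (\<phi> (?h u))"
  note [simp] = coords_inv[OF f] coordsD(4)[OF f] \<phi>_cl
  note h_add = coords_inv_add[OF vectorspace_axioms f] and h_smult = coords_inv_smult[OF vectorspace_axioms f]
  have act_cl: "act X y v \<in> carrier X" if "y \<in> N" "v \<in> carrier X" for y v
    using act_closed that by simp
  have R_eq: "f (act X y v) = act (matmod d R) y (f v)" if "y \<in> N" "v \<in> carrier X" for y v
    using R(2) that by (simp add: equivariant_def)
  show ?thesis
  proof (rule hom_mats_of_embedding[where \<phi> = ?\<psi>])
    fix u w :: "'k vec" assume "u \<in> carrier_vec d" "w \<in> carrier_vec d"
    then show "?\<psi> (u + w) = ?\<psi> u + ?\<psi> w"
      using \<phi>(1) by (simp add: h_add LinearCombinations.module_hom_def coordsD(5)[OF f])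
  next
    fix c and u :: "'k vec" assume "u \<in> carrier_vec d"
    then show "?\<psi> (c \<cdot>\<^sub>v u) = c \<cdot>\<^sub>v ?\<psi> u"
      using \<phi>(1) by (simp add: h_smult LinearCombinations.module_hom_def coordsD(6)[OF f])
  next
    show "inj_on ?\<psi> (carrier_vec d)"
    proof (rule inj_onI)
      fix u w assume uw: "u \<in> carrier_vec d" "w \<in> carrier_vec d" "?\<psi> u = ?\<psi> w"
      have "\<phi> (?h u) = \<phi> (?h w)" using inj_onD[OF coordsD(2)[OF f] uw(3)] uw by simp
      from inj_onD[OF bij_betw_imp_inj_on[OF \<phi>(2)] this] have "?h u = ?h w" using uw(1,2) by simp
      then show "u = w" using coords_inv(2)[OF f uw(1)] coords_inv(2)[OF f uw(2)] by metis
    qed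
  next
    fix y and u :: "'k vec" assume y: "y \<in> carrier (G\<lparr>carrier := N\<rparr>)" and u: "u \<in> carrier_vec d"
    let ?y = "inv\<^bsub>G\<^esub> g \<otimes>\<^bsub>G\<^esub> y \<otimes>\<^bsub>G\<^esub> g"
    have y': "?y \<in> N" using N.conj_closed[OF gG] y by simp
    have "act (matmod d (twist G g R)) y u = f (act X ?y (?h u))"
      using R_eq[OF y', of "?h u"] u by (simp add: twist_def)
    then have "?\<psi> (act (matmod d (twist G g R)) y u) = f (\<phi> (act X ?y (?h u)))"
      using coords_inv_left[OF f act_cl[OF y', of "?h u"]] u by (metis coords_inv(1)[OF f u])
    also have "\<dots> = act (matmod d R) y (?\<psi> u)"
      using eq[of y "?h u"] R_eq[of y "\<phi> (?h u)"] y u by (simp del: matmod_simps(5))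
    finally show "?\<psi> (act (matmod d (twist G g R)) y u) = act (matmod d R) y (?\<psi> u)" .
  qed (use d R(1) N.conj_closed[OF gG] in \<open>auto simp: mat_rep_def twist_def\<close>)
qed

section \<open>The wreath product\<close>

lemma wreath_mult:
  assumes "\<sigma> permutes {1..n}" "y \<in> carrier (power_group B n)"
  shows "(x, \<sigma>) \<otimes>\<^bsub>wreath_sym B n\<^esub> (y, \<tau>) = (\<lambda>i\<in>{1..n}. x i \<otimes>\<^bsub>B\<^esub> y (inv' \<sigma> i), \<sigma> \<circ> \<tau>)"
  using assms by (auto simp: wreath_sym_def semidirect_def permute_factors_def inv_sym sym_group_mult fun_eq_iff
      simp del: carrier_product_group)

lemma wreath_carrier: "carrier (wreath_sym B n) = carrier (power_group B n) \<times> {\<sigma>. \<sigma> permutes {1..n}}"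
  by (auto simp: wreath_sym_def semidirect_def sym_group_carrier)

lemma wreath_one: "\<one>\<^bsub>wreath_sym B n\<^esub> = (\<one>\<^bsub>power_group B n\<^esub>, id)"
  by (simp add: wreath_sym_def semidirect_def sym_group_one)

lemma wreath_conj:
  assumes B: "group B" and x: "x \<in> carrier (power_group B n)" and \<sigma>: "\<sigma> permutes {1..n}"
    and i: "i \<in> {1..n}" and l: "l \<in> carrier B"
  shows "inv\<^bsub>wreath_sym B n\<^esub> (x, \<sigma>) \<otimes>\<^bsub>wreath_sym B n\<^esub> (\<lambda>j\<in>{1..n}. if j = i then l else \<one>\<^bsub>B\<^esub>, id)
           \<otimes>\<^bsub>wreath_sym B n\<^esub> (x, \<sigma>) =
         (\<lambda>j\<in>{1..n}. if j = inv' \<sigma> i then inv\<^bsub>B\<^esub> (x i) \<otimes>\<^bsub>B\<^esub> l \<otimes>\<^bsub>B\<^esub> x i else \<one>\<^bsub>B\<^esub>, id)"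
    (is "inv\<^bsub>?G\<^esub> ?g \<otimes>\<^bsub>?G\<^esub> ?a \<otimes>\<^bsub>?G\<^esub> ?g = ?c")
proof -
  interpret B: group B by fact
  interpret G: group ?G by (rule wreath_sym_is_group[OF B])
  have xc: "x j \<in> carrier B" if "j \<in> {1..n}" for j using x that by (auto simp: PiE_iff)
  have eq: "inv' \<sigma> j = inv' \<sigma> i \<longleftrightarrow> j = i" for j
    using permutes_inj[OF permutes_inv[OF \<sigma>]] by (auto dest: injD)
  have mem: "?g \<in> carrier ?G" "?a \<in> carrier ?G" "?c \<in> carrier ?G"
    using x \<sigma> l xc[OF i] by (auto simp: wreath_carrier permutes_id)
  have c: "(\<lambda>j\<in>{1..n}. if j = inv' \<sigma> i then inv\<^bsub>B\<^esub> (x i) \<otimes>\<^bsub>B\<^esub> l \<otimes>\<^bsub>B\<^esub> x i else \<one>\<^bsub>B\<^esub>) \<in> carrier (power_group B n)"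
    using l xc[OF i] by auto
  have "?g \<otimes>\<^bsub>?G\<^esub> ?c = ?a \<otimes>\<^bsub>?G\<^esub> ?g"
    unfolding wreath_mult[OF \<sigma> c] wreath_mult[OF permutes_id x]
    using xc l inv_sym_mem[OF \<sigma>] i
    by (auto simp: fun_eq_iff eq B.m_assoc[symmetric] permutes_id restrict_def)
  then have "inv\<^bsub>?G\<^esub> ?g \<otimes>\<^bsub>?G\<^esub> (?a \<otimes>\<^bsub>?G\<^esub> ?g) = ?c"
    using G.inv_solve_left[OF mem(3,1), of "?a \<otimes>\<^bsub>?G\<^esub> ?g"] mem by simp
  then show ?thesis using mem by (simp add: G.m_assoc)
qed


text \<open>
  The matrix entries of \<open>Q g\<close> multiply the extended representations \<open>P (r i)\<close> along the permutation, evaluated at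
  the components of \<open>g\<close> conjugated to the representatives. Membership of \<open>g\<close> in the stabilizer puts these arguments
  into the domain of \<open>P (r i)\<close> and makes the dimensions match.
\<close>

lemma extends_to_stabilizer_wreath:
  fixes B :: "'b monoid" and X :: "('k :: alg_closed_field, 'v, (nat \<Rightarrow> 'b) \<times> (nat \<Rightarrow> nat)) kG_record"
  assumes L: "L \<lhd> B" "finite L" and N: "N = (\<Pi>\<^sub>E i\<in>{1..n}. L) \<times> {id}" "N \<lhd> wreath_sym B n"
    and extends: "\<And>X\<^sub>0 :: ('k, 'k vec, 'b) kG_record. kG_simple (B\<lparr>carrier := L\<rparr>) X\<^sub>0 \<Longrightarrow> extends_to_stabilizer B L X\<^sub>0"
    and X: "kG_simple ((wreath_sym B n)\<lparr>carrier := N\<rparr>) X"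
  shows "extends_to_stabilizer (wreath_sym B n) N X"
proof -
  let ?G = "wreath_sym B n" and ?J = "{1..n}" and ?L = "B\<lparr>carrier := L\<rparr>"
  let ?N = "?G\<lparr>carrier := N\<rparr>" and ?P = "product_group {1..n} (\<lambda>_. B\<lparr>carrier := L\<rparr>)"
  let ?S = "stabilizer ?G N X"
  interpret B: normal L B by fact
  interpret N: normal N ?G by fact
  have LB: "l \<in> carrier B" if "l \<in> L" for l using that by (rule B.mem_carrier)
  have PB: "x \<in> carrier (power_group B n)" if "x \<in> carrier ?P" for x using that LB by (auto simp: PiE_iff)
  have finN: "finite (carrier ?N)" using L(2) N(1) by (simp add: finite_PiE)
  have N_iff: "(x, \<sigma>) \<in> N \<longleftrightarrow> x \<in> carrier ?P \<and> \<sigma> = id" for x \<sigma> by (auto simp: N(1))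
  interpret X: kG_module ?N X using X by (simp add: kG_simple_def)
  have vs: "vectorspace class_ring X" by unfold_locales
  obtain D f where f: "coords X D f"
    using coords_exist[OF vs X.finite_dimensional] by blast
  obtain \<rho> where \<rho>: "mat_rep ?N {..<D} \<rho>" "equivariant ?N X D \<rho> f"
    using rep_of_coords[OF X.kG_module_axioms f] by blast
  have \<rho>_full: "full_rep ?N {..<D} \<rho>"
    by (rule simple_imp_full[OF X N.group_NH finN f \<rho>])
  then have D: "D > 0" by (auto simp: full_rep_def)
  define \<rho>' where "\<rho>' x = \<rho> (x, id)" for x
  have "full_rep ?P {..<D} \<rho>'"
  proof -
    have lin: "lin N (\<lambda>y. c (fst y)) \<rho> = lin (carrier ?P) c \<rho>'" for c
    proof (intro ext)
      fix p q
      show "lin N (\<lambda>y. c (fst y)) \<rho> p q = lin (carrier ?P) c \<rho>' p q"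
        unfolding lin_def \<rho>'_def N(1)
        by (rule sum.reindex_bij_witness[where i = "\<lambda>x :: nat \<Rightarrow> 'b. (x, id :: nat \<Rightarrow> nat)" and j = fst]) auto
    qed
    have "\<exists>c. lin (carrier ?P) c \<rho>' = munit a b" if "a < D" "b < D" for a b
    proof -
      have "\<forall>a\<in>{..<D}. \<forall>b\<in>{..<D}. \<exists>c. lin N c \<rho> = munit a b"
        using \<rho>_full by (simp add: full_rep_def)
      moreover have "a \<in> {..<D}" "b \<in> {..<D}" using that by simp_all
      ultimately obtain c where c: "lin N c \<rho> = munit a b" by blast
      have "lin N c \<rho> = lin N (\<lambda>y. c (fst y, id)) \<rho>" 
        unfolding lin_def N(1) by (intro ext sum.cong) auto
      then show ?thesis using c lin[of "\<lambda>x. c (x, id)"] by metis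
    qed
    moreover have "\<rho>' (x \<otimes>\<^bsub>?P\<^esub> y) = mmul {..<D} (\<rho>' x) (\<rho>' y)" if "x \<in> carrier ?P" "y \<in> carrier ?P" for x y
    proof -
      have "(x, id) \<otimes>\<^bsub>?G\<^esub> (y, id) = (x \<otimes>\<^bsub>?P\<^esub> y, id)"
        using wreath_mult[OF permutes_id PB[OF that(2)], of x id] by (auto simp: fun_eq_iff)
      moreover have "(x, id) \<in> N" "(y, id) \<in> N" using that by (simp_all only: N_iff)
      then have "\<rho> ((x, id) \<otimes>\<^bsub>?G\<^esub> (y, id)) = mmul {..<D} (\<rho> (x, id)) (\<rho> (y, id))"
        using \<rho>(1) by (simp add: mat_rep_def)
      ultimately show ?thesis unfolding \<rho>'_def by simp
    qed
    moreover have "\<rho>' \<one>\<^bsub>?P\<^esub> = idm {..<D}" using \<rho>(1) by (simp add: mat_rep_def \<rho>'_def wreath_one)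
    moreover have "\<rho>' x \<in> mats {..<D} {..<D}" if "x \<in> carrier ?P" for x
      using \<rho>(1) that by (auto simp: mat_rep_def \<rho>'_def N_iff simp del: carrier_product_group)
    ultimately show ?thesis using D unfolding full_rep_def mat_rep_def by auto
  qed
  then interpret PR: power_rep ?L ?J "{..<D}" \<rho>'
    using B.group_NH L(2) by (intro power_rep.intro power_rep_axioms.intro) auto
  \<comment> \<open>Each factor gets a simple constituent, which is then replaced by the conjugate \<open>M' i\<close> of its orbit representative.\<close>
  have "\<forall>i. \<exists>d M U. full_rep ?L {..<d} M \<and> kG_simple ?L (matmod d M) \<and>
      U \<in> hom_mats ?L {..<D} (\<lambda>l. \<rho>' (PR.single i l)) {..<d} M \<and> U \<noteq> (\<lambda>p q. 0)"
    using full_subrep_exists[OF B.group_NH _ PR.single_rep D] L(2) by simp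
  then obtain d M U where M: "\<And>i. full_rep ?L {..<d i} (M i)" "\<And>i. kG_simple ?L (matmod (d i) (M i))"
    and U: "\<And>i. U i \<in> hom_mats ?L {..<D} (\<lambda>l. \<rho>' (PR.single i l)) {..<d i} (M i)" "\<And>i. U i \<noteq> (\<lambda>p q. 0)"
    by metis
  obtain r b where rb: "\<forall>i\<in>?J. r i \<in> ?J \<and> b i \<in> carrier B \<and>
      (\<exists>U\<in>hom_mats ?L {..<d i} (M i) {..<d (r i)} (twist B (b i) (M (r i))). U \<noteq> (\<lambda>p q. 0))"
    and orbit: "\<forall>i\<in>?J. \<forall>j\<in>?J. \<forall>c\<in>carrier B.
      (\<exists>U\<in>hom_mats ?L {..<d (r i)} (twist B (b i) (M (r i))) {..<d (r j)} (twist B c (twist B (b j) (M (r j)))).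
         U \<noteq> (\<lambda>p q. 0)) \<longrightarrow>
      r i = r j \<and> inv\<^bsub>B\<^esub> (b i) \<otimes>\<^bsub>B\<^esub> c \<otimes>\<^bsub>B\<^esub> b j \<in> stabilizer B L (matmod (d (r i)) (M (r i)))"
    using B.orbit_representatives[of ?J d M] M(1) by blast
  have b: "b i \<in> carrier B" if "i \<in> ?J" for i using rb that by blast
  define E where "E i = {..<d (r i)}" for i
  define M' where "M' i = twist B (b i) (M (r i))" for i
  have M'_full: "full_rep ?L (E i) (M' i)" if "i \<in> ?J" for i
    unfolding E_def M'_def by (rule B.twist_full[OF M(1) b[OF that]])
  have "\<exists>V. V \<in> hom_mats ?L {..<D} (\<lambda>l. \<rho>' (PR.single i l)) (E i) (M' i) \<and> V \<noteq> (\<lambda>p q. 0)" if i: "i \<in> ?J" for i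
  proof -
    obtain W where W: "W \<in> hom_mats ?L {..<d i} (M i) (E i) (M' i)" "W \<noteq> (\<lambda>p q. 0)"
      using rb i unfolding E_def M'_def by blast
    show ?thesis using hom_mats_trans[OF M(1) _ U W] by blast
  qed
  then obtain U' where U': "\<And>i. i \<in> ?J \<Longrightarrow> U' i \<in> hom_mats ?L {..<D} (\<lambda>l. \<rho>' (PR.single i l)) (E i) (M' i)"
    "\<And>i. i \<in> ?J \<Longrightarrow> U' i \<noteq> (\<lambda>p q. 0)"
    by metis
  have "\<forall>i. \<exists>P. mat_rep (B\<lparr>carrier := stabilizer B L (matmod (d i) (M i))\<rparr>) {..<d i} P \<and> (\<forall>l\<in>L. P l = M i l)"
    using B.extension_matrices[OF M(1) extends[OF M(2)]] by blast
  then obtain P where P: "\<And>i. mat_rep (B\<lparr>carrier := stabilizer B L (matmod (d i) (M i))\<rparr>) {..<d i} (P i)"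
    "\<And>i l. l \<in> L \<Longrightarrow> P i l = M i l"
    by metis
  \<comment> \<open>\<open>V\<close> and \<open>V'\<close> identify \<open>X\<close> with the outer tensor product of the \<open>M' i\<close>.\<close>
  let ?I = "Pi\<^sub>E ?J E"
  let ?T = "tensor_rep ?J E M'"
  have T_full: "full_rep ?P ?I ?T"
    using L(2) by (intro tensor_rep_full M'_full) auto
  obtain V where V: "V \<in> hom_mats ?P {..<D} \<rho>' ?I ?T" "V \<noteq> (\<lambda>p q. 0)"
    using PR.outer_tensor[OF M'_full U'] by blast
  obtain V' where V': "V' \<in> hom_mats ?P ?I ?T {..<D} \<rho>'" "mmul {..<D} V' V = idm ?I" "mmul ?I V V' = idm {..<D}"
    using schur[OF PR.full T_full V] by blast
  \<comment> \<open>The element of \<open>B\<close> through which \<open>g\<close> acts in the \<open>i\<close>-th place, as seen from the representatives.\<close>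
  define s where "s g i = inv\<^bsub>B\<^esub> (b i) \<otimes>\<^bsub>B\<^esub> fst g i \<otimes>\<^bsub>B\<^esub> b (inv' (snd g) i)" for g :: "(nat \<Rightarrow> 'b) \<times> (nat \<Rightarrow> nat)" and i
  have stab: "snd g permutes ?J" "fst g \<in> carrier (power_group B n)" if "g \<in> ?S" for g
    using that by (auto simp: stabilizer_def wreath_carrier simp del: carrier_product_group)
  have key: "r (inv' (snd g) i) = r i \<and> s g i \<in> stabilizer B L (matmod (d (r i)) (M (r i)))"
    if g: "g \<in> ?S" and i: "i \<in> ?J" for g i
  proof -
    obtain x \<sigma> where g_eq: "g = (x, \<sigma>)" by (cases g)
    have \<sigma>: "\<sigma> permutes ?J" and x: "x \<in> carrier (power_group B n)" using stab[OF g] g_eq by auto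
    let ?j = "inv' \<sigma> i"
    have j: "?j \<in> ?J" by (rule inv_sym_mem[OF \<sigma> i])
    have xi: "x i \<in> carrier B" using x i by (auto simp: PiE_iff)
    have gG: "g \<in> carrier ?G" using g by (simp add: stabilizer_def)
    obtain \<Phi> where \<Phi>: "\<Phi> \<in> hom_mats ?N {..<D} \<rho> {..<D} (twist ?G g \<rho>)" "\<Phi> \<noteq> (\<lambda>p q. 0)"
      using hom_mats_of_stabilizer[OF N(2) X.kG_module_axioms f D \<rho> g] by blast
    obtain \<Psi> where \<Psi>: "mmul {..<D} \<Psi> \<Phi> = idm {..<D}"
      using full_hom_left_inverse[OF N.twist_full[OF \<rho>_full gG] _ \<Phi>] by auto
    \<comment> \<open>The isomorphism \<open>\<Phi>\<close> moves the constituent for the factor \<open>j\<close> to one for the factor \<open>i\<close>, conjugated by \<open>x i\<close>.\<close>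
    let ?W = "mmul {..<D} \<Phi> (U' ?j)"
    have "U' ?j \<in> mats {..<D} (E ?j)" using U'(1)[OF j] by (simp add: hom_mats_def)
    then have W_nz: "?W \<noteq> (\<lambda>p q. 0)"
      by (intro mmul_nonzero[OF _ \<Psi>] U'(2) j) auto
    have W: "?W \<in> hom_mats ?L {..<D} (\<lambda>l. \<rho>' (PR.single i l)) (E ?j) (twist B (x i) (M' ?j))"
    proof -
      have "mmul {..<D} (\<rho>' (PR.single i l)) ?W = mmul (E ?j) ?W (twist B (x i) (M' ?j) l)" if l: "l \<in> L" for l
      proof -
        let ?l = "inv\<^bsub>B\<^esub> (x i) \<otimes>\<^bsub>B\<^esub> l \<otimes>\<^bsub>B\<^esub> x i"
        have l': "?l \<in> L" by (rule B.conj_closed[OF xi l])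
        have mem: "(PR.single i l, id) \<in> N" using PR.single_closed[of l i] l by (simp add: N_iff del: carrier_product_group)
        have conj: "inv\<^bsub>?G\<^esub> g \<otimes>\<^bsub>?G\<^esub> (PR.single i l, id) \<otimes>\<^bsub>?G\<^esub> g = (PR.single ?j ?l, id)"
          using wreath_conj[OF B.is_group x \<sigma> i LB[OF l]] by (simp add: g_eq PR.single_def del: One_nat_def cong: if_cong)
        have "mmul {..<D} (\<rho>' (PR.single i l)) ?W = mmul {..<D} (mmul {..<D} (\<rho> (PR.single i l, id)) \<Phi>) (U' ?j)"
          by (simp add: mmul_assoc \<rho>'_def)
        also have "mmul {..<D} (\<rho> (PR.single i l, id)) \<Phi> = mmul {..<D} \<Phi> (twist ?G g \<rho> (PR.single i l, id))"
          using \<Phi>(1) mem by (simp add: hom_mats_def)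
        also have "twist ?G g \<rho> (PR.single i l, id) = \<rho>' (PR.single ?j ?l)"
          unfolding twist_def conj \<rho>'_def ..
        also have "mmul {..<D} (mmul {..<D} \<Phi> (\<rho>' (PR.single ?j ?l))) (U' ?j) = mmul {..<D} \<Phi> (mmul (E ?j) (U' ?j) (M' ?j ?l))"
          using U'(1)[OF j] l' by (simp add: mmul_assoc hom_mats_def)
        finally show ?thesis by (simp add: mmul_assoc twist_def)
      qed
      moreover have "?W \<in> mats {..<D} (E ?j)"
        using \<Phi>(1) U'(1)[OF j] by (auto simp: hom_mats_def intro: mmul_mats)
      ultimately show ?thesis by (simp add: hom_mats_def)
    qed
    have full_j: "full_rep ?L (E ?j) (twist B (x i) (M' ?j))" by (rule B.twist_full[OF M'_full[OF j] xi])
    have "\<exists>V\<in>hom_mats ?L (E i) (M' i) (E ?j) (twist B (x i) (M' ?j)). V \<noteq> (\<lambda>p q. 0)"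
      by (rule PR.isotypic_single[OF i full_j W W_nz M'_full[OF i] U'(1)[OF i] U'(2)[OF i]])
    from orbit[rule_format, OF i j xi this[unfolded E_def M'_def]] show ?thesis
      by (metis s_def g_eq fst_conv snd_conv)
  qed
  \<comment> \<open>The \<open>i\<close>-th place of the result depends on the place \<open>\<sigma>\<inverse> i\<close> of the argument.\<close>
  define Q where "Q g = (\<lambda>p q. if p \<in> ?I \<and> q \<in> ?I then \<Prod>i\<in>?J. P (r i) (s g i) (p i) (q (inv' (snd g) i)) else 0)" for g
  have Q_mats: "Q g \<in> mats ?I ?I" for g by (auto simp: Q_def mats_def)
  have finE: "finite (E i)" for i by (simp add: E_def)
  have Q_N: "Q (x, id) = ?T x" if x: "x \<in> carrier ?P" for x
  proof -
    have "P (r i) (s (x, id) i) = M' i (x i)" if i: "i \<in> ?J" for i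
      using P(2)[of "s (x, id) i" "r i"] x i B.conj_closed[OF b[OF i], of "x i"]
      by (auto simp: s_def M'_def twist_def PiE_iff)
    then have "(\<Prod>i\<in>?J. P (r i) (s (x, id) i) (p i) (q (inv' (snd (x, id)) i))) = (\<Prod>i\<in>?J. M' i (x i) (p i) (q i))" for p q
      by (intro prod.cong refl) (simp del: One_nat_def)
    then show ?thesis unfolding Q_def tensor_rep_def by (simp only:)
  qed
  have Q_mult: "Q (g \<otimes>\<^bsub>?G\<^esub> h) = mmul ?I (Q g) (Q h)" if g: "g \<in> ?S" and h: "h \<in> ?S" for g h
  proof -
    obtain x \<sigma> y \<tau> where gh: "g = (x, \<sigma>)" "h = (y, \<tau>)" by (cases g, cases h)
    have \<sigma>: "\<sigma> permutes ?J" and \<tau>: "\<tau> permutes ?J" and x: "x \<in> carrier (power_group B n)"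
      and y: "y \<in> carrier (power_group B n)"
      using stab[OF g] stab[OF h] gh by auto
    have \<sigma>'J: "inv' \<sigma> i \<in> ?J" if "i \<in> ?J" for i by (rule inv_sym_mem[OF \<sigma> that])
    have \<tau>'J: "inv' \<tau> i \<in> ?J" if "i \<in> ?J" for i by (rule inv_sym_mem[OF \<tau> that])
    have inv_comp: "inv' (\<sigma> \<circ> \<tau>) i = inv' \<tau> (inv' \<sigma> i)" for i
      using o_inv_distrib[OF permutes_bij[OF \<sigma>] permutes_bij[OF \<tau>]] by simp
    have s_mult: "s (g \<otimes>\<^bsub>?G\<^esub> h) i = s g i \<otimes>\<^bsub>B\<^esub> s h (inv' \<sigma> i)" if i: "i \<in> ?J" for i
    proof -
      have c: "x i \<in> carrier B" "y (inv' \<sigma> i) \<in> carrier B" using x y i \<sigma>'J by (auto simp: PiE_iff)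
      note bb = b[OF i] b[OF \<sigma>'J[OF i]] b[OF \<tau>'J[OF \<sigma>'J[OF i]]]
      have cancel: "b (inv' \<sigma> i) \<otimes>\<^bsub>B\<^esub> (inv\<^bsub>B\<^esub> (b (inv' \<sigma> i)) \<otimes>\<^bsub>B\<^esub> z) = z" if "z \<in> carrier B" for z
        using bb that by (simp flip: B.m_assoc)
      show ?thesis
        using c bb i unfolding gh wreath_mult[OF \<sigma> y]
        by (simp add: s_def inv_comp B.m_assoc cancel)
    qed
    \<comment> \<open>The \<open>i\<close>-th factors of the entries of \<open>Q g\<close> and \<open>Q h\<close> when the index in place \<open>\<sigma>\<inverse> i\<close> of the middle tuple is \<open>c\<close>.\<close>
    define A where "A p i c = P (r i) (s g i) (p i) c" for p :: "nat \<Rightarrow> nat" and i c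
    define C where "C q i c = P (r i) (s h (inv' \<sigma> i)) c (q (inv' \<tau> (inv' \<sigma> i)))" for q :: "nat \<Rightarrow> nat" and i c
    have P_mult: "P (r i) (s (g \<otimes>\<^bsub>?G\<^esub> h) i) (p i) (q (inv' (snd (g \<otimes>\<^bsub>?G\<^esub> h)) i)) = (\<Sum>c\<in>E i. A p i c * C q i c)"
      if i: "i \<in> ?J" for p q i
    proof -
      have "s g i \<in> stabilizer B L (matmod (d (r i)) (M (r i)))" using key[OF g i] by blast
      moreover have "s h (inv' \<sigma> i) \<in> stabilizer B L (matmod (d (r i)) (M (r i)))"
        using key[OF g i] key[OF h \<sigma>'J[OF i]] by (simp add: gh)
      ultimately have "P (r i) (s g i \<otimes>\<^bsub>B\<^esub> s h (inv' \<sigma> i)) = mmul (E i) (P (r i) (s g i)) (P (r i) (s h (inv' \<sigma> i)))"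
        using P(1)[of "r i"] by (simp add: mat_rep_def E_def)
      moreover have "snd (g \<otimes>\<^bsub>?G\<^esub> h) = \<sigma> \<circ> \<tau>" by (simp add: gh wreath_mult[OF \<sigma> y])
      ultimately show ?thesis by (simp add: s_mult[OF i] mmul_def A_def C_def inv_comp)
    qed
    show ?thesis
    proof (rule mats_eqI[OF Q_mats mmul_mats[OF Q_mats Q_mats]])
      fix p q assume pq: "p \<in> ?I" "q \<in> ?I"
      have E_\<sigma>': "E (inv' \<sigma> i) = E i" if "i \<in> ?J" for i using key[OF g that] by (simp add: E_def gh)
      have \<sigma>J: "\<sigma> i \<in> ?J" if "i \<in> ?J" for i using \<sigma> that permutes_in_image by metis
      have \<sigma>_inv: "\<sigma> (inv' \<sigma> i) = i" "inv' \<sigma> (\<sigma> i) = i" for i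
        using permutes_inverses[OF \<sigma>] by auto
      have E_\<sigma>: "E (\<sigma> i) = E i" if "i \<in> ?J" for i using E_\<sigma>'[OF \<sigma>J[OF that]] \<sigma>_inv by simp
      have "Q (g \<otimes>\<^bsub>?G\<^esub> h) p q = (\<Prod>i\<in>?J. \<Sum>c\<in>E i. A p i c * C q i c)"
        using pq by (simp add: Q_def P_mult del: snd_conv)
      also have "\<dots> = (\<Sum>t\<in>?I. \<Prod>i\<in>?J. A p i (t i) * C q i (t i))"
        by (intro prod_sum_PiE) (auto simp: finE)
      \<comment> \<open>Permuting the components of a tuple keeps it in the index set, since \<open>\<sigma>\<close> preserves \<open>r\<close> and hence the dimensions.\<close>
      also have "\<dots> = (\<Sum>t\<in>?I. \<Prod>i\<in>?J. A p i (t (inv' \<sigma> i)) * C q i (t (inv' \<sigma> i)))"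
      proof (rule sum.reindex_bij_witness[of _ "\<lambda>t. \<lambda>i\<in>?J. t (inv' \<sigma> i)" "\<lambda>t. \<lambda>i\<in>?J. t (\<sigma> i)"])
        fix t assume t: "t \<in> ?I"
        show "(\<lambda>i\<in>?J. (\<lambda>i\<in>?J. t (\<sigma> i)) (inv' \<sigma> i)) = t" "(\<lambda>i\<in>?J. (\<lambda>i\<in>?J. t (inv' \<sigma> i)) (\<sigma> i)) = t"
          using t \<sigma>J \<sigma>'J by (auto simp: fun_eq_iff \<sigma>_inv PiE_iff extensional_def restrict_def)
        have "t (\<sigma> i) \<in> E i" if "i \<in> ?J" for i
          using PiE_mem[OF t \<sigma>J[OF that]] unfolding E_\<sigma>[OF that] .
        then show "(\<lambda>i\<in>?J. t (\<sigma> i)) \<in> ?I" by auto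
        have "t (inv' \<sigma> i) \<in> E i" if "i \<in> ?J" for i
          using PiE_mem[OF t \<sigma>'J[OF that]] unfolding E_\<sigma>'[OF that] .
        then show "(\<lambda>i\<in>?J. t (inv' \<sigma> i)) \<in> ?I" by auto
        show "(\<Prod>i\<in>?J. A p i ((\<lambda>i\<in>?J. t (\<sigma> i)) (inv' \<sigma> i)) * C q i ((\<lambda>i\<in>?J. t (\<sigma> i)) (inv' \<sigma> i))) =
            (\<Prod>i\<in>?J. A p i (t i) * C q i (t i))"
          using \<sigma>'J by (intro prod.cong) (simp_all add: \<sigma>_inv)
      qed
      also have "\<dots> = mmul ?I (Q g) (Q h) p q"
        unfolding mmul_def
      proof (rule sum.cong[OF refl])
        fix t assume t: "t \<in> ?I"
        have "(\<Prod>j\<in>?J. P (r j) (s h j) (t j) (q (inv' \<tau> j))) =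
            (\<Prod>i\<in>?J. P (r (inv' \<sigma> i)) (s h (inv' \<sigma> i)) (t (inv' \<sigma> i)) (q (inv' \<tau> (inv' \<sigma> i))))"
          by (rule prod.reindex_bij_betw[OF permutes_imp_bij[OF permutes_inv[OF \<sigma>]], symmetric])
        also have "\<dots> = (\<Prod>i\<in>?J. C q i (t (inv' \<sigma> i)))"
          using key[OF g] by (intro prod.cong refl) (simp add: C_def gh)
        finally show "(\<Prod>i\<in>?J. A p i (t (inv' \<sigma> i)) * C q i (t (inv' \<sigma> i))) = Q g p t * Q h t q"
          using pq t by (simp add: Q_def A_def gh prod.distrib)
      qed
      finally show "Q (g \<otimes>\<^bsub>?G\<^esub> h) p q = mmul ?I (Q g) (Q h) p q" .
    qed
  qed
  \<comment> \<open>Back from the tensor basis to the coordinates of \<open>X\<close>.\<close>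
  define R where "R g = mmul ?I (mmul ?I V (Q g)) V'" for g
  have VV: "V \<in> mats {..<D} ?I" "V' \<in> mats ?I {..<D}" using V V' by (auto simp: hom_mats_def)
  have finI: "finite ?I" by (intro finite_PiE finE) simp
  have R_N: "R (x, id) = \<rho> (x, id)" if x: "x \<in> carrier ?P" for x
  proof -
    have "mmul ?I V (Q (x, id)) = mmul {..<D} (\<rho>' x) V"
      using V(1) x unfolding Q_N[OF x] by (simp add: hom_mats_def)
    then have "R (x, id) = mmul {..<D} (\<rho>' x) (mmul ?I V V')" by (simp add: R_def mmul_assoc)
    then show ?thesis
      unfolding V'(3) using mmul_idm_right[OF _ PR.rho_mats[OF x]] by (simp add: \<rho>'_def)
  qed
  have "mat_rep (?G\<lparr>carrier := ?S\<rparr>) {..<D} R"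
  proof -
    have "R (g \<otimes>\<^bsub>?G\<^esub> h) = mmul {..<D} (R g) (R h)" if "g \<in> ?S" "h \<in> ?S" for g h
    proof -
      have "mmul {..<D} (R g) (R h) = mmul ?I V (mmul ?I (Q g) (mmul ?I (mmul {..<D} V' V) (mmul ?I (Q h) V')))"
        by (simp add: R_def mmul_assoc)
      also have "mmul ?I (mmul {..<D} V' V) (mmul ?I (Q h) V') = mmul ?I (Q h) V'"
        unfolding V'(2) by (rule mmul_idm_left[OF finI mmul_mats[OF Q_mats VV(2)]])
      finally show ?thesis by (simp add: R_def Q_mult[OF that] mmul_assoc)
    qed
    moreover have "R \<one>\<^bsub>?G\<^esub> = idm {..<D}"
    proof -
      have "\<one>\<^bsub>?P\<^esub> = \<one>\<^bsub>power_group B n\<^esub>" by simp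
      moreover have "\<one>\<^bsub>?P\<^esub> \<in> carrier ?P" by simp
      ultimately show ?thesis
        using R_N[of "\<one>\<^bsub>?P\<^esub>"] \<rho>(1) by (simp add: wreath_one mat_rep_def)
    qed
    moreover have "R g \<in> mats {..<D} {..<D}" for g
      unfolding R_def by (intro mmul_mats[OF mmul_mats[OF VV(1) Q_mats] VV(2)])
    ultimately show ?thesis by (simp add: mat_rep_def)
  qed
  from module_by_matrices[OF vs X.finite_dimensional f this]
  obtain Y where Y: "kG_module (?G\<lparr>carrier := ?S\<rparr>) Y"
    and Y_def: "Y = X\<lparr>act := \<lambda>g v. inv_into (carrier X) f (act (matmod D R) g (f v))\<rparr>" by blast
  have "act Y y v = act X y v" if y: "y \<in> N" and v: "v \<in> carrier X" for y v
  proof -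
    obtain x where x: "y = (x, id)" "x \<in> carrier ?P" using y by (cases y) (auto simp: N_iff simp del: carrier_product_group)
    have "act X y v \<in> carrier X"
      using X.act_closed y v by simp
    moreover have "act (matmod D R) y (f v) = f (act X y v)"
      using \<rho>(2) y v R_N[OF x(2)] unfolding x(1) by (simp add: equivariant_def)
    ultimately show ?thesis by (simp add: Y_def coords_inv_left[OF f] del: matmod_simps(5))
  qed
  then have "kG_isomorphic ?N Y X"
    unfolding kG_isomorphic_def
    by (intro bexI[of _ id]) (auto simp: Y_def LinearCombinations.module_hom_def simp del: matmod_simps(5))
  then show ?thesis using Y unfolding extends_to_stabilizer_def by blast
qed

theorem theorem2p4:
  fixes H :: "'h monoid" and A :: "'a monoid" and \<theta> :: "'a \<Rightarrow> 'h \<Rightarrow> 'h" and n :: nat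
  assumes "group H" and "finite (carrier H)"
    and "group A" and "finite (carrier A)"
    and "\<theta> \<in> hom A (AutoGroup H)"
    and "n > 0"
    and "\<forall>X\<^sub>0 :: ('k :: alg_closed_field, 'k vec, 'h \<times> 'a) kG_record.
           kG_simple ((semidirect H A \<theta>)\<lparr>carrier := normal_factor H A\<rparr>) X\<^sub>0
             \<longrightarrow> extends_to_stabilizer (semidirect H A \<theta>) (normal_factor H A) X\<^sub>0"
  shows "\<forall>X :: ('k, 'v, (nat \<Rightarrow> 'h \<times> 'a) \<times> (nat \<Rightarrow> nat)) kG_record.
           kG_simple ((wreath_sym (semidirect H A \<theta>) n)\<lparr>carrier := power_factor H A n\<rparr>) X
             \<longrightarrow> extends_to_stabilizer (wreath_sym (semidirect H A \<theta>) n) (power_factor H A n) X"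
proof (intro allI impI)
  fix X :: "('k, 'v, (nat \<Rightarrow> 'h \<times> 'a) \<times> (nat \<Rightarrow> nat)) kG_record"
  assume X: "kG_simple ((wreath_sym (semidirect H A \<theta>) n)\<lparr>carrier := power_factor H A n\<rparr>) X"
  show "extends_to_stabilizer (wreath_sym (semidirect H A \<theta>) n) (power_factor H A n) X"
  proof (rule extends_to_stabilizer_wreath[OF normal_factor_normal[OF assms(1,3,5)] _ _
        power_factor_normal[OF assms(1,3,5)] _ X])
    show "finite (normal_factor H A)" using assms(2) by (simp add: normal_factor_def)
    show "power_factor H A n = (\<Pi>\<^sub>E i\<in>{1..n}. normal_factor H A) \<times> {id}"
      by (simp add: power_factor_def sym_group_one)
  qed (use assms(7) in blast)
qed

end
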